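(* Let $X$ be a Banach space and suppose that the linear equation $v'=A(t)v$ admits a nonuniform $\mu$-dichotomy in $\mathbb{R}^+_0$ for some constants $D\ge 1$, $a<0\le b$ and $\varepsilon>0$, and that $$a+\varepsilon<b.$$ Then for all sufficiently small $\delta>0$ (that is, there is $\delta_0>0$ such that for every $0<\delta\le\delta_0$) the following holds. Let $f\colon\mathbb{R}^+_0\times X\to X$ be a function of class $C^1$ such that for every $t\ge 0$ and $u,v\in X$ $$f(t,0)=0,\qquad \partial f(t,0)=0,$$ $$\|\partial f(t,u)\|\le\delta\,\mu'(t)\,\mu(t)^{-3\varepsilon-1},$$ $$\|\partial f(t,u)-\partial f(t,v)\|\le\delta\,\mu'(t)\,\mu(t)^{-3\varepsilon-1}\|u-v\|.$$ Then there exists a unique function $\phi\in\mathcal{X}$ such that $$\Psi_\tau(\mathcal{V}_\phi)\subseteq\mathcal{V}_\phi\quad\text{for every }\tau\ge 0.$$ Furthermore: a) $\mathcal{V}_\phi$ is a $C^1$ manifold with $T_{(s,0)}\mathcal{V}_\phi=\mathbb{R}\times E(s)$ for $s\ge 0$; b) there is $K>0$ such that for every $(s,\xi),(s,\bar\xi)\in G$ and every $t\ge s$ $$\|\Psi_{t-s}(p_{s,\xi})-\Psi_{t-s}(p_{s,\bar\xi})\|\le K\left[\frac{\mu(t)}{\mu(s)}\right]^a\mu(s)^{\varepsilon}\|\xi-\bar\xi\|,$$ $$\|\partial(\Psi_{t-s}(p_{s,\xi}))-\partial(\Psi_{t-s}(p_{s,\bar\xi}))\|\le K\left[\frac{\mu(t)}{\mu(s)}\right]^a\mu(s)^{2\varepsilon}\|\xi-\bar\xi\|,$$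 where $p_{s,\xi}=(s,\xi,\phi(s,\xi))$.
   Context: Linear equation. $B(X)$ is the space of bounded linear operators on the Banach space $X$, and $A\colon\mathbb{R}^+_0\to B(X)$ is a $C^1$ function, where $\mathbb{R}^+_0=[0,+\infty[$. All solutions of $v'=A(t)v$, $v(s)=v_s$ ($s\ge0$, $v_s\in X$) are assumed global, and $T(t,s)$ denotes the evolution operator: $v(t)=T(t,s)v_s$ for $t,s\ge 0$. Growth rate. $\mu\colon\mathbb{R}^+_0\to[1,+\infty[$ is an increasing differentiable function with $\lim_{t\to+\infty}\mu(t)=+\infty$. Dichotomy. $v'=A(t)v$ admits a nonuniform $\mu$-dichotomy in $\mathbb{R}^+_0$ with constants $D\ge1$, $a<0\le b$, $\varepsilon\ge0$ if for each $t\ge0$ there is a projection $P(t)$ on $X$ such that $P(t)T(t,s)=T(t,s)P(s)$ for all $t,s\ge0$ and, for every $t\ge s\ge0$, $$\|T(t,s)P(s)\|\le D\left[\frac{\mu(t)}{\mu(s)}\right]^a\mu(s)^\varepsilon,\qquad \|T(t,s)^{-1}Q(t)\|\le D\left[\frac{\mu(t)}{\mu(s)}\right]^{-b}\mu(t)^\varepsilon,$$ where $Q(t)=\mathrm{Id}-P(t)$. Put $E(t)=P(t)X$ and $F(t)=Q(t)X$. The spaces $E(t)\times F(t)$ and $E(t)\oplus F(t)=X$ are identified and equipped with the norm $\|(x,y)\|=\|x\|+\|y\|$, $(x,y)\in E(t)\times F(t)$. Derivatives. $\partial$ denotes the partial derivative with respect to the second variable (for $f(t,u)$, with respect to $u$;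 for $\phi(s,\xi)$, with respect to $\xi$). $\partial(\Psi_{t-s}(p_{s,\xi}))$ denotes the derivative with respect to $\xi\in E(s)$ of the map $\xi\mapsto\Psi_{t-s}(p_{s,\xi})$. The set $G$ and the space $\mathcal{X}$. $G=\bigcup_{t\ge0}\{t\}\times E(t)$. $\mathcal{X}$ is the space of $C^1$ functions $\phi\colon G\to X$ such that for all $(s,\xi),(s,\bar\xi)\in G$: $\phi(s,\xi)\in F(s)$; $\phi(s,0)=0$ and $\partial\phi(s,0)=0$; $\|\partial\phi(s,\xi)\|\le1$; $\|\partial\phi(s,\xi)-\partial\phi(s,\bar\xi)\|\le\|\xi-\bar\xi\|$. For $\phi\in\mathcal{X}$, its graph is $\mathcal{V}_\phi=\{(s,\xi,\phi(s,\xi)):(s,\xi)\in G\}$. Semiflow. For $s\ge0$ and $v_s=(\xi,\eta)\in E(s)\times F(s)$, write the unique solution of $v'=A(t)v+f(t,v)$, $v(s)=v_s$, as $(x(t,s,v_s),y(t,s,v_s))\in E(t)\times F(t)$. For $\tau\ge0$, $\Psi_\tau(s,v_s)=(s+\tau,\,x(s+\tau,s,v_s),\,y(s+\tau,s,v_s))$. *)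

theory Defs
  imports "HOL-Analysis.Analysis"
begin

text \<open>
  Class \<open>C\<^sup>1\<close> on a set that need not be open: the derivative within \<open>S\<close> exists at every point of
  \<open>S\<close> and can be chosen continuously in the operator norm. It is used for open sets, for
  \<open>[0,\<infinity>)\<close> and \<open>[0,\<infinity>) \<times> X\<close> (one-sided derivative at \<open>0\<close>), and for the bundle \<open>G\<close> below. The
  derivative within \<open>G\<close> is determined only on vectors tangent to \<open>G\<close>; since
  \<open>(t, v) \<mapsto> (t, P(t) v)\<close> is a \<open>C\<^sup>1\<close> retraction of \<open>[0,\<infinity>) \<times> X\<close> onto \<open>G\<close>, a continuous choice of it
  exists iff the map is \<open>C\<^sup>1\<close> in the bundle chart \<open>(t, w) \<mapsto> (t, T(t,0) w)\<close>, \<open>w \<in> E(0)\<close>.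
\<close>

definition C1_on :: "'a::real_normed_vector set \<Rightarrow> ('a \<Rightarrow> 'b::real_normed_vector) \<Rightarrow> bool" where
  "C1_on S f \<longleftrightarrow>
     (\<exists>f' :: 'a \<Rightarrow> 'a \<Rightarrow>\<^sub>L 'b. continuous_on S f' \<and>
        (\<forall>x\<in>S. (f has_derivative blinfun_apply (f' x)) (at x within S)))"

text \<open>
  Norm of the restriction to the subspace \<open>V\<close> of a bounded linear map \<open>L\<close>, with the norm \<open>N\<close> on
  the codomain; \<open>onorm\<close> is the case \<open>V = UNIV\<close>, \<open>N = norm\<close>. It is needed because
  \<open>frechet_derivative g (at \<xi> within V)\<close> is determined only on \<open>V\<close>.
\<close>

definition onorm_on ::
    "('b \<Rightarrow> real) \<Rightarrow> 'a::real_normed_vector set \<Rightarrow> ('a \<Rightarrow> 'b) \<Rightarrow> real" where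
  "onorm_on N V L = (SUP x\<in>V. N (L x) / norm x)"

text \<open>
  Split \<open>C\<^sup>1\<close> submanifold, possibly with boundary: near each point a \<open>C\<^sup>1\<close> diffeomorphism of open
  sets of the ambient space carries \<open>M\<close> to a complemented closed subspace, the range of \<open>\<pi>\<close>, or to
  a half-space \<open>{l \<ge> 0}\<close> of it. The functional \<open>l\<close> may vanish, which gives the charts without
  boundary.
\<close>

definition C1_submanifold :: "'z::real_normed_vector set \<Rightarrow> bool" where
  "C1_submanifold M \<longleftrightarrow>
     (\<forall>p\<in>M. \<exists>U W h g. \<exists>(\<pi> :: 'z \<Rightarrow>\<^sub>L 'z) (l :: 'z \<Rightarrow>\<^sub>L real).
        open U \<and> p \<in> U \<and> open W \<and> homeomorphism U W h g \<and> C1_on U h \<and> C1_on W g \<and>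
        \<pi> o\<^sub>L \<pi> = \<pi> \<and> h ` (U \<inter> M) = {w \<in> W. w \<in> range \<pi> \<and> 0 \<le> l w})"

text \<open>
  At a boundary point the initial velocities of curves in \<open>M\<close> fill only a half-space of the tangent
  space; the span makes it the full tangent space. At other points the span changes nothing.
\<close>

definition tangent_space :: "'z::real_normed_vector set \<Rightarrow> 'z \<Rightarrow> 'z set" where
  "tangent_space M p =
     span {v. \<exists>\<gamma> e. 0 < e \<and> C1_on {0..e} \<gamma> \<and> \<gamma> ` {0..e} \<subseteq> M \<and> \<gamma> 0 = p \<and>
                (\<gamma> has_vector_derivative v) (at 0 within {0..e})}"

definition evolution_operator ::
    "(real \<Rightarrow> 'a::banach \<Rightarrow>\<^sub>L 'a) \<Rightarrow> (real \<Rightarrow> real \<Rightarrow> 'a \<Rightarrow>\<^sub>L 'a) \<Rightarrow> bool" where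
  "evolution_operator A T \<longleftrightarrow>
     (\<forall>s\<ge>0. \<forall>v. T s s v = v \<and>
        (\<forall>t\<ge>0. ((\<lambda>r. T r s v) has_vector_derivative A t (T t s v)) (at t within {0..})))"

definition growth_rate :: "(real \<Rightarrow> real) \<Rightarrow> bool" where
  "growth_rate \<mu> \<longleftrightarrow>
     (\<forall>t\<ge>0. 1 \<le> \<mu> t) \<and> mono_on {0..} \<mu> \<and> \<mu> differentiable_on {0..} \<and> filterlim \<mu> at_top at_top"

definition compl_proj :: "(real \<Rightarrow> 'a::banach \<Rightarrow>\<^sub>L 'a) \<Rightarrow> real \<Rightarrow> 'a \<Rightarrow>\<^sub>L 'a" where
  "compl_proj P t = id_blinfun - P t"

definition mu_dichotomy ::
    "(real \<Rightarrow> real \<Rightarrow> 'a::banach \<Rightarrow>\<^sub>L 'a) \<Rightarrow> (real \<Rightarrow> real) \<Rightarrow> (real \<Rightarrow> 'a \<Rightarrow>\<^sub>L 'a) \<Rightarrow>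
     real \<Rightarrow> real \<Rightarrow> real \<Rightarrow> real \<Rightarrow> bool" where
  "mu_dichotomy T \<mu> P D a b \<epsilon> \<longleftrightarrow>
     1 \<le> D \<and> a < 0 \<and> 0 \<le> b \<and> 0 \<le> \<epsilon> \<and>
     (\<forall>t\<ge>0. P t o\<^sub>L P t = P t) \<and>
     (\<forall>t\<ge>0. \<forall>s\<ge>0. P t o\<^sub>L T t s = T t s o\<^sub>L P s) \<and>
     (\<forall>s\<ge>0. \<forall>t\<ge>s.
        norm (T t s o\<^sub>L P s) \<le> D * (\<mu> t / \<mu> s) powr a * \<mu> s powr \<epsilon> \<and>
        onorm (inv (blinfun_apply (T t s)) \<circ> blinfun_apply (compl_proj P t))
          \<le> D * (\<mu> t / \<mu> s) powr (- b) * \<mu> t powr \<epsilon>)"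

definition Esp :: "(real \<Rightarrow> 'a::banach \<Rightarrow>\<^sub>L 'a) \<Rightarrow> real \<Rightarrow> 'a set" where
  "Esp P t = range (P t)"

definition Fsp :: "(real \<Rightarrow> 'a::banach \<Rightarrow>\<^sub>L 'a) \<Rightarrow> real \<Rightarrow> 'a set" where
  "Fsp P t = range (compl_proj P t)"

definition Gset :: "(real \<Rightarrow> 'a::banach \<Rightarrow>\<^sub>L 'a) \<Rightarrow> (real \<times> 'a) set" where
  "Gset P = Sigma {0..} (Esp P)"

definition dphi :: "(real \<Rightarrow> 'a::banach \<Rightarrow>\<^sub>L 'a) \<Rightarrow> (real \<times> 'a \<Rightarrow> 'a) \<Rightarrow> real \<Rightarrow> 'a \<Rightarrow> 'a \<Rightarrow> 'a" where
  "dphi P \<phi> s \<xi> = frechet_derivative (\<lambda>x. \<phi> (s, x)) (at \<xi> within Esp P s)"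

text \<open>
  The extensional product makes the elements genuine functions on \<open>G\<close>, so that two of them are
  equal iff they agree on \<open>G\<close>.
\<close>

definition Xspace :: "(real \<Rightarrow> 'a::banach \<Rightarrow>\<^sub>L 'a) \<Rightarrow> (real \<times> 'a \<Rightarrow> 'a) set" where
  "Xspace P =
     {\<phi> \<in> (\<Pi>\<^sub>E p\<in>Gset P. Fsp P (fst p)). C1_on (Gset P) \<phi> \<and>
        (\<forall>s\<ge>0. \<phi> (s, 0) = 0 \<and> (\<forall>h\<in>Esp P s. dphi P \<phi> s 0 h = 0)) \<and>
        (\<forall>s\<ge>0. \<forall>\<xi>\<in>Esp P s. onorm_on norm (Esp P s) (dphi P \<phi> s \<xi>) \<le> 1) \<and>
        (\<forall>s\<ge>0. \<forall>\<xi>\<in>Esp P s. \<forall>\<xi>'\<in>Esp P s.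
           onorm_on norm (Esp P s) (\<lambda>h. dphi P \<phi> s \<xi> h - dphi P \<phi> s \<xi>' h) \<le> norm (\<xi> - \<xi>'))}"

definition lift :: "(real \<times> 'a \<Rightarrow> 'a) \<Rightarrow> real \<Rightarrow> 'a \<Rightarrow> real \<times> 'a \<times> 'a" where
  "lift \<phi> s \<xi> = (s, \<xi>, \<phi> (s, \<xi>))"

definition graph_of :: "(real \<Rightarrow> 'a::banach \<Rightarrow>\<^sub>L 'a) \<Rightarrow> (real \<times> 'a \<Rightarrow> 'a) \<Rightarrow> (real \<times> 'a \<times> 'a) set" where
  "graph_of P \<phi> = (\<lambda>(s, \<xi>). lift \<phi> s \<xi>) ` Gset P"

text \<open>
  The identification of \<open>E(s) \<times> F(s)\<close> with \<open>X = E(s) \<oplus> F(s)\<close>, and the norm of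
  \<open>E(s) \<times> F(s)\<close>, extended to phase space (the time component vanishes wherever it is applied).
\<close>

definition ident :: "real \<times> 'a \<times> 'a \<Rightarrow> real \<times> 'a::banach" where
  "ident = (\<lambda>(s, x, y). (s, x + y))"

definition sum_norm :: "real \<times> 'a \<times> 'a::banach \<Rightarrow> real" where
  "sum_norm = (\<lambda>(r, x, y). \<bar>r\<bar> + norm x + norm y)"

definition admissible_perturbation ::
    "(real \<Rightarrow> real) \<Rightarrow> real \<Rightarrow> real \<Rightarrow> (real \<Rightarrow> 'a::banach \<Rightarrow> 'a) \<Rightarrow> bool" where
  "admissible_perturbation \<mu> \<epsilon> \<delta> f \<longleftrightarrow>
     C1_on ({0..} \<times> UNIV) (\<lambda>(t, v). f t v) \<and>
     (\<forall>t\<ge>0. let c = \<delta> * vector_derivative \<mu> (at t within {0..}) * \<mu> t powr (- 3 * \<epsilon> - 1) in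
        f t 0 = 0 \<and> frechet_derivative (f t) (at 0) = (\<lambda>h. 0) \<and>
        (\<forall>u. onorm (frechet_derivative (f t) (at u)) \<le> c) \<and>
        (\<forall>u v. onorm (\<lambda>h. frechet_derivative (f t) (at u) h - frechet_derivative (f t) (at v) h)
                 \<le> c * norm (u - v)))"

definition solves ::
    "(real \<Rightarrow> 'a::banach \<Rightarrow>\<^sub>L 'a) \<Rightarrow> (real \<Rightarrow> 'a \<Rightarrow> 'a) \<Rightarrow> real \<Rightarrow> 'a \<Rightarrow> (real \<Rightarrow> 'a) \<Rightarrow> bool" where
  "solves A f s v\<^sub>s v \<longleftrightarrow>
     v s = v\<^sub>s \<and>
     (\<forall>t\<ge>s. (v has_vector_derivative A t (v t) + f t (v t)) (at t within {s..}))"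

text \<open>
  For admissible \<open>f\<close> the solution on \<open>[s,\<infinity>)\<close> exists and is unique, because \<open>f(t, \<cdot>)\<close> is
  Lipschitz with a constant that is integrable on bounded intervals.
\<close>

definition sol ::
    "(real \<Rightarrow> 'a::banach \<Rightarrow>\<^sub>L 'a) \<Rightarrow> (real \<Rightarrow> 'a \<Rightarrow> 'a) \<Rightarrow> real \<Rightarrow> 'a \<Rightarrow> real \<Rightarrow> 'a" where
  "sol A f s v\<^sub>s t = (THE x. \<exists>v. solves A f s v\<^sub>s v \<and> v t = x)"

definition semiflow ::
    "(real \<Rightarrow> 'a::banach \<Rightarrow>\<^sub>L 'a) \<Rightarrow> (real \<Rightarrow> 'a \<Rightarrow> 'a) \<Rightarrow> (real \<Rightarrow> 'a \<Rightarrow>\<^sub>L 'a) \<Rightarrow> real \<Rightarrow>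
     real \<times> 'a \<times> 'a \<Rightarrow> real \<times> 'a \<times> 'a" where
  "semiflow A f P \<tau> = (\<lambda>(s, \<xi>, \<eta>).
     let v = sol A f s (\<xi> + \<eta>) (s + \<tau>) in (s + \<tau>, P (s + \<tau>) v, compl_proj P (s + \<tau>) v))"

definition invariant_graph ::
    "(real \<Rightarrow> 'a::banach \<Rightarrow>\<^sub>L 'a) \<Rightarrow> (real \<Rightarrow> 'a \<Rightarrow> 'a) \<Rightarrow> (real \<Rightarrow> 'a \<Rightarrow>\<^sub>L 'a) \<Rightarrow>
     (real \<times> 'a \<Rightarrow> 'a) \<Rightarrow> bool" where
  "invariant_graph A f P \<phi> \<longleftrightarrow> (\<forall>\<tau>\<ge>0. semiflow A f P \<tau> ` graph_of P \<phi> \<subseteq> graph_of P \<phi>)"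

definition flow_on_graph ::
    "(real \<Rightarrow> 'a::banach \<Rightarrow>\<^sub>L 'a) \<Rightarrow> (real \<Rightarrow> 'a \<Rightarrow> 'a) \<Rightarrow> (real \<Rightarrow> 'a \<Rightarrow>\<^sub>L 'a) \<Rightarrow>
     (real \<times> 'a \<Rightarrow> 'a) \<Rightarrow> real \<Rightarrow> real \<Rightarrow> 'a \<Rightarrow> real \<times> 'a \<times> 'a" where
  "flow_on_graph A f P \<phi> t s \<xi> = semiflow A f P (t - s) (lift \<phi> s \<xi>)"

definition dflow_on_graph ::
    "(real \<Rightarrow> 'a::banach \<Rightarrow>\<^sub>L 'a) \<Rightarrow> (real \<Rightarrow> 'a \<Rightarrow> 'a) \<Rightarrow> (real \<Rightarrow> 'a \<Rightarrow>\<^sub>L 'a) \<Rightarrow>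
     (real \<times> 'a \<Rightarrow> 'a) \<Rightarrow> real \<Rightarrow> real \<Rightarrow> 'a \<Rightarrow> 'a \<Rightarrow> real \<times> 'a \<times> 'a" where
  "dflow_on_graph A f P \<phi> t s \<xi> =
     frechet_derivative (flow_on_graph A f P \<phi> t s) (at \<xi> within Esp P s)"

end

theory Submission
  imports Defs
begin

text \<open>
  The stable manifold is found by the Lyapunov--Perron method. Call a solution starting at time \<open>s\<close>
  decaying if it is \<open>O((\<mu> t / \<mu> s) powr a)\<close>. A decaying solution of \<open>v' = A(t) v + g(t)\<close> is determined
  by \<open>g\<close> and the stable component of its initial value, because its unstable component has to be
  propagated backward from infinity, where the gap \<open>a + \<epsilon> < b\<close> makes the boundary term vanish
  (\<open>forced_solution_bounds\<close>). The hypotheses on \<open>f\<close> are tuned to the dichotomy: a factor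
  \<open>\<mu> powr \<epsilon>\<close> is lost to nonuniformity in each use of the dichotomy, and \<open>\<mu>' \<mu> powr (- 3 \<epsilon> - 1)\<close> times
  \<open>\<mu> powr \<epsilon>\<close> is still a multiple of the derivative of \<open>- \<mu> powr (- 2 \<epsilon>)\<close> (\<open>green_bound\<close>). So for small
  \<open>\<delta>\<close> the nonlinear equation, and its linearization along any solution, are solved by contraction:
  for every \<open>\<xi> \<in> E(s)\<close> there is exactly one decaying solution with stable initial component \<open>\<xi>\<close>
  (\<open>decaying_solution_exists\<close>, \<open>decaying_solution_unique\<close>). Its unstable initial component is
  \<open>\<phi>(s, \<xi>)\<close>.

  Since a solution that decays from \<open>s\<close> decays from every later time, the graph of \<open>\<phi>\<close> is invariant.
  Conversely, on an invariant graph of an element of the function space the unstable component is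
  dominated by the stable one, and this forces decay (\<open>solution_on_graph_decays\<close>); hence \<open>\<phi>\<close> is
  unique. Differences and linearization remainders of decaying solutions satisfy linear equations
  with small or quadratic forcing, so the same a priori estimate yields differentiability in \<open>\<xi>\<close>,
  the bounds required of \<open>\<partial>\<phi>\<close> and the estimates for the flow on the graph
  (\<open>stable_solution_remainder\<close>, \<open>dstable_lipschitz\<close>). The factor \<open>\<rho> s = \<mu> s powr (- 2 \<epsilon>)\<close> gained at
  the initial time is what makes the bounds on \<open>\<partial>\<phi>\<close> independent of \<open>s\<close>.

  Joint continuous differentiability of \<open>\<phi>\<close> is proved in the coordinates \<open>z = T(0,t) v\<close>, where the
  linear part disappears and the bundle \<open>G\<close> becomes the product of \<open>[0,\<infinity>)\<close> and \<open>E(0)\<close>; there \<open>\<phi>\<close> turns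
  into \<open>psi\<close>. A solution moving inside the graph compares \<open>psi\<close> at neighbouring times, and because the
  derivatives in \<open>z\<close> are Lipschitz, closeness of the functions gives closeness of the derivatives
  (\<open>derivative_close\<close>). The same coordinates straighten the graph: \<open>(t, z) \<mapsto> (t, z - psi (t, z))\<close> maps it
  onto \<open>[0,\<infinity>) \<times> E(0)\<close>. Reflection in the time variable extends this map to negative times and makes it
  a single global chart with boundary.
\<close>

section \<open>Comparison of derivatives and Gronwall estimates\<close>

lemma norm_increment_le:
  fixes f :: "real \<Rightarrow> 'b::real_normed_vector" and g :: "real \<Rightarrow> real"
  assumes "a \<le> b" and sub: "{a..b} \<subseteq> S"
    and f: "\<And>x. x \<in> {a..b} \<Longrightarrow> (f has_vector_derivative f' x) (at x within S)"
    and g: "\<And>x. x \<in> {a..b} \<Longrightarrow> (g has_vector_derivative g' x) (at x within S)"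
    and le: "\<And>x. x \<in> {a..b} \<Longrightarrow> norm (f' x) \<le> g' x"
  shows "norm (f b - f a) \<le> g b - g a"
proof (cases "a = b")
  case True
  then show ?thesis by simp
next
  case False
  then have "a < b" using \<open>a \<le> b\<close> by simp
  have f1: "(f has_vector_derivative f' x) (at x within {a..b})" if "x \<in> {a..b}" for x
    using has_vector_derivative_within_subset[OF f[OF that] sub] .
  have g1: "(g has_vector_derivative g' x) (at x within {a..b})" if "x \<in> {a..b}" for x
    using has_vector_derivative_within_subset[OF g[OF that] sub] .
  show ?thesis
  proof (rule differentiable_bound_general[OF \<open>a < b\<close>, of f g f' g'])
    show "continuous_on {a..b} f"
      using f1 by (rule continuous_on_vector_derivative)
    show "continuous_on {a..b} g"
      using g1 by (rule continuous_on_vector_derivative)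
    fix x assume x: "a < x" "x < b"
    then show "(f has_vector_derivative f' x) (at x)"
      using f1[of x] at_within_Icc_at[of a x b] by auto
    show "(g has_vector_derivative g' x) (at x)"
      using g1[of x] at_within_Icc_at[of a x b] x by auto
    show "norm (f' x) \<le> g' x" using le[of x] x by auto
  qed
qed

text \<open>
  \<open>norm (d x)\<close> need not be differentiable and \<open>l\<close> is only required to have an antiderivative, so instead of
  an integrating factor or an integral inequality the proof uses the maximum of
  \<open>norm (d x) * exp (- 2 * (\<Gamma> x - \<Gamma> a))\<close>. The factor \<open>2\<close> in the exponent is what this costs.
\<close>

lemma gronwall_forward:
  fixes d :: "real \<Rightarrow> 'b::real_normed_vector"
  assumes "a \<le> b" and sub: "{a..b} \<subseteq> S"
    and d: "\<And>x. x \<in> {a..b} \<Longrightarrow> (d has_vector_derivative d' x) (at x within S)"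
    and G: "\<And>x. x \<in> {a..b} \<Longrightarrow> (\<Gamma> has_vector_derivative l x) (at x within S)"
    and le: "\<And>x. x \<in> {a..b} \<Longrightarrow> norm (d' x) \<le> l x * norm (d x)"
    and l0: "\<And>x. x \<in> {a..b} \<Longrightarrow> 0 \<le> l x"
  shows "norm (d b - d a) \<le> norm (d a) * (exp (2 * (\<Gamma> b - \<Gamma> a)) - 1)"
proof -
  define w where "w x = exp (2 * (\<Gamma> x - \<Gamma> a))" for x
  have dc: "continuous_on {a..b} d"
    using d sub by (metis continuous_on_eq_continuous_within continuous_within_subset
        has_vector_derivative_continuous)
  have Gc: "continuous_on {a..b} \<Gamma>"
    using G sub by (metis continuous_on_eq_continuous_within continuous_within_subset
        has_vector_derivative_continuous)
  have "continuous_on {a..b} (\<lambda>x. norm (d x) / w x)"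
    unfolding w_def by (intro continuous_intros dc Gc) auto
  then obtain c where c: "c \<in> {a..b}" "\<And>x. x \<in> {a..b} \<Longrightarrow> norm (d x) / w x \<le> norm (d c) / w c"
    using continuous_attains_sup[of "{a..b}" "\<lambda>x. norm (d x) / w x"] \<open>a \<le> b\<close> by auto
  define M where "M = norm (d c) / w c"
  have wpos: "w x > 0" for x by (simp add: w_def)
  have M0: "M \<ge> 0" using wpos[of c] by (simp add: M_def)
  have dM: "norm (d x) \<le> M * w x" if "x \<in> {a..b}" for x
    using c(2)[OF that] wpos[of x] by (simp add: M_def[symmetric] divide_le_eq)
  have inc: "norm (d x - d a) \<le> M/2 * (w x - 1)" if x: "x \<in> {a..b}" for x
  proof -
    have "norm (d x - d a) \<le> M/2 * w x - M/2 * w a"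
    proof (rule norm_increment_le[where S = S and f' = d' and g' = "\<lambda>y. l y * (M * w y)"])
      show "a \<le> x" "{a..x} \<subseteq> S" using x sub by auto
      fix y assume y: "y \<in> {a..x}"
      then have y': "y \<in> {a..b}" using x by auto
      show "(d has_vector_derivative d' y) (at y within S)" using d[OF y'] .
      have Gd: "(\<Gamma> has_real_derivative l y) (at y within S)"
        using G[OF y'] by (simp add: has_real_derivative_iff_has_vector_derivative)
      have "((\<lambda>x. M/2 * w x) has_real_derivative l y * (M * w y)) (at y within S)"
        unfolding w_def by (rule derivative_eq_intros refl Gd | simp)+
      then show "((\<lambda>x. M/2 * w x) has_vector_derivative l y * (M * w y)) (at y within S)"
        by (simp add: has_real_derivative_iff_has_vector_derivative)
      show "norm (d' y) \<le> l y * (M * w y)"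
        using le[OF y'] l0[OF y'] dM[OF y'] by (meson mult_left_mono order_trans)
    qed
    also have "w a = 1" by (simp add: w_def)
    finally show ?thesis by (simp add: algebra_simps)
  qed
  have wc: "w c \<ge> 1"
  proof -
    have "norm ((\<lambda>x. 0::real) c - 0) \<le> \<Gamma> c - \<Gamma> a"
      using norm_increment_le[of a c S "\<lambda>x. 0::real" "\<lambda>x. 0" \<Gamma> l] c(1) sub G l0 by force
    then show ?thesis by (simp add: w_def)
  qed
  \<comment> \<open>The weighted maximum is attained at \<open>c\<close>; the increment bound at \<open>c\<close> bounds it by the initial value.\<close>
  have "M * w c = norm (d c)" using wpos[of c] by (simp add: M_def)
  also have "\<dots> \<le> norm (d a) + norm (d c - d a)" by norm
  also have "\<dots> \<le> norm (d a) + M/2 * (w c - 1)" using inc[OF c(1)] by simp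
  finally have "M * (w c + 1) / 2 \<le> norm (d a)"
    by (simp add: distrib_left right_diff_distrib add_divide_distrib diff_divide_distrib)
  moreover have "M * 2 \<le> M * (w c + 1)" using M0 wc by (intro mult_left_mono) auto
  ultimately have "M \<le> norm (d a)" by linarith
  have wb: "w b \<ge> 1"
  proof -
    have "norm ((\<lambda>x. 0::real) b - 0) \<le> \<Gamma> b - \<Gamma> a"
      using norm_increment_le[of a b S "\<lambda>x. 0::real" "\<lambda>x. 0" \<Gamma> l] assms by auto
    then show ?thesis by (simp add: w_def)
  qed
  have "norm (d b - d a) \<le> M/2 * (w b - 1)" using inc[of b] \<open>a \<le> b\<close> by auto
  also have "\<dots> \<le> norm (d a) * (w b - 1)"
    using \<open>M \<le> norm (d a)\<close> M0 wb by (intro mult_right_mono) auto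
  finally show ?thesis by (simp add: w_def)
qed

lemma gronwall_backward:
  fixes d :: "real \<Rightarrow> 'b::real_normed_vector"
  assumes "a \<le> b" and sub: "{a..b} \<subseteq> S"
    and d: "\<And>x. x \<in> {a..b} \<Longrightarrow> (d has_vector_derivative d' x) (at x within S)"
    and G: "\<And>x. x \<in> {a..b} \<Longrightarrow> (\<Gamma> has_vector_derivative l x) (at x within S)"
    and le: "\<And>x. x \<in> {a..b} \<Longrightarrow> norm (d' x) \<le> l x * norm (d x)"
    and l0: "\<And>x. x \<in> {a..b} \<Longrightarrow> 0 \<le> l x"
  shows "norm (d a - d b) \<le> norm (d b) * (exp (2 * (\<Gamma> b - \<Gamma> a)) - 1)"
proof -
  have im: "uminus ` uminus ` S = S" by force
  have neg: "(uminus has_vector_derivative -1) (at x within uminus ` S)" for x :: real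
    by (rule has_vector_derivative_minus[OF has_vector_derivative_id])
  have "norm ((d \<circ> uminus) (-a) - (d \<circ> uminus) (-b)) \<le> norm ((d \<circ> uminus) (-b)) *
     (exp (2 * ((\<lambda>x. - (\<Gamma> \<circ> uminus) x) (-a) - (\<lambda>x. - (\<Gamma> \<circ> uminus) x) (-b))) - 1)"
  proof (rule gronwall_forward[where S = "uminus ` S" and d' = "\<lambda>x. - d' (-x)" and l = "\<lambda>x. l (-x)"])
    show "-b \<le> -a" using \<open>a \<le> b\<close> by simp
    show "{- b..- a} \<subseteq> uminus ` S"
    proof
      fix x assume "x \<in> {- b..- a}"
      then have "- x \<in> S" using sub by auto
      then show "x \<in> uminus ` S" by (rule image_eqI[rotated]) simp
    qed
    fix x assume "x \<in> {-b..-a}"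
    then have x: "-x \<in> {a..b}" by auto
    show "(d \<circ> uminus has_vector_derivative - d' (- x)) (at x within uminus ` S)"
      using vector_diff_chain_within[OF neg, of d "d' (-x)"] d[OF x] by (simp add: im)
    have "(\<Gamma> \<circ> uminus has_vector_derivative - l (- x)) (at x within uminus ` S)"
      using vector_diff_chain_within[OF neg, of \<Gamma> "l (-x)"] G[OF x] by (simp add: im)
    from has_vector_derivative_minus[OF this]
    show "((\<lambda>x. - (\<Gamma> \<circ> uminus) x) has_vector_derivative l (- x)) (at x within uminus ` S)" by simp
    show "norm (- d' (- x)) \<le> l (- x) * norm ((d \<circ> uminus) x)" using le[OF x] by simp
    show "0 \<le> l (-x)" using l0[OF x] .
  qed
  then show ?thesis by simp
qed

lemma gronwall:
  fixes d :: "real \<Rightarrow> 'b::real_normed_vector"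
  assumes d: "\<And>x. 0 \<le> x \<Longrightarrow> (d has_vector_derivative d' x) (at x within {0..})"
    and G: "\<And>x. 0 \<le> x \<Longrightarrow> (\<Gamma> has_vector_derivative l x) (at x within {0..})"
    and le: "\<And>x. 0 \<le> x \<Longrightarrow> norm (d' x) \<le> l x * norm (d x)"
    and l0: "\<And>x. 0 \<le> x \<Longrightarrow> 0 \<le> l x"
    and st: "0 \<le> s" "0 \<le> t"
  shows "norm (d t - d s) \<le> norm (d s) * (exp (2 * \<bar>\<Gamma> t - \<Gamma> s\<bar>) - 1)"
proof -
  have "\<exists>c. \<bar>c\<bar> = \<bar>\<Gamma> t - \<Gamma> s\<bar> \<and> norm (d t - d s) \<le> norm (d s) * (exp (2 * c) - 1)"
  proof (cases "s \<le> t")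
    case True
    show ?thesis
      by (rule exI[of _ "\<Gamma> t - \<Gamma> s"], rule conjI[OF refl gronwall_forward[where S = "{0..}", OF _ _ d G le l0]])
         (use True st in auto)
  next
    case False
    show ?thesis
      by (rule exI[of _ "\<Gamma> s - \<Gamma> t"],
          rule conjI[OF abs_minus_commute gronwall_backward[where S = "{0..}", OF _ _ d G le l0]])
         (use False st in auto)
  qed
  then obtain c where c: "\<bar>c\<bar> = \<bar>\<Gamma> t - \<Gamma> s\<bar>" "norm (d t - d s) \<le> norm (d s) * (exp (2 * c) - 1)" by blast
  have "norm (d s) * (exp (2 * c) - 1) \<le> norm (d s) * (exp (2 * \<bar>c\<bar>) - 1)"
    by (intro mult_left_mono) auto
  then show ?thesis using c by simp
qed

text \<open>
  The form in which the derivative of an inverse operator is obtained as a limit of products of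
  operators.
\<close>

lemma has_vector_derivative_iff_quotient:
  fixes f :: "real \<Rightarrow> 'b::real_normed_vector"
  shows "(f has_vector_derivative f') (at x within S) \<longleftrightarrow>
    ((\<lambda>y. (f y - f x) /\<^sub>R (y - x)) \<longlongrightarrow> f') (at x within S)"
proof -
  have "norm (f y - f x - (y - x) *\<^sub>R f') / norm (y - x) = norm ((f y - f x) /\<^sub>R (y - x) - f')" if "y \<noteq> x" for y
  proof -
    have "(f y - f x) /\<^sub>R (y - x) - f' = inverse (y - x) *\<^sub>R (f y - f x - (y - x) *\<^sub>R f')"
      using that by (simp add: scaleR_diff_right)
    then show ?thesis by (simp add: divide_inverse abs_inverse mult.commute)
  qed
  then have "((\<lambda>y. norm (f y - f x - (y - x) *\<^sub>R f') / norm (y - x)) \<longlongrightarrow> 0) (at x within S) \<longleftrightarrow>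
     ((\<lambda>y. norm ((f y - f x) /\<^sub>R (y - x) - f')) \<longlongrightarrow> 0) (at x within S)"
    by (intro filterlim_cong refl) (auto simp: eventually_at intro!: exI[of _ 1])
  then show ?thesis
    unfolding has_vector_derivative_def has_derivative_iff_norm
    by (simp add: bounded_linear_scaleR_left tendsto_norm_zero_iff LIM_zero_iff)
qed

section \<open>Fixed points in weighted function spaces\<close>

lemma Cauchy_if_tail_bound:
  fixes X :: "nat \<Rightarrow> 'b::real_normed_vector"
  assumes le: "\<And>i j. j \<le> i \<Longrightarrow> norm (X i - X j) \<le> B j" and B: "B \<longlonglongrightarrow> 0"
  shows "Cauchy X"
proof (rule metric_CauchyI)
  fix e :: real assume "0 < e"
  obtain m where m: "B m < e / 2"
    using eventually_happens'[OF sequentially_bot order_tendstoD(2)[OF B, of "e/2"]] \<open>0 < e\<close> by auto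
  have "dist (X i) (X j) < e" if "m \<le> i" "m \<le> j" for i j
  proof -
    have "norm (X i - X m) < e / 2" "norm (X j - X m) < e / 2"
      using le[OF that(1)] le[OF that(2)] m by auto
    then show ?thesis unfolding dist_norm by norm
  qed
  then show "\<exists>M. \<forall>m\<ge>M. \<forall>n\<ge>M. dist (X m) (X n) < e" by blast
qed

definition weighted_on :: "real set \<Rightarrow> (real \<Rightarrow> real) \<Rightarrow> (real \<Rightarrow> 'b::real_normed_vector) \<Rightarrow> bool" where
  "weighted_on S \<omega> u \<longleftrightarrow> continuous_on S u \<and> (\<exists>M. \<forall>t\<in>S. norm (u t) \<le> M * \<omega> t)"

text \<open>
  Banach's fixed point theorem in the space of continuous functions with the norm
  \<open>SUP t\<in>S. norm (u t) / \<omega> t\<close>. Only the values on \<open>S\<close> of elements of this space matter, so it is not a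
  metric space of functions on the whole line, and the Picard iterates are used directly.
\<close>

lemma weighted_fixpoint:
  fixes \<Phi> :: "(real \<Rightarrow> 'b::banach) \<Rightarrow> real \<Rightarrow> 'b"
  assumes \<omega>: "continuous_on S \<omega>" "\<And>t. t \<in> S \<Longrightarrow> \<omega> t > 0"
    and into: "\<And>u. weighted_on S \<omega> u \<Longrightarrow> weighted_on S \<omega> (\<Phi> u)"
    and contr: "\<And>u v N. weighted_on S \<omega> u \<Longrightarrow> weighted_on S \<omega> v \<Longrightarrow> 0 \<le> N \<Longrightarrow>
       (\<And>t. t \<in> S \<Longrightarrow> norm (u t - v t) \<le> N * \<omega> t) \<Longrightarrow>
       (\<And>t. t \<in> S \<Longrightarrow> norm (\<Phi> u t - \<Phi> v t) \<le> N / 2 * \<omega> t)"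
  obtains v where "weighted_on S \<omega> v" "\<And>t. t \<in> S \<Longrightarrow> \<Phi> v t = v t"
proof -
  define x where "x n = (\<Phi> ^^ n) (\<lambda>_. 0)" for n
  have x0: "x 0 = (\<lambda>_. 0)" and xS: "x (Suc n) = \<Phi> (x n)" for n by (simp_all add: x_def)
  have Wx: "weighted_on S \<omega> (x n)" for n
  proof (induction n)
    case 0
    then show ?case by (auto simp: weighted_on_def x0 intro!: exI[of _ 0])
  next
    case (Suc n)
    then show ?case using into by (simp add: xS)
  qed
  obtain N1 where N1: "\<And>t. t \<in> S \<Longrightarrow> norm (x 1 t) \<le> N1 * \<omega> t"
    using Wx[of 1] unfolding weighted_on_def by auto
  define N where "N = max N1 0"
  have N0: "N \<ge> 0" and N: "\<And>t. t \<in> S \<Longrightarrow> norm (x 1 t - x 0 t) \<le> N * \<omega> t"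
    using N1 \<omega>(2) unfolding N_def x0
    by (auto, smt (verit) max.cobounded1 mult_right_mono)
  have step: "norm (x (Suc n) t - x n t) \<le> N / 2^n * \<omega> t" if "t \<in> S" for n t
    using that
  proof (induction n arbitrary: t)
    case 0
    then show ?case using N by simp
  next
    case (Suc n)
    have "norm (\<Phi> (x (Suc n)) t - \<Phi> (x n) t) \<le> (N / 2^n) / 2 * \<omega> t"
      by (rule contr[OF Wx Wx]) (use Suc N0 in auto)
    then show ?case by (simp add: xS field_simps)
  qed
  have tail: "norm (x (n + k) t - x n t) \<le> 2 * N / 2^n * \<omega> t" if "t \<in> S" for n k t
  proof (induction k arbitrary: n)
    case 0
    then show ?case using N0 \<omega>(2)[OF that] by simp
  next
    case (Suc k)
    have "norm (x (n + Suc k) t - x n t) \<le> norm (x (Suc n + k) t - x (Suc n) t) + norm (x (Suc n) t - x n t)"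
      using norm_triangle_ineq[of "x (Suc n + k) t - x (Suc n) t" "x (Suc n) t - x n t"] by simp
    also have "\<dots> \<le> 2 * N / 2^(Suc n) * \<omega> t + N / 2^n * \<omega> t"
      using Suc[of "Suc n"] step[OF that, of n] by linarith
    also have "\<dots> = 2 * N / 2^n * \<omega> t" by (simp add: field_simps)
    finally show ?case .
  qed
  have lim0: "(\<lambda>n. 2 * N / 2^n * c) \<longlonglongrightarrow> 0" for c :: real
  proof -
    have "(\<lambda>n. (2 * N * c) * (1/2)^n) \<longlonglongrightarrow> (2 * N * c) * 0"
      by (intro tendsto_intros) auto
    then show ?thesis by (simp add: field_simps)
  qed
  have "Cauchy (\<lambda>n. x n t)" if t: "t \<in> S" for t
  proof (rule Cauchy_if_tail_bound[OF _ lim0[of "\<omega> t"]])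
    show "norm (x i t - x j t) \<le> 2 * N / 2^j * \<omega> t" if "j \<le> i" for i j
      using tail[OF t, of j "i - j"] that by simp
  qed
  then have conv: "(\<lambda>n. x n t) \<longlonglongrightarrow> lim (\<lambda>n. x n t)" if "t \<in> S" for t
    using that Cauchy_convergent convergent_LIMSEQ_iff by blast
  define v where "v t = lim (\<lambda>n. x n t)" for t
  have vx: "norm (v t - x n t) \<le> 2 * N / 2^n * \<omega> t" if "t \<in> S" for n t
  proof (rule tendsto_upperbound)
    show "((\<lambda>k. norm (x (n + k) t - x n t)) \<longlongrightarrow> norm (v t - x n t)) sequentially"
      using LIMSEQ_ignore_initial_segment[OF conv[OF that], of n]
      by (intro tendsto_intros) (simp add: v_def add.commute)
  qed (use tail[OF that] in auto)
  have "uniform_limit S (\<lambda>n t. inverse (\<omega> t) *\<^sub>R x n t) (\<lambda>t. inverse (\<omega> t) *\<^sub>R v t) sequentially"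
  proof (rule uniform_limitI)
    fix e :: real assume "e > 0"
    have "\<forall>\<^sub>F n in sequentially. 2 * N / 2^n * 1 < e"
      by (rule order_tendstoD(2)[OF lim0]) (use \<open>e > 0\<close> in auto)
    then show "\<forall>\<^sub>F n in sequentially. \<forall>t\<in>S. dist (inverse (\<omega> t) *\<^sub>R x n t) (inverse (\<omega> t) *\<^sub>R v t) < e"
    proof (eventually_elim, intro ballI)
      case (elim n)
      fix t assume t: "t \<in> S"
      have "dist (inverse (\<omega> t) *\<^sub>R x n t) (inverse (\<omega> t) *\<^sub>R v t) = norm (inverse (\<omega> t) *\<^sub>R (x n t - v t))"
        by (simp add: dist_norm scaleR_diff_right)
      also have "\<dots> = norm (v t - x n t) / \<omega> t"
        using \<omega>(2)[OF t] by (simp add: norm_minus_commute divide_inverse)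
      also have "\<dots> \<le> 2 * N / 2^n" using vx[OF t, of n] \<omega>(2)[OF t] by (simp add: divide_le_eq)
      finally show "dist (inverse (\<omega> t) *\<^sub>R x n t) (inverse (\<omega> t) *\<^sub>R v t) < e" using elim by simp
    qed
  qed
  then have "continuous_on S (\<lambda>t. inverse (\<omega> t) *\<^sub>R v t)"
  proof (rule uniform_limit_theorem[rotated])
    show "\<forall>\<^sub>F n in sequentially. continuous_on S (\<lambda>t. inverse (\<omega> t) *\<^sub>R x n t)"
      using Wx \<omega> unfolding weighted_on_def
      by (intro always_eventually allI continuous_intros) (auto simp: less_imp_neq[symmetric])
  qed auto
  then have "continuous_on S (\<lambda>t. \<omega> t *\<^sub>R (inverse (\<omega> t) *\<^sub>R v t))"
    by (rule continuous_on_scaleR[OF \<omega>(1)])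
  then have "continuous_on S v"
    by (rule continuous_on_eq) (use \<omega>(2) in fastforce)
  moreover have "norm (v t) \<le> 2 * N * \<omega> t" if "t \<in> S" for t
    using vx[OF that, of 0] by (simp add: x0)
  ultimately have Wv: "weighted_on S \<omega> v" unfolding weighted_on_def by blast
  have "\<Phi> v t = v t" if t: "t \<in> S" for t
  proof -
    have "norm (\<Phi> v t - x (Suc n) t) \<le> 2 * N / 2^n * \<omega> t" for n
    proof -
      have "norm (\<Phi> v t - \<Phi> (x n) t) \<le> (2 * N / 2^n) / 2 * \<omega> t"
        by (rule contr[OF Wv Wx _ _ t]) (use vx N0 in auto)
      also have "\<dots> \<le> 2 * N / 2^n * \<omega> t"
        using N0 \<omega>(2)[OF t] by (intro mult_right_mono) (auto simp: divide_right_mono)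
      finally show ?thesis by (simp add: xS)
    qed
    then have "(\<lambda>n. \<Phi> v t - x (Suc n) t) \<longlonglongrightarrow> 0"
      by (intro Lim_null_comparison[OF _ lim0[of "\<omega> t"]]) auto
    then have "(\<lambda>n. \<Phi> v t - (\<Phi> v t - x (Suc n) t)) \<longlonglongrightarrow> \<Phi> v t - 0"
      by (intro tendsto_intros)
    then have "(\<lambda>n. x (Suc n) t) \<longlonglongrightarrow> \<Phi> v t" by simp
    moreover have "(\<lambda>n. x (Suc n) t) \<longlonglongrightarrow> v t"
      using conv[OF t] LIMSEQ_Suc by (auto simp: v_def)
    ultimately show ?thesis by (rule LIMSEQ_unique)
  qed
  with Wv show ?thesis using that by blast
qed

section \<open>Initial value problems\<close>

lemma antiderivative_atLeast:
  fixes g :: "real \<Rightarrow> 'b::banach"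
  assumes "continuous_on {a..} g"
  obtains G where "\<And>t. a \<le> t \<Longrightarrow> (G has_vector_derivative g t) (at t within {a..})"
proof
  fix t assume "a \<le> t"
  have "((\<lambda>u. integral {a..u} g) has_vector_derivative g t) (at t within {a..t+1})"
    using \<open>a \<le> t\<close> by (intro integral_has_vector_derivative continuous_on_subset[OF assms]) auto
  moreover have "at t within {a..} = at t within {a..t+1}"
    by (rule at_within_nhd[of t "{..<t+1}"]) auto
  ultimately show "((\<lambda>u. integral {a..u} g) has_vector_derivative g t) (at t within {a..})" by simp
qed

text \<open>
  The reason for the weight \<open>exp (2 * \<bar>\<Gamma> x - \<Gamma> s\<bar>)\<close>: integrating \<open>l\<close> times the weight gains the factor
  \<open>1/2\<close>. This makes the Picard operator a contraction on the whole half-line.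
\<close>

lemma weighted_increment:
  fixes e :: "real \<Rightarrow> 'b::real_normed_vector"
  assumes G: "\<And>x. 0 \<le> x \<Longrightarrow> (\<Gamma> has_vector_derivative l x) (at x within {0..})"
    and l0: "\<And>x. 0 \<le> x \<Longrightarrow> 0 \<le> l x"
    and e: "\<And>x. 0 \<le> x \<Longrightarrow> (e has_vector_derivative e' x) (at x within {0..})"
    and le: "\<And>x. 0 \<le> x \<Longrightarrow> norm (e' x) \<le> l x * (N * exp (2 * \<bar>\<Gamma> x - \<Gamma> s\<bar>))"
    and "0 \<le> s" "0 \<le> t"
  shows "norm (e t - e s) \<le> N / 2 * (exp (2 * \<bar>\<Gamma> t - \<Gamma> s\<bar>) - 1)"
proof -
  have Gr: "(\<Gamma> has_real_derivative l x) (at x within {0..})" if "0 \<le> x" for x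
    using G[OF that] by (simp add: has_real_derivative_iff_has_vector_derivative)
  have mono: "\<Gamma> x \<le> \<Gamma> y" if "0 \<le> x" "x \<le> y" for x y
    using norm_increment_le[of x y "{0..}" "\<lambda>x. 0::real" "\<lambda>x. 0" \<Gamma> l] that G l0 by force
  show ?thesis
  proof (cases "s \<le> t")
    case True
    have "norm (e t - e s) \<le> N/2 * exp (2 * (\<Gamma> t - \<Gamma> s)) - N/2 * exp (2 * (\<Gamma> s - \<Gamma> s))"
    proof (rule norm_increment_le[where S = "{0..}"])
      fix x assume x: "x \<in> {s..t}"
      then have x0: "0 \<le> x" using \<open>0 \<le> s\<close> by auto
      show "(e has_vector_derivative e' x) (at x within {0..})" using e[OF x0] .
      have "((\<lambda>x. N/2 * exp (2 * (\<Gamma> x - \<Gamma> s))) has_real_derivative l x * (N * exp (2 * (\<Gamma> x - \<Gamma> s))))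
         (at x within {0..})"
        by (rule derivative_eq_intros refl Gr x0 | simp)+
      then show "((\<lambda>x. N/2 * exp (2 * (\<Gamma> x - \<Gamma> s))) has_vector_derivative
          l x * (N * exp (2 * (\<Gamma> x - \<Gamma> s)))) (at x within {0..})"
        by (simp add: has_real_derivative_iff_has_vector_derivative)
      show "norm (e' x) \<le> l x * (N * exp (2 * (\<Gamma> x - \<Gamma> s)))"
        using le[OF x0] mono[of s x] x \<open>0 \<le> s\<close> by auto
    qed (use True assms in auto)
    then show ?thesis using mono[of s t] True \<open>0 \<le> s\<close> by (simp add: algebra_simps)
  next
    case False
    have "norm (e s - e t) \<le> - (N/2 * exp (2 * (\<Gamma> s - \<Gamma> s))) - (- (N/2 * exp (2 * (\<Gamma> s - \<Gamma> t))))"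
    proof (rule norm_increment_le[where S = "{0..}"])
      fix x assume x: "x \<in> {t..s}"
      then have x0: "0 \<le> x" using \<open>0 \<le> t\<close> by auto
      show "(e has_vector_derivative e' x) (at x within {0..})" using e[OF x0] .
      have "((\<lambda>x. - (N/2 * exp (2 * (\<Gamma> s - \<Gamma> x)))) has_real_derivative l x * (N * exp (2 * (\<Gamma> s - \<Gamma> x))))
         (at x within {0..})"
        by (rule derivative_eq_intros refl Gr x0 | simp)+
      then show "((\<lambda>x. - (N/2 * exp (2 * (\<Gamma> s - \<Gamma> x)))) has_vector_derivative
          l x * (N * exp (2 * (\<Gamma> s - \<Gamma> x)))) (at x within {0..})"
        by (simp add: has_real_derivative_iff_has_vector_derivative)
      show "norm (e' x) \<le> l x * (N * exp (2 * (\<Gamma> s - \<Gamma> x)))"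
        using le[OF x0] mono[of x s] x \<open>0 \<le> t\<close> by auto
    qed (use False assms in auto)
    then show ?thesis using mono[of t s] False \<open>0 \<le> t\<close> by (simp add: algebra_simps norm_minus_commute)
  qed
qed

text \<open>
  Global solvability forward and backward from \<open>s\<close>. The Lipschitz constant \<open>l\<close> need not be locally
  bounded; an antiderivative is enough.
\<close>

lemma lipschitz_ivp:
  fixes F :: "real \<Rightarrow> 'b::banach \<Rightarrow> 'b"
  assumes G: "\<And>x. 0 \<le> x \<Longrightarrow> (\<Gamma> has_vector_derivative l x) (at x within {0..})"
    and l0: "\<And>x. 0 \<le> x \<Longrightarrow> 0 \<le> l x"
    and cont: "\<And>u. continuous_on {0..} u \<Longrightarrow> continuous_on {0..} (\<lambda>t. F t (u t))"
    and F0: "\<And>t. 0 \<le> t \<Longrightarrow> F t 0 = 0"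
    and lip: "\<And>t u v. 0 \<le> t \<Longrightarrow> norm (F t u - F t v) \<le> l t * norm (u - v)"
    and s: "0 \<le> s"
  obtains v where "v s = v0" "\<And>t. 0 \<le> t \<Longrightarrow> (v has_vector_derivative F t (v t)) (at t within {0..})"
proof -
  define is_int where "is_int u w \<longleftrightarrow> w s = v0 \<and>
      (\<forall>t\<ge>0. (w has_vector_derivative F t (u t)) (at t within {0..}))" for u w
  define \<Phi> where "\<Phi> u = (SOME w. is_int u w)" for u
  have \<Phi>: "is_int u (\<Phi> u)" if u: "continuous_on {0..} u" for u
  proof -
    obtain H where H: "\<And>t. 0 \<le> t \<Longrightarrow> (H has_vector_derivative F t (u t)) (at t within {0..})"
      using antiderivative_atLeast[OF cont[OF u]] by blast
    have "is_int u (\<lambda>t. H t + (v0 - H s))"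
      unfolding is_int_def using H
      by (auto intro!: has_vector_derivative_add_const[THEN iffD2])
    then show ?thesis unfolding \<Phi>_def by (rule someI[of "is_int u"])
  qed
  define \<omega> where "\<omega> t = exp (2 * \<bar>\<Gamma> t - \<Gamma> s\<bar>)" for t
  have \<omega>1: "\<omega> t \<ge> 1" for t by (simp add: \<omega>_def)
  have \<Gamma>c: "continuous_on {0..} \<Gamma>" using G by (intro continuous_on_vector_derivative) auto
  obtain v where v: "weighted_on {0..} \<omega> v" "\<And>t. t \<in> {0..} \<Longrightarrow> \<Phi> v t = v t"
  proof (rule weighted_fixpoint[of "{0..}" \<omega> \<Phi>])
    show "continuous_on {0..} \<omega>" unfolding \<omega>_def by (intro continuous_intros \<Gamma>c)
    show "\<omega> t > 0" for t by (simp add: \<omega>_def)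
  next
    fix u :: "real \<Rightarrow> 'b" assume "weighted_on {0..} \<omega> u"
    then obtain M where uc: "continuous_on {0..} u" and M: "\<And>t. 0 \<le> t \<Longrightarrow> norm (u t) \<le> M * \<omega> t"
      unfolding weighted_on_def by auto
    have M0: "M \<ge> 0" using M[OF s] \<omega>1[of s]
      by (smt (verit) mult_less_0_iff norm_ge_zero)
    note P = \<Phi>[OF uc, unfolded is_int_def]
    have "norm (\<Phi> u t) \<le> (norm v0 + M / 2) * \<omega> t" if t: "0 \<le> t" for t
    proof -
      have "norm (\<Phi> u t - \<Phi> u s) \<le> M / 2 * (exp (2 * \<bar>\<Gamma> t - \<Gamma> s\<bar>) - 1)"
      proof (rule weighted_increment[OF G l0])
        fix x :: real assume x: "0 \<le> x"
        show "norm (F x (u x)) \<le> l x * (M * exp (2 * \<bar>\<Gamma> x - \<Gamma> s\<bar>))"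
          using lip[OF x, of "u x" 0] F0[OF x] mult_left_mono[OF M[OF x] l0[OF x]]
          by (simp add: \<omega>_def)
      qed (use P s t in auto)
      then have "norm (\<Phi> u t) \<le> norm v0 + M / 2 * (\<omega> t - 1)"
        using P norm_triangle_sub[of "\<Phi> u t" "\<Phi> u s"] by (simp add: \<omega>_def)
      also have "\<dots> \<le> norm v0 * \<omega> t + M / 2 * \<omega> t"
        using M0 \<omega>1[of t] mult_left_mono[OF \<omega>1[of t], of "norm v0"]
        by (simp add: algebra_simps diff_divide_distrib)
      finally show ?thesis by (simp add: algebra_simps)
    qed
    moreover have "continuous_on {0..} (\<Phi> u)"
      using P by (intro continuous_on_vector_derivative) auto
    ultimately show "weighted_on {0..} \<omega> (\<Phi> u)" unfolding weighted_on_def by auto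
  next
    fix u v :: "real \<Rightarrow> 'b" and N t :: real
    assume u: "weighted_on {0..} \<omega> u" and v: "weighted_on {0..} \<omega> v" and N: "0 \<le> N"
      and uv: "\<And>t. t \<in> {0..} \<Longrightarrow> norm (u t - v t) \<le> N * \<omega> t" and t: "t \<in> {0..}"
    have Pu: "is_int u (\<Phi> u)" and Pv: "is_int v (\<Phi> v)"
      using u v \<Phi> by (auto simp: weighted_on_def)
    have "norm ((\<Phi> u t - \<Phi> v t) - (\<Phi> u s - \<Phi> v s)) \<le> N / 2 * (exp (2 * \<bar>\<Gamma> t - \<Gamma> s\<bar>) - 1)"
    proof (rule weighted_increment[OF G l0, where e = "\<lambda>t. \<Phi> u t - \<Phi> v t"])
      fix x :: real assume x: "0 \<le> x"
      show "((\<lambda>t. \<Phi> u t - \<Phi> v t) has_vector_derivative F x (u x) - F x (v x)) (at x within {0..})"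
        using Pu Pv x unfolding is_int_def by (intro has_vector_derivative_diff) auto
      show "norm (F x (u x) - F x (v x)) \<le> l x * (N * exp (2 * \<bar>\<Gamma> x - \<Gamma> s\<bar>))"
        using lip[OF x, of "u x" "v x"] mult_left_mono[OF uv l0[OF x], of x] x
        by (simp add: \<omega>_def)
    qed (use s t in auto)
    also have "\<dots> \<le> N / 2 * \<omega> t" using N by (simp add: \<omega>_def algebra_simps)
    finally show "norm (\<Phi> u t - \<Phi> v t) \<le> N / 2 * \<omega> t"
      using Pu Pv by (simp add: is_int_def)
  qed (blast intro: that)
  have vc: "continuous_on {0..} v" using v(1) by (simp add: weighted_on_def)
  have P: "is_int v (\<Phi> v)" by (rule \<Phi>[OF vc])
  show ?thesis
  proof (rule that[of "\<Phi> v"])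
    show "\<Phi> v s = v0" using P by (simp add: is_int_def)
    fix t :: real assume "0 \<le> t"
    then show "(\<Phi> v has_vector_derivative F t (\<Phi> v t)) (at t within {0..})"
      using P v(2)[of t] by (simp add: is_int_def)
  qed
qed

section \<open>Derivatives with quadratic remainder\<close>

lemma lipschitz_derivative_remainder:
  fixes f :: "'b::real_normed_vector \<Rightarrow> 'c::real_normed_vector"
  assumes f: "\<And>x. (f has_derivative blinfun_apply (f' x)) (at x)"
    and lip: "\<And>x. norm (f' x - f' u) \<le> C * norm (x - u)" and "0 \<le> C"
  shows "norm (f v - f u - f' u (v - u)) \<le> C * (norm (v - u))\<^sup>2"
proof -
  have "norm (f v - f u - f' u (v - u)) \<le> norm (v - u) * (C * norm (v - u))"
  proof (rule differentiable_bound_linearization[where S = "closed_segment u v" and f' = "\<lambda>x. blinfun_apply (f' x)"])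
    show "u + t *\<^sub>R (v - u) \<in> closed_segment u v" if "t \<in> {0..1}" for t
      using that by (auto simp: closed_segment_def algebra_simps intro!: exI[of _ t])
    show "u \<in> closed_segment u v" by simp
    fix x assume x: "x \<in> closed_segment u v"
    show "(f has_derivative blinfun_apply (f' x)) (at x within closed_segment u v)"
      by (rule has_derivative_at_withinI[OF f])
    have "onorm (blinfun_apply (f' x) - blinfun_apply (f' u)) = norm (f' x - f' u)"
      by (simp add: norm_blinfun.rep_eq minus_blinfun.rep_eq fun_diff_def)
    also have "\<dots> \<le> C * norm (x - u)" by (rule lip)
    also have "\<dots> \<le> C * norm (v - u)"
      using segment_bound1[OF x] \<open>0 \<le> C\<close> by (intro mult_left_mono) (auto simp: norm_minus_commute)
    finally show "onorm (blinfun_apply (f' x) - blinfun_apply (f' u)) \<le> C * norm (v - u)" .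
  qed
  then show ?thesis by (simp add: power2_eq_square mult_ac)
qed

text \<open>
  Both increments over a vector of length \<open>r\<close> determine the derivatives up to an error of order \<open>r\<^sup>2\<close>, and
  they differ by at most \<open>2 * \<eta>\<close>. Hence uniform closeness of functions whose remainders are uniformly
  quadratic implies closeness of their derivatives.
\<close>

lemma derivative_close:
  fixes g1 g2 :: "'b::real_normed_vector \<Rightarrow> 'c::real_normed_vector"
  assumes "0 < r" "0 \<le> C"
    and g1: "\<And>h. norm h \<le> r \<Longrightarrow> norm (g1 (v + h) - g1 v - blinfun_apply L1 h) \<le> C * (norm h)\<^sup>2"
    and g2: "\<And>h. norm h \<le> r \<Longrightarrow> norm (g2 (v + h) - g2 v - blinfun_apply L2 h) \<le> C * (norm h)\<^sup>2"
    and close: "\<And>h. norm h \<le> r \<Longrightarrow> norm (g1 (v + h) - g2 (v + h)) \<le> \<eta>"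
  shows "norm (L1 - L2) \<le> 2 * \<eta> / r + 2 * C * r"
proof (rule norm_blinfun_bound)
  have eta: "0 \<le> \<eta>" using order_trans[OF norm_ge_zero close[of 0]] \<open>0 < r\<close> by simp
  then show "0 \<le> 2 * \<eta> / r + 2 * C * r" using assms by simp
  fix x
  show "norm (blinfun_apply (L1 - L2) x) \<le> (2 * \<eta> / r + 2 * C * r) * norm x"
  proof (cases "x = 0")
    case True
    then show ?thesis by simp
  next
    case False
    define h where "h = (r / norm x) *\<^sub>R x"
    have nh: "norm h = r" using False \<open>0 < r\<close> by (simp add: h_def)
    define q where "q = C * r\<^sup>2"
    have "norm (g1 (v + h) - g1 v - L1 h) \<le> q" "norm (g2 (v + h) - g2 v - L2 h) \<le> q"
      "norm (g1 (v + h) - g2 (v + h)) \<le> \<eta>" "norm (g1 v - g2 v) \<le> \<eta>"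
      using g1[of h] g2[of h] close[of h] close[of 0] nh \<open>0 < r\<close> by (simp_all add: q_def)
    then have "norm (L1 h - L2 h) \<le> 2 * \<eta> + 2 * (C * r\<^sup>2)"
      unfolding q_def[symmetric] by norm
    moreover have "L1 h - L2 h = (r / norm x) *\<^sub>R blinfun_apply (L1 - L2) x"
      by (simp add: h_def blinfun.bilinear_simps scaleR_diff_right)
    ultimately have "r / norm x * norm (blinfun_apply (L1 - L2) x) \<le> 2 * \<eta> + 2 * (C * r\<^sup>2)"
      using \<open>0 < r\<close> by simp
    then show ?thesis using False \<open>0 < r\<close>
      by (simp add: field_simps power2_eq_square)
  qed
qed

lemma quadratic_remainder_has_derivative:
  assumes "bounded_linear L" and le: "\<And>y. y \<in> S \<Longrightarrow> norm (f y - f x - L (y - x)) \<le> C * (norm (y - x))\<^sup>2"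
  shows "(f has_derivative L) (at x within S)"
  unfolding has_derivative_iff_norm
proof
  show "((\<lambda>y. norm (f y - f x - L (y - x)) / norm (y - x)) \<longlongrightarrow> 0) (at x within S)"
  proof (rule Lim_null_comparison)
    have "((\<lambda>y. C * norm (y - x)) \<longlongrightarrow> C * norm (x - x)) (at x within S)" by (intro tendsto_intros)
    then show "((\<lambda>y. C * norm (y - x)) \<longlongrightarrow> 0) (at x within S)" by simp
    have "norm (norm (f y - f x - L (y - x)) / norm (y - x)) \<le> C * norm (y - x)" if "y \<in> S" "y \<noteq> x" for y
      using le[OF that(1)] that(2) by (simp add: divide_le_eq power2_eq_square mult.assoc)
    then show "\<forall>\<^sub>F y in at x within S. norm (norm (f y - f x - L (y - x)) / norm (y - x)) \<le> C * norm (y - x)"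
      by (auto simp: eventually_at_filter intro!: always_eventually)
  qed
qed (rule assms(1))

text \<open>
  Within a subspace the derivative is determined on that subspace only. This is how statements about
  \<open>frechet_derivative\<close> within \<open>E(s)\<close>, an arbitrary choice off \<open>E(s)\<close>, are reduced to explicit derivatives.
\<close>

lemma has_derivative_unique_on_subspace:
  assumes V: "subspace V" "x \<in> V" "h \<in> V"
    and d1: "(f has_derivative D1) (at x within V)" and d2: "(f has_derivative D2) (at x within V)"
  shows "D1 h = D2 h"
proof -
  have g: "((\<lambda>r::real. x + r *\<^sub>R h) has_derivative (\<lambda>r. r *\<^sub>R h)) (at 0)"
    by (auto intro!: derivative_eq_intros)
  have im: "range (\<lambda>r::real. x + r *\<^sub>R h) \<subseteq> V"
    using V by (auto intro: subspace_add subspace_scale)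
  have comp: "((\<lambda>r::real. f (x + r *\<^sub>R h)) has_vector_derivative D h) (at 0)" if "(f has_derivative D) (at x within V)" for D
  proof -
    have "((\<lambda>r::real. f (x + r *\<^sub>R h)) has_derivative (\<lambda>r. D (r *\<^sub>R h))) (at 0)"
      using has_derivative_in_compose[OF g] has_derivative_subset[OF that im] by simp
    then show ?thesis
      using linear_scale[OF has_derivative_linear[OF that]] by (simp add: has_vector_derivative_def)
  qed
  show ?thesis using vector_derivative_unique_at[OF comp[OF d1] comp[OF d2]] .
qed

lemma onorm_on_le:
  assumes "V \<noteq> {}" "0 \<le> B" "\<And>x. x \<in> V \<Longrightarrow> N (L x) \<le> B * norm x"
  shows "onorm_on N V L \<le> B"
  unfolding onorm_on_def
proof (rule cSUP_least[OF assms(1)])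
  show "N (L x) / norm x \<le> B" if "x \<in> V" for x
    using assms(2) assms(3)[OF that] by (cases "x = 0") (auto simp: divide_le_eq)
qed

lemma norm_le_onorm_on:
  assumes L: "bounded_linear L" and "x \<in> V" and B: "onorm_on norm V L \<le> B"
  shows "norm (L x) \<le> B * norm x"
proof (cases "x = 0")
  case True
  then show ?thesis using linear_0[OF bounded_linear.linear[OF L]] by simp
next
  case False
  have "norm (L x) / norm x \<le> onorm_on norm V L"
    unfolding onorm_on_def
    by (rule cSUP_upper[OF \<open>x \<in> V\<close>])
       (auto intro!: bdd_aboveI[of _ "onorm L"] le_onorm[OF L])
  then have "norm (L x) \<le> onorm_on norm V L * norm x" using False by (simp add: divide_le_eq)
  also have "\<dots> \<le> B * norm x" using B by (rule mult_right_mono) simp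
  finally show ?thesis .
qed

section \<open>Continuously differentiable maps\<close>

definition Pair_left :: "'b::real_normed_vector \<Rightarrow>\<^sub>L ('b \<times> 'c::real_normed_vector)" where
  "Pair_left = Blinfun (\<lambda>x. (x, 0))"
definition Pair_right :: "'c::real_normed_vector \<Rightarrow>\<^sub>L ('b::real_normed_vector \<times> 'c)" where
  "Pair_right = Blinfun (\<lambda>x. (0, x))"

lemma Pair_left_apply [simp]: "blinfun_apply Pair_left x = (x, 0)"
  unfolding Pair_left_def
  by (subst bounded_linear_Blinfun_apply) (auto intro!: bounded_linear_Pair bounded_linear_ident bounded_linear_zero)
lemma Pair_right_apply [simp]: "blinfun_apply Pair_right x = (0, x)"
  unfolding Pair_right_def
  by (subst bounded_linear_Blinfun_apply) (auto intro!: bounded_linear_Pair bounded_linear_ident bounded_linear_zero)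

lemmas continuous_on_blinfun_compose = bounded_bilinear.continuous_on[OF bounded_bilinear_blinfun_compose]
lemmas continuous_on_blinfun_apply = bounded_bilinear.continuous_on[OF bounded_bilinear_blinfun_apply]

lemma C1_onI:
  assumes "continuous_on S f'" "\<And>x. x \<in> S \<Longrightarrow> (f has_derivative blinfun_apply (f' x)) (at x within S)"
  shows "C1_on S f"
  using assms unfolding C1_on_def by blast

lemma C1_onE:
  assumes "C1_on S f"
  obtains f' where "continuous_on S f'" "\<And>x. x \<in> S \<Longrightarrow> (f has_derivative blinfun_apply (f' x)) (at x within S)"
  using assms unfolding C1_on_def by blast

lemma C1_on_imp_continuous_on: "C1_on S f \<Longrightarrow> continuous_on S f"
  unfolding C1_on_def by (meson has_derivative_continuous_on)

lemma C1_on_subset: "C1_on S f \<Longrightarrow> R \<subseteq> S \<Longrightarrow> C1_on R f"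
  unfolding C1_on_def by (meson continuous_on_subset has_derivative_subset subsetD)

lemma C1_on_cong:
  assumes "C1_on S f" "\<And>x. x \<in> S \<Longrightarrow> f x = g x"
  shows "C1_on S g"
  using assms unfolding C1_on_def by (metis has_derivative_transform)

lemma C1_on_bounded_linear:
  assumes "bounded_linear f" shows "C1_on S f"
  by (rule C1_onI[of S "\<lambda>_. Blinfun f"])
     (auto simp: bounded_linear_Blinfun_apply[OF assms] intro: bounded_linear_imp_has_derivative[OF assms])

lemma C1_on_const: "C1_on S (\<lambda>_. c)"
  by (rule C1_onI[of S "\<lambda>_. 0"]) (auto intro!: derivative_eq_intros)

lemma C1_on_compose:
  assumes f: "C1_on S f" and g: "C1_on R g" and sub: "f ` S \<subseteq> R"
  shows "C1_on S (\<lambda>x. g (f x))"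
proof -
  obtain f' where f': "continuous_on S f'" "\<And>x. x \<in> S \<Longrightarrow> (f has_derivative blinfun_apply (f' x)) (at x within S)"
    using C1_onE[OF f] by blast
  obtain g' where g': "continuous_on R g'" "\<And>x. x \<in> R \<Longrightarrow> (g has_derivative blinfun_apply (g' x)) (at x within R)"
    using C1_onE[OF g] by blast
  show ?thesis
  proof (rule C1_onI[of S "\<lambda>x. g' (f x) o\<^sub>L f' x"])
    have "continuous_on S (\<lambda>x. g' (f x))"
      by (rule continuous_on_compose2[OF g'(1) C1_on_imp_continuous_on[OF f] sub])
    then show "continuous_on S (\<lambda>x. g' (f x) o\<^sub>L f' x)"
      by (intro continuous_on_blinfun_compose f'(1))
    fix x assume x: "x \<in> S"
    show "((\<lambda>x. g (f x)) has_derivative blinfun_apply (g' (f x) o\<^sub>L f' x)) (at x within S)"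
      using has_derivative_in_compose2[OF g'(2) sub x f'(2)[OF x]] by (simp add: blinfun_compose.rep_eq o_def)
  qed
qed

lemma C1_on_Pair:
  assumes f: "C1_on S f" and g: "C1_on S g"
  shows "C1_on S (\<lambda>x. (f x, g x))"
proof -
  obtain f' where f': "continuous_on S f'" "\<And>x. x \<in> S \<Longrightarrow> (f has_derivative blinfun_apply (f' x)) (at x within S)"
    using C1_onE[OF f] by blast
  obtain g' where g': "continuous_on S g'" "\<And>x. x \<in> S \<Longrightarrow> (g has_derivative blinfun_apply (g' x)) (at x within S)"
    using C1_onE[OF g] by blast
  show ?thesis
  proof (rule C1_onI[of S "\<lambda>x. (Pair_left o\<^sub>L f' x) + (Pair_right o\<^sub>L g' x)"])
    show "continuous_on S (\<lambda>x. (Pair_left o\<^sub>L f' x) + (Pair_right o\<^sub>L g' x))"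
      by (intro continuous_intros continuous_on_blinfun_compose f'(1) g'(1))
    fix x assume "x \<in> S"
    then show "((\<lambda>x. (f x, g x)) has_derivative blinfun_apply ((Pair_left o\<^sub>L f' x) + (Pair_right o\<^sub>L g' x))) (at x within S)"
      by (intro has_derivative_eq_rhs[OF has_derivative_Pair[OF f'(2) g'(2)]])
         (auto simp: blinfun.bilinear_simps)
  qed
qed

lemma (in bounded_bilinear) C1_on:
  assumes f: "C1_on S f" and g: "C1_on S g"
  shows "C1_on S (\<lambda>x. prod (f x) (g x))"
proof -
  obtain f' where f': "continuous_on S f'" "\<And>x. x \<in> S \<Longrightarrow> (f has_derivative blinfun_apply (f' x)) (at x within S)"
    using C1_onE[OF f] by blast
  obtain g' where g': "continuous_on S g'" "\<And>x. x \<in> S \<Longrightarrow> (g has_derivative blinfun_apply (g' x)) (at x within S)"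
    using C1_onE[OF g] by blast
  show ?thesis
  proof (rule C1_onI[of S "\<lambda>x. (prod_right (f x) o\<^sub>L g' x) + (prod_left (g x) o\<^sub>L f' x)"])
    show "continuous_on S (\<lambda>x. (prod_right (f x) o\<^sub>L g' x) + (prod_left (g x) o\<^sub>L f' x))"
      by (intro continuous_intros continuous_on_blinfun_compose f'(1) g'(1)
          bounded_linear.continuous_on[OF bounded_linear_prod_right] 
          bounded_linear.continuous_on[OF bounded_linear_prod_left]
          C1_on_imp_continuous_on[OF f] C1_on_imp_continuous_on[OF g])
    fix x assume "x \<in> S"
    then show "((\<lambda>x. prod (f x) (g x)) has_derivative
        blinfun_apply ((prod_right (f x) o\<^sub>L g' x) + (prod_left (g x) o\<^sub>L f' x))) (at x within S)"
      by (intro has_derivative_eq_rhs[OF FDERIV[OF f'(2) g'(2)]])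
         (auto simp: plus_blinfun.rep_eq prod_right.rep_eq prod_left.rep_eq)
  qed
qed

lemma C1_on_bounded_linear_compose:
  "bounded_linear g \<Longrightarrow> C1_on S f \<Longrightarrow> C1_on S (\<lambda>x. g (f x))"
  by (rule C1_on_compose[OF _ C1_on_bounded_linear[where S = UNIV]]) auto

lemma C1_on_add: "C1_on S f \<Longrightarrow> C1_on S g \<Longrightarrow> C1_on S (\<lambda>x. f x + g x)"
  using C1_on_bounded_linear_compose[OF bounded_linear_add[OF bounded_linear_fst bounded_linear_snd] C1_on_Pair, of S f g]
  by simp

lemma C1_on_diff: "C1_on S f \<Longrightarrow> C1_on S g \<Longrightarrow> C1_on S (\<lambda>x. f x - g x)"
  using C1_on_bounded_linear_compose[OF bounded_linear_sub[OF bounded_linear_fst bounded_linear_snd] C1_on_Pair, of S f g]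
  by simp

lemma C1_on_blinfun_apply:
  "C1_on S f \<Longrightarrow> C1_on S g \<Longrightarrow> C1_on S (\<lambda>x. blinfun_apply (f x) (g x))"
  by (rule bounded_bilinear.C1_on[OF bounded_bilinear_blinfun_apply])

lemma C1_on_curve:
  fixes c :: "real \<Rightarrow> 'b::real_normed_vector"
  assumes "\<And>t. t \<in> S \<Longrightarrow> (c has_vector_derivative c' t) (at t within S)" "continuous_on S c'"
  shows "C1_on S c"
proof (rule C1_onI[of S "\<lambda>t. blinfun_scaleR_left (c' t)"])
  show "continuous_on S (\<lambda>t. blinfun_scaleR_left (c' t))"
    by (rule bounded_linear.continuous_on[OF bounded_linear_blinfun_scaleR_left assms(2)])
  show "(c has_derivative blinfun_apply (blinfun_scaleR_left (c' t))) (at t within S)" if "t \<in> S" for t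
    using assms(1)[OF that] by (simp add: has_vector_derivative_def)
qed
lemma C1_on_glue:
  fixes f g :: "'b::real_normed_vector \<Rightarrow> 'c::real_normed_vector"
  assumes "closed S" "closed R" "S \<union> R = UNIV"
    and f: "continuous_on S f'" "\<And>x. x \<in> S \<Longrightarrow> (f has_derivative blinfun_apply (f' x)) (at x within S)"
    and g: "continuous_on R g'" "\<And>x. x \<in> R \<Longrightarrow> (g has_derivative blinfun_apply (g' x)) (at x within R)"
    and eq: "\<And>x. x \<in> S \<Longrightarrow> x \<in> R \<Longrightarrow> f x = g x" "\<And>x. x \<in> S \<Longrightarrow> x \<in> R \<Longrightarrow> f' x = g' x"
  shows "C1_on UNIV (\<lambda>x. if x \<in> S then f x else g x)"
proof (rule C1_onI[where f' = "\<lambda>x. if x \<in> S then f' x else g' x"])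
  have "continuous_on (S \<union> R) (\<lambda>x. if x \<in> S then f' x else g' x)"
    by (rule continuous_on_If) (use assms in auto)
  then show "continuous_on UNIV (\<lambda>x. if x \<in> S then f' x else g' x)" using assms(3) by simp
  have cl: "closure S = S" "closure (- S) \<subseteq> R"
    using assms(1) closure_minimal[OF _ assms(2), of "- S"] assms(3) by auto
  have R: "- S \<union> (closure S \<inter> closure (- S)) \<subseteq> R" "S \<union> (closure S \<inter> closure (- S)) = S"
    using assms(3) cl by auto
  fix x
  have "((\<lambda>x. if x \<in> S then f x else g x) has_derivative
      (if x \<in> S then blinfun_apply (f' x) else blinfun_apply (g' x))) (at x within S \<union> - S)"
  proof (rule has_derivative_If_within_closures)
    show "(f has_derivative blinfun_apply (f' x)) (at x within S \<union> (closure S \<inter> closure (- S)))"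
      if "x \<in> S \<union> (closure S \<inter> closure (- S))" using that f(2) R(2) by simp
    show "(g has_derivative blinfun_apply (g' x)) (at x within - S \<union> (closure S \<inter> closure (- S)))"
      if "x \<in> - S \<union> (closure S \<inter> closure (- S))"
      using has_derivative_subset[OF g(2) R(1)] that R(1) by blast
  qed (use cl eq in auto)
  then show "((\<lambda>x. if x \<in> S then f x else g x) has_derivative
      blinfun_apply (if x \<in> S then f' x else g' x)) (at x within UNIV)" by (simp add: if_distrib)
qed

text \<open>
  Odd reflection about the value at time \<open>0\<close> preserves the derivative there: the sign that it produces
  in the time direction is undone by the minus in front, and the space derivative occurs \<open>2 - 1\<close> times.
\<close>

lemma C1_on_odd_reflection:
  fixes F :: "real \<times> 'b::real_normed_vector \<Rightarrow> 'c::real_normed_vector"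
  assumes "C1_on ({0..} \<times> UNIV) F"
  shows "C1_on UNIV (\<lambda>x. if x \<in> {0..} \<times> UNIV then F x else 2 *\<^sub>R F (0, snd x) - F (- fst x, snd x))"
proof -
  obtain F' where F': "continuous_on ({0..} \<times> UNIV) F'"
    "\<And>x. x \<in> {0..} \<times> UNIV \<Longrightarrow> (F has_derivative blinfun_apply (F' x)) (at x within {0..} \<times> UNIV)"
    using C1_onE[OF assms] by blast
  define p :: "(real \<times> 'b) \<Rightarrow>\<^sub>L (real \<times> 'b)" where "p = Pair_right o\<^sub>L snd_blinfun"
  define m :: "(real \<times> 'b) \<Rightarrow>\<^sub>L (real \<times> 'b)" where "m = (Pair_right o\<^sub>L snd_blinfun) - (Pair_left o\<^sub>L fst_blinfun)"
  have p: "blinfun_apply p x = (0, snd x)" for x by (simp add: p_def)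
  have m: "blinfun_apply m x = (- fst x, snd x)" for x by (simp add: m_def blinfun.bilinear_simps)
  define G' where "G' x = 2 *\<^sub>R (F' (p x) o\<^sub>L p) - (F' (m x) o\<^sub>L m)" for x
  show ?thesis
  proof (rule C1_on_glue[where R = "{..0} \<times> UNIV" and f' = F' and g' = G'])
    show "closed ({0..} \<times> UNIV :: (real \<times> 'b) set)" "closed ({..0} \<times> UNIV :: (real \<times> 'b) set)"
      by (auto intro!: closed_Times)
    show "{0..} \<times> UNIV \<union> {..0} \<times> UNIV = (UNIV :: (real \<times> 'b) set)" by auto
    have c: "continuous_on ({..0} \<times> UNIV) (\<lambda>x. F' (blinfun_apply q x))"
      if "blinfun_apply q ` ({..0} \<times> UNIV) \<subseteq> {0..} \<times> UNIV" for q :: "(real \<times> 'b) \<Rightarrow>\<^sub>L (real \<times> 'b)"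
      by (rule continuous_on_compose2[OF F'(1) _ that]) (intro continuous_intros)
    have pi: "blinfun_apply p ` ({..0} \<times> UNIV) \<subseteq> {0..} \<times> UNIV" "blinfun_apply m ` ({..0} \<times> UNIV) \<subseteq> {0..} \<times> UNIV"
      by (auto simp: p m)
    show "continuous_on ({..0} \<times> UNIV) G'"
      unfolding G'_def by (intro continuous_intros continuous_on_blinfun_compose c pi)
    have d: "((\<lambda>x. F (blinfun_apply q x)) has_derivative blinfun_apply (F' (q x) o\<^sub>L q)) (at x within {..0} \<times> UNIV)"
      if "blinfun_apply q ` ({..0} \<times> UNIV) \<subseteq> {0..} \<times> UNIV" "x \<in> {..0} \<times> UNIV"
      for q :: "(real \<times> 'b) \<Rightarrow>\<^sub>L (real \<times> 'b)" and x
      using has_derivative_in_compose2[OF F'(2) that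
          bounded_linear_imp_has_derivative[OF blinfun.bounded_linear_right[of q]]]
      by (simp add: blinfun_compose.rep_eq o_def)
    fix x :: "real \<times> 'b"
    show "((\<lambda>x. 2 *\<^sub>R F (0, snd x) - F (- fst x, snd x)) has_derivative blinfun_apply (G' x)) (at x within {..0} \<times> UNIV)"
      if x: "x \<in> {..0} \<times> UNIV"
      using has_derivative_diff[OF has_derivative_scaleR_right[OF d[OF pi(1) x], of 2] d[OF pi(2) x]]
      by (simp add: G'_def p m blinfun.bilinear_simps[abs_def] minus_blinfun.rep_eq scaleR_blinfun.rep_eq)
    assume x: "x \<in> {0..} \<times> UNIV" "x \<in> {..0} \<times> UNIV"
    then obtain z where xz: "x = (0, z)" by auto
    show "F x = 2 *\<^sub>R F (0, snd x) - F (- fst x, snd x)" by (simp add: xz scaleR_2)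
    show "F' x = G' x"
    proof (rule blinfun_eqI)
      fix h :: "real \<times> 'b"
      have "2 *\<^sub>R (0, snd h) - (- fst h, snd h) = h" by (cases h) (simp add: scaleR_2)
      then have "F' (0, z) h = F' (0, z) (2 *\<^sub>R (0, snd h) - (- fst h, snd h))" by simp
      then show "F' x h = G' x h"
        by (simp only: G'_def p m xz blinfun.bilinear_simps blinfun_apply_blinfun_compose fst_conv snd_conv minus_zero)
    qed
  qed (use F' in auto)
qed

section \<open>The evolution operator\<close>

locale mu_dichotomy_system =
  fixes A :: "real \<Rightarrow> 'a::banach \<Rightarrow>\<^sub>L 'a"
    and T :: "real \<Rightarrow> real \<Rightarrow> 'a \<Rightarrow>\<^sub>L 'a"
    and P :: "real \<Rightarrow> 'a \<Rightarrow>\<^sub>L 'a"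
    and \<mu> :: "real \<Rightarrow> real"
    and D a b \<epsilon> :: real
  assumes A_C1: "C1_on {0..} A"
    and evolution: "evolution_operator A T"
    and growth: "growth_rate \<mu>"
    and dichotomy: "mu_dichotomy T \<mu> P D a b \<epsilon>"
    and eps_pos: "\<epsilon> > 0"
    and gap: "a + \<epsilon> < b"
begin

abbreviation "Q \<equiv> compl_proj P"

lemma A_cont: "continuous_on {0..} A"
  by (rule C1_on_imp_continuous_on[OF A_C1])

lemma T_self: "0 \<le> s \<Longrightarrow> T s s v = v"
  using evolution by (auto simp: evolution_operator_def)

lemma T_deriv: "0 \<le> s \<Longrightarrow> 0 \<le> t \<Longrightarrow> ((\<lambda>r. T r s v) has_vector_derivative A t (T t s v)) (at t within {0..})"
  using evolution by (auto simp: evolution_operator_def)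

definition \<Gamma>\<^sub>A :: "real \<Rightarrow> real" where
  "\<Gamma>\<^sub>A = (SOME G. \<forall>t\<ge>0. (G has_vector_derivative norm (A t)) (at t within {0..}))"

lemma \<Gamma>\<^sub>A: "0 \<le> t \<Longrightarrow> (\<Gamma>\<^sub>A has_vector_derivative norm (A t)) (at t within {0..})"
proof -
  have "\<exists>G. \<forall>t\<ge>0. (G has_vector_derivative norm (A t)) (at t within {0..})"
    using antiderivative_atLeast[OF continuous_on_norm[OF A_cont]] by blast
  then have "\<forall>t\<ge>0. (\<Gamma>\<^sub>A has_vector_derivative norm (A t)) (at t within {0..})"
    unfolding \<Gamma>\<^sub>A_def by (rule someI_ex)
  then show "0 \<le> t \<Longrightarrow> (\<Gamma>\<^sub>A has_vector_derivative norm (A t)) (at t within {0..})" by blast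
qed

lemma \<Gamma>\<^sub>A_cont: "continuous_on {0..} \<Gamma>\<^sub>A"
  by (rule continuous_on_vector_derivative) (use \<Gamma>\<^sub>A in auto)

lemma linear_solution_estimate:
  fixes v :: "real \<Rightarrow> 'a"
  assumes "\<And>t. 0 \<le> t \<Longrightarrow> (v has_vector_derivative A t (v t)) (at t within {0..})"
    and "0 \<le> s" "0 \<le> t"
  shows "norm (v t - v s) \<le> norm (v s) * (exp (2 * \<bar>\<Gamma>\<^sub>A t - \<Gamma>\<^sub>A s\<bar>) - 1)"
  by (rule gronwall[OF assms(1) \<Gamma>\<^sub>A]) (use assms in \<open>auto intro: norm_blinfun\<close>)

lemma T_comp:
  assumes "0 \<le> s" "0 \<le> r" "0 \<le> t"
  shows "T t r (T r s v) = T t s v"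
proof -
  have "norm ((T t r (T r s v) - T t s v) - (T r r (T r s v) - T r s v))
      \<le> norm (T r r (T r s v) - T r s v) * (exp (2 * \<bar>\<Gamma>\<^sub>A t - \<Gamma>\<^sub>A r\<bar>) - 1)"
  proof (rule linear_solution_estimate)
    fix t :: real assume "0 \<le> t"
    then show "((\<lambda>t. T t r (T r s v) - T t s v) has_vector_derivative A t (T t r (T r s v) - T t s v)) (at t within {0..})"
      using T_deriv[of r t "T r s v"] T_deriv[of s t v] assms
      by (auto simp: blinfun.bilinear_simps intro: has_vector_derivative_diff)
  qed (use assms in auto)
  then show ?thesis using T_self assms by simp
qed

lemma T_inverse: "0 \<le> s \<Longrightarrow> 0 \<le> t \<Longrightarrow> T s t (T t s v) = v"
  by (simp add: T_comp T_self)

lemma T_near_id: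
  assumes "0 \<le> s" "0 \<le> t"
  shows "norm (T t s - id_blinfun) \<le> exp (2 * \<bar>\<Gamma>\<^sub>A t - \<Gamma>\<^sub>A s\<bar>) - 1"
proof (rule norm_blinfun_bound)
  fix v
  show "norm (blinfun_apply (T t s - id_blinfun) v) \<le> (exp (2 * \<bar>\<Gamma>\<^sub>A t - \<Gamma>\<^sub>A s\<bar>) - 1) * norm v"
    using linear_solution_estimate[OF T_deriv, of s s t v] assms T_self[of s]
    by (simp add: blinfun.bilinear_simps mult.commute)
qed auto

lemma \<Gamma>\<^sub>A_modulus: 
  assumes "0 \<le> s"
  shows "((\<lambda>t. c * (exp (2 * \<bar>\<Gamma>\<^sub>A t - \<Gamma>\<^sub>A s\<bar>) - 1)) \<longlongrightarrow> 0) (at s within {0..})"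
proof -
  have "(\<Gamma>\<^sub>A \<longlongrightarrow> \<Gamma>\<^sub>A s) (at s within {0..})"
    using \<Gamma>\<^sub>A_cont assms by (simp add: continuous_on_def)
  then have "((\<lambda>t. c * (exp (2 * \<bar>\<Gamma>\<^sub>A t - \<Gamma>\<^sub>A s\<bar>) - 1)) \<longlongrightarrow> c * (exp (2 * \<bar>\<Gamma>\<^sub>A s - \<Gamma>\<^sub>A s\<bar>) - 1)) (at s within {0..})"
    by (intro tendsto_intros)
  then show ?thesis by simp
qed

lemma continuous_T_0: "continuous_on {0..} (\<lambda>t. T t 0)"
  unfolding continuous_on_def
proof (intro ballI)
  fix s :: real assume s: "s \<in> {0..}"
  have "norm (T t 0 - T s 0) \<le> norm (T s 0) * (exp (2 * \<bar>\<Gamma>\<^sub>A t - \<Gamma>\<^sub>A s\<bar>) - 1)" if "0 \<le> t" for t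
  proof -
    have "T t 0 - T s 0 = (T t s - id_blinfun) o\<^sub>L T s 0"
      using T_comp[of 0 s t] s that by (auto intro!: blinfun_eqI simp: blinfun.bilinear_simps)
    then have "norm (T t 0 - T s 0) \<le> norm (T t s - id_blinfun) * norm (T s 0)"
      using norm_blinfun_compose by metis
    also have "\<dots> \<le> (exp (2 * \<bar>\<Gamma>\<^sub>A t - \<Gamma>\<^sub>A s\<bar>) - 1) * norm (T s 0)"
      using T_near_id[of s t] s that by (intro mult_right_mono) auto
    finally show ?thesis by (simp add: mult.commute)
  qed
  then show "((\<lambda>t. T t 0) \<longlongrightarrow> T s 0) (at s within {0..})"
    by (intro LIM_zero_cancel[OF Lim_null_comparison[OF _ \<Gamma>\<^sub>A_modulus[of s "norm (T s 0)"]]])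
       (use s in \<open>auto simp: eventually_at_filter intro!: always_eventually\<close>)
qed

lemma continuous_T_to_0: "continuous_on {0..} (\<lambda>t. T 0 t)"
  unfolding continuous_on_def
proof (intro ballI)
  fix s :: real assume s: "s \<in> {0..}"
  have "norm (T 0 t - T 0 s) \<le> norm (T 0 s) * (exp (2 * \<bar>\<Gamma>\<^sub>A t - \<Gamma>\<^sub>A s\<bar>) - 1)" if "0 \<le> t" for t
  proof -
    have "T 0 t - T 0 s = T 0 s o\<^sub>L (T s t - id_blinfun)"
      using T_comp[of t s 0] s that by (auto intro!: blinfun_eqI simp: blinfun.bilinear_simps)
    then have "norm (T 0 t - T 0 s) \<le> norm (T 0 s) * norm (T s t - id_blinfun)"
      using norm_blinfun_compose by metis
    also have "\<dots> \<le> norm (T 0 s) * (exp (2 * \<bar>\<Gamma>\<^sub>A t - \<Gamma>\<^sub>A s\<bar>) - 1)"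
      using T_near_id[of t s] s that by (intro mult_left_mono) (auto simp: abs_minus_commute)
    finally show ?thesis .
  qed
  then show "((\<lambda>t. T 0 t) \<longlongrightarrow> T 0 s) (at s within {0..})"
    by (intro LIM_zero_cancel[OF Lim_null_comparison[OF _ \<Gamma>\<^sub>A_modulus[of s "norm (T 0 s)"]]])
       (use s in \<open>auto simp: eventually_at_filter intro!: always_eventually\<close>)
qed

text \<open>
  The defining property of \<open>T\<close> holds pointwise only. Differentiability in operator norm follows since an
  antiderivative of the norm continuous map \<open>t \<mapsto> A t o\<^sub>L T t 0\<close> has the same pointwise derivatives as
  \<open>T t 0\<close>.
\<close>

lemma T_0_deriv:
  assumes "0 \<le> t"
  shows "((\<lambda>t. T t 0) has_vector_derivative A t o\<^sub>L T t 0) (at t within {0..})"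
proof -
  have "continuous_on {0..} (\<lambda>t. A t o\<^sub>L T t 0)"
    by (intro continuous_on_blinfun_compose A_cont continuous_T_0)
  then obtain H where H: "\<And>t. 0 \<le> t \<Longrightarrow> (H has_vector_derivative A t o\<^sub>L T t 0) (at t within {0..})"
    using antiderivative_atLeast by blast
  have "T t 0 = H t + (id_blinfun - H 0)" if t: "0 \<le> t" for t
  proof (rule blinfun_eqI)
    fix v
    have "norm ((H t v - T t 0 v) - (H 0 v - T 0 0 v)) \<le> (0::real) - 0"
    proof (rule norm_increment_le[where S = "{0..}" and f' = "\<lambda>_. 0" and g' = "\<lambda>_. 0"])
      fix x assume "x \<in> {0..t}"
      then have x: "0 \<le> x" by simp
      have "((\<lambda>t. H t v) has_vector_derivative (A x o\<^sub>L T x 0) v) (at x within {0..})"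
        using bounded_linear.has_vector_derivative[OF blinfun.bounded_linear_left H[OF x]] .
      then show "((\<lambda>t. H t v - T t 0 v) has_vector_derivative 0) (at x within {0..})"
        using has_vector_derivative_diff[OF _ T_deriv[of 0 x v]] x by fastforce
    qed (use t in auto)
    then show "T t 0 v = (H t + (id_blinfun - H 0)) v"
      by (simp add: T_self blinfun.bilinear_simps algebra_simps)
  qed
  moreover have "((\<lambda>t. H t + (id_blinfun - H 0)) has_vector_derivative A t o\<^sub>L T t 0) (at t within {0..})"
    using H[OF assms] by (simp add: has_vector_derivative_add_const)
  ultimately show ?thesis
    using assms by (auto intro: has_vector_derivative_transform[rotated 2])
qed

lemma T_to_0_deriv:
  assumes "0 \<le> t"
  shows "((\<lambda>t. T 0 t) has_vector_derivative - (T 0 t o\<^sub>L A t)) (at t within {0..})"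
  unfolding has_vector_derivative_iff_quotient
proof -
  have "((\<lambda>y. T 0 y) \<longlongrightarrow> T 0 t) (at t within {0..})"
    using continuous_T_to_0 assms by (simp add: continuous_on_def)
  moreover have "((\<lambda>y. (T y 0 - T t 0) /\<^sub>R (y - t)) \<longlongrightarrow> A t o\<^sub>L T t 0) (at t within {0..})"
    using T_0_deriv[OF assms] by (simp add: has_vector_derivative_iff_quotient)
  ultimately have "((\<lambda>y. - (T 0 y o\<^sub>L ((T y 0 - T t 0) /\<^sub>R (y - t)) o\<^sub>L T 0 t)) \<longlongrightarrow>
      - (T 0 t o\<^sub>L (A t o\<^sub>L T t 0) o\<^sub>L T 0 t)) (at t within {0..})"
    by (intro tendsto_minus bounded_bilinear.tendsto[OF bounded_bilinear_blinfun_compose] tendsto_const)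
  moreover have "- (T 0 t o\<^sub>L (A t o\<^sub>L T t 0) o\<^sub>L T 0 t) = - (T 0 t o\<^sub>L A t)"
    using assms by (auto intro!: blinfun_eqI simp: blinfun.bilinear_simps T_inverse)
  moreover have "- (T 0 y o\<^sub>L ((T y 0 - T t 0) /\<^sub>R (y - t)) o\<^sub>L T 0 t) = (T 0 y - T 0 t) /\<^sub>R (y - t)"
    if "y \<in> {0..}" for y
    using assms that
    by (auto intro!: blinfun_eqI simp: blinfun.bilinear_simps T_inverse scaleR_diff_right)
  ultimately show "((\<lambda>y. (T 0 y - T 0 t) /\<^sub>R (y - t)) \<longlongrightarrow> - (T 0 t o\<^sub>L A t)) (at t within {0..})"
    by (metis (no_types, lifting) Lim_cong_within)
qed

text \<open>
  In the coordinate \<open>z = T 0 t v\<close> the linear part of the equation disappears; \<open>T_push_deriv\<close> is the way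
  back.
\<close>

lemma T_pull_deriv:
  assumes "S \<subseteq> {0..}" "0 \<le> t" and v: "(v has_vector_derivative A t (v t) + g) (at t within S)"
  shows "((\<lambda>\<tau>. T 0 \<tau> (v \<tau>)) has_vector_derivative T 0 t g) (at t within S)"
  using bounded_bilinear.has_vector_derivative[OF bounded_bilinear_blinfun_apply
      has_vector_derivative_within_subset[OF T_to_0_deriv[OF \<open>0 \<le> t\<close>] \<open>S \<subseteq> {0..}\<close>] v]
  by (simp add: blinfun.bilinear_simps)

lemma T_push_deriv:
  assumes "S \<subseteq> {0..}" "0 \<le> t" and z: "(z has_vector_derivative T 0 t g) (at t within S)"
  shows "((\<lambda>\<tau>. T \<tau> 0 (z \<tau>)) has_vector_derivative A t (T t 0 (z t)) + g) (at t within S)"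
  using bounded_bilinear.has_vector_derivative[OF bounded_bilinear_blinfun_apply
      has_vector_derivative_within_subset[OF T_0_deriv[OF \<open>0 \<le> t\<close>] \<open>S \<subseteq> {0..}\<close>] z] assms(2)
  by (simp add: blinfun.bilinear_simps T_inverse add.commute)

definition forced_solution :: "real \<Rightarrow> (real \<Rightarrow> 'a) \<Rightarrow> (real \<Rightarrow> 'a) \<Rightarrow> bool" where
  "forced_solution s g v \<longleftrightarrow> (\<forall>t\<ge>s. (v has_vector_derivative A t (v t) + g t) (at t within {s..}))"

lemma forced_solution_lincomb:
  "forced_solution s g v \<Longrightarrow> forced_solution s h w \<Longrightarrow>
    forced_solution s (\<lambda>t. x *\<^sub>R g t + y *\<^sub>R h t) (\<lambda>t. x *\<^sub>R v t + y *\<^sub>R w t)"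
  unfolding forced_solution_def
  by (auto intro!: derivative_eq_intros simp: blinfun.bilinear_simps algebra_simps)

lemma forced_solution_diff:
  "forced_solution s g v \<Longrightarrow> forced_solution s h w \<Longrightarrow>
    forced_solution s (\<lambda>t. g t - h t) (\<lambda>t. v t - w t)"
  using forced_solution_lincomb[of s g v h w 1 "-1"] by simp

lemma forced_solution_cong:
  "(\<And>t. s \<le> t \<Longrightarrow> g t = h t) \<Longrightarrow> forced_solution s g v \<longleftrightarrow> forced_solution s h v"
  by (simp add: forced_solution_def)

lemma forced_solution_cont: "forced_solution s g v \<Longrightarrow> continuous_on {s..} v"
  unfolding forced_solution_def by (intro continuous_on_vector_derivative) auto

lemma forced_solution_mono:
  assumes "forced_solution s g v" "s \<le> t" shows "forced_solution t g v"
  using assms unfolding forced_solution_def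
  by (auto intro: has_vector_derivative_within_subset[of v _ _ "{s..}"])

lemma forced_solution_pull:
  assumes "0 \<le> s" "forced_solution s g v" "s \<le> t"
  shows "((\<lambda>\<tau>. T 0 \<tau> (v \<tau>)) has_vector_derivative T 0 t (g t)) (at t within {s..})"
  using T_pull_deriv[of "{s..}" t v "g t"] assms by (auto simp: forced_solution_def)

section \<open>Invariant projections and growth rate\<close>

lemma P_idem: "0 \<le> t \<Longrightarrow> P t (P t x) = P t x"
proof -
  assume "0 \<le> t"
  then have "P t o\<^sub>L P t = P t" using dichotomy by (auto simp: mu_dichotomy_def)
  from arg_cong[OF this, of "\<lambda>L. blinfun_apply L x"] show ?thesis by simp
qed

lemma P_T: "0 \<le> t \<Longrightarrow> 0 \<le> s \<Longrightarrow> P t (T t s x) = T t s (P s x)"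
proof -
  assume "0 \<le> t" "0 \<le> s"
  then have "P t o\<^sub>L T t s = T t s o\<^sub>L P s" using dichotomy by (auto simp: mu_dichotomy_def)
  from arg_cong[OF this, of "\<lambda>L. blinfun_apply L x"] show ?thesis by simp
qed

lemma Q_apply: "Q t x = x - P t x"
  by (simp add: compl_proj_def blinfun.bilinear_simps)

lemma Q_T: "0 \<le> t \<Longrightarrow> 0 \<le> s \<Longrightarrow> Q t (T t s x) = T t s (Q s x)"
  by (simp add: Q_apply P_T blinfun.bilinear_simps)

lemma Q_idem: "0 \<le> t \<Longrightarrow> Q t (Q t x) = Q t x"
  by (simp add: Q_apply P_idem blinfun.bilinear_simps)

lemma P_Q: "0 \<le> t \<Longrightarrow> P t (Q t x) = 0" and Q_P: "0 \<le> t \<Longrightarrow> Q t (P t x) = 0"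
  by (simp_all add: Q_apply P_idem blinfun.bilinear_simps)

lemma Esp_iff: "0 \<le> t \<Longrightarrow> x \<in> Esp P t \<longleftrightarrow> P t x = x"
  unfolding Esp_def by (auto simp: P_idem intro: range_eqI[OF sym])

lemma Fsp_iff: "0 \<le> t \<Longrightarrow> x \<in> Fsp P t \<longleftrightarrow> Q t x = x"
  unfolding Fsp_def by (auto simp: Q_idem intro: range_eqI[OF sym])

lemma D_ge_1: "D \<ge> 1" and a_neg: "a < 0" and b_nonneg: "b \<ge> 0"
  using dichotomy by (auto simp: mu_dichotomy_def)

lemma T_P_bound:
  assumes "0 \<le> s" "s \<le> t"
  shows "norm (T t s (P s x)) \<le> D * (\<mu> t / \<mu> s) powr a * \<mu> s powr \<epsilon> * norm x"
proof -
  have "norm (T t s o\<^sub>L P s) \<le> D * (\<mu> t / \<mu> s) powr a * \<mu> s powr \<epsilon>"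
    using dichotomy assms by (auto simp: mu_dichotomy_def)
  then have "norm (T t s o\<^sub>L P s) * norm x \<le> D * (\<mu> t / \<mu> s) powr a * \<mu> s powr \<epsilon> * norm x"
    by (intro mult_right_mono) auto
  then show ?thesis using norm_blinfun[of "T t s o\<^sub>L P s" x] by simp
qed

lemma T_Q_bound:
  assumes "0 \<le> s" "s \<le> t"
  shows "norm (T s t (Q t x)) \<le> D * (\<mu> t / \<mu> s) powr (- b) * \<mu> t powr \<epsilon> * norm x"
proof -
  have "inv (blinfun_apply (T t s)) = blinfun_apply (T s t)"
    by (rule inv_equality) (use assms T_inverse in auto)
  then have "inv (blinfun_apply (T t s)) \<circ> blinfun_apply (Q t) = blinfun_apply (T s t o\<^sub>L Q t)"
    by (auto simp: fun_eq_iff)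
  then have "norm (T s t o\<^sub>L Q t) \<le> D * (\<mu> t / \<mu> s) powr (- b) * \<mu> t powr \<epsilon>"
    using dichotomy assms unfolding mu_dichotomy_def norm_blinfun.rep_eq by metis
  then have "norm (T s t o\<^sub>L Q t) * norm x \<le> D * (\<mu> t / \<mu> s) powr (- b) * \<mu> t powr \<epsilon> * norm x"
    by (intro mult_right_mono) auto
  then show ?thesis using norm_blinfun[of "T s t o\<^sub>L Q t" x] by simp
qed

definition d\<mu> :: "real \<Rightarrow> real" where "d\<mu> t = vector_derivative \<mu> (at t within {0..})"

lemma mu_ge_1: "0 \<le> t \<Longrightarrow> 1 \<le> \<mu> t"
  using growth by (auto simp: growth_rate_def)

lemma mu_pos: "0 \<le> t \<Longrightarrow> 0 < \<mu> t"
  using mu_ge_1[of t] by simp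

lemma mu_mono: "0 \<le> s \<Longrightarrow> s \<le> t \<Longrightarrow> \<mu> s \<le> \<mu> t"
  using growth by (auto simp: growth_rate_def mono_on_def)

lemma mu_lim: "filterlim \<mu> at_top at_top"
  using growth by (auto simp: growth_rate_def)

lemma mu_deriv: "0 \<le> t \<Longrightarrow> (\<mu> has_vector_derivative d\<mu> t) (at t within {0..})"
  using growth unfolding growth_rate_def d\<mu>_def differentiable_on_def
  by (simp add: vector_derivative_works)

lemma at_within_atLeast_neq_bot: "0 \<le> t \<Longrightarrow> at t within {0::real..} \<noteq> bot"
proof -
  assume "0 \<le> t"
  then have "{t<..} \<subseteq> {0..}" by auto
  then show ?thesis
    using at_le[of "{t<..}" "{0..}" t] trivial_limit_at_right_real[of t] bot_unique by metis
qed

lemma d\<mu>_nonneg: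
  assumes "0 \<le> t" shows "0 \<le> d\<mu> t"
proof (rule tendsto_lowerbound)
  show "((\<lambda>y. (\<mu> y - \<mu> t) /\<^sub>R (y - t)) \<longlongrightarrow> d\<mu> t) (at t within {0..})"
    using mu_deriv[OF assms] by (simp only: has_vector_derivative_iff_quotient)
  have "0 \<le> (\<mu> y - \<mu> t) /\<^sub>R (y - t)" if "0 \<le> y" for y
    using mu_mono[of t y] mu_mono[of y t] assms that
    by (cases "y \<le> t") (auto simp: zero_le_mult_iff)
  then show "\<forall>\<^sub>F y in at t within {0..}. 0 \<le> (\<mu> y - \<mu> t) /\<^sub>R (y - t)"
    by (auto simp: eventually_at_filter intro!: always_eventually)
  show "at t within {0..} \<noteq> bot" using at_within_atLeast_neq_bot[OF assms] .
qed

lemma mu_powr_deriv: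
  assumes "0 \<le> t" "S \<subseteq> {0..}"
  shows "((\<lambda>t. c * \<mu> t powr p) has_vector_derivative c * (p * d\<mu> t * \<mu> t powr (p - 1))) (at t within S)"
proof -
  have m: "(\<mu> has_real_derivative d\<mu> t) (at t within S)"
    using has_vector_derivative_within_subset[OF mu_deriv[OF assms(1)] assms(2)]
    by (simp add: has_real_derivative_iff_has_vector_derivative)
  have "((\<lambda>t. c * \<mu> t powr p) has_real_derivative c * (p * d\<mu> t * \<mu> t powr (p - 1))) (at t within S)"
    by (rule derivative_eq_intros m mu_pos assms(1) refl | simp)+
  then show ?thesis by (simp add: has_real_derivative_iff_has_vector_derivative)
qed

definition weight :: "real \<Rightarrow> real \<Rightarrow> real" where
  "weight s t = (\<mu> t / \<mu> s) powr a"

lemma weight_pos: "0 \<le> s \<Longrightarrow> 0 \<le> t \<Longrightarrow> weight s t > 0"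
  using mu_pos[of s] mu_pos[of t] by (simp add: weight_def)

lemma weight_self: "0 \<le> s \<Longrightarrow> weight s s = 1"
  using mu_pos[of s] by (simp add: weight_def)

lemma weight_mult: "0 \<le> r \<Longrightarrow> 0 \<le> s \<Longrightarrow> 0 \<le> t \<Longrightarrow> weight r s * weight s t = weight r t"
  using mu_pos[of r] mu_pos[of s] mu_pos[of t]
  by (simp add: weight_def powr_divide)

lemma weight_antimono: "0 \<le> s \<Longrightarrow> 0 \<le> r \<Longrightarrow> r \<le> t \<Longrightarrow> weight s t \<le> weight s r"
  unfolding weight_def using mu_pos[of s] mu_pos[of r] mu_mono[of r t] a_neg
  by (intro powr_mono2') (auto simp: divide_right_mono)

lemma weight_le_1: "0 \<le> s \<Longrightarrow> s \<le> t \<Longrightarrow> weight s t \<le> 1"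
  using weight_antimono[of s s t] weight_self[of s] by simp

lemma mu_cont: "continuous_on {0..} \<mu>"
  by (rule continuous_on_vector_derivative) (use mu_deriv in auto)

lemma weight_cont: "0 \<le> s \<Longrightarrow> continuous_on {0..} (weight s)"
  unfolding weight_def using mu_pos[of s] mu_pos
  by (intro continuous_intros mu_cont) (auto simp: less_imp_neq[symmetric])

end

section \<open>Estimates for Green's operator\<close>

locale small_perturbation_scale = mu_dichotomy_system +
  fixes \<delta> :: real
  assumes delta_pos: "0 < \<delta>" and delta_small: "\<delta> \<le> \<epsilon> / (4 * D ^ 3)"
begin

text \<open>
  \<open>\<kappa>\<close> is the Lipschitz constant of the perturbation and of its derivative. \<open>\<theta>\<close> bounds the norm of Green's
  operator on forcing terms of size \<open>\<kappa> t\<close> in the weighted norm; the bound on \<open>\<delta>\<close> in the locale says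
  \<open>8 * \<theta> * D\<^sup>2 \<le> 1\<close>, the smallness that all later estimates use.
\<close>

definition \<kappa> :: "real \<Rightarrow> real" where
  "\<kappa> t = \<delta> * d\<mu> t * \<mu> t powr (- 3 * \<epsilon> - 1)"

definition \<theta> :: real where "\<theta> = D * \<delta> / (2 * \<epsilon>)"

lemma kappa_nonneg: "0 \<le> t \<Longrightarrow> 0 \<le> \<kappa> t"
  using d\<mu>_nonneg[of t] delta_pos by (simp add: \<kappa>_def)

lemma theta_pos: "0 < \<theta>"
  using D_ge_1 delta_pos eps_pos by (simp add: \<theta>_def)

lemma theta_D2: "8 * \<theta> * D\<^sup>2 \<le> 1"
proof -
  have "4 * D ^ 3 * \<delta> \<le> \<epsilon>" using delta_small D_ge_1 by (simp add: field_simps)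
  then show ?thesis using eps_pos by (simp add: \<theta>_def field_simps power2_eq_square power3_eq_cube)
qed

lemma theta_D: "8 * \<theta> * D \<le> 1"
proof -
  have "8 * \<theta> * D * 1 \<le> 8 * \<theta> * D * D" using theta_pos D_ge_1 by (intro mult_left_mono) auto
  then show ?thesis using theta_D2 by (simp add: power2_eq_square mult_ac)
qed

lemma theta_le: "8 * \<theta> \<le> 1"
proof -
  have "8 * \<theta> * 1 \<le> 8 * \<theta> * D" using theta_pos D_ge_1 by (intro mult_left_mono) auto
  then show ?thesis using theta_D by simp
qed

text \<open>
  A use of the dichotomy costs \<open>\<mu> t powr \<epsilon>\<close>; the product with \<open>\<kappa>\<close> is, up to a constant, the
  derivative of \<open>- \<mu> t powr (- 2 * \<epsilon>)\<close>.
\<close>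

lemma kappa_mu: "0 \<le> t \<Longrightarrow> \<mu> t powr \<epsilon> * \<kappa> t = \<delta> * (d\<mu> t * \<mu> t powr (- 2 * \<epsilon> - 1))"
proof -
  have e: "- 2 * \<epsilon> - 1 = \<epsilon> + (- 3 * \<epsilon> - 1)" by simp
  have "\<mu> t powr (- 2 * \<epsilon> - 1) = \<mu> t powr \<epsilon> * \<mu> t powr (- 3 * \<epsilon> - 1)"
    unfolding e by (rule powr_add)
  then show ?thesis by (simp add: \<kappa>_def)
qed

definition \<rho> :: "real \<Rightarrow> real" where "\<rho> t = \<mu> t powr (- 2 * \<epsilon>)"

lemma rho_nonneg: "0 \<le> \<rho> t" by (simp add: \<rho>_def)
lemma rho_le_1: "0 \<le> t \<Longrightarrow> \<rho> t \<le> 1"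
  using mu_ge_1[of t] eps_pos powr_mono[of "- 2 * \<epsilon>" 0 "\<mu> t"] by (simp add: \<rho>_def)
lemma rho_antimono: "0 \<le> s \<Longrightarrow> s \<le> t \<Longrightarrow> \<rho> t \<le> \<rho> s"
  unfolding \<rho>_def using mu_pos[of s] mu_mono[of s t] eps_pos by (intro powr_mono2') auto

lemma mu_powr_tendsto_0: "p < 0 \<Longrightarrow> ((\<lambda>t. \<mu> t powr p) \<longlongrightarrow> 0) at_top"
  by (rule tendsto_neg_powr[OF _ mu_lim])

text \<open>
  The point of the decay rate \<open>\<kappa>\<close> of the nonlinearity: the factor \<open>\<mu> \<tau> powr \<epsilon>\<close> by which the dichotomy
  fails to be uniform turns \<open>\<kappa>\<close> into a multiple of the derivative of \<open>\<rho>\<close>. Green's integrals are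
  therefore bounded by increments of \<open>\<rho>\<close>, through comparison of derivatives and without integrating
  \<open>d\<mu>\<close>, which need not be continuous.
\<close>

lemma green_bound:
  fixes B :: "'a \<Rightarrow>\<^sub>L 'a"
  assumes "\<tau>1 \<le> \<tau>2" and S: "{\<tau>1..\<tau>2} \<subseteq> S" "S \<subseteq> {0..}"
    and R: "\<And>\<tau>. \<tau> \<in> {\<tau>1..\<tau>2} \<Longrightarrow> (R has_vector_derivative T 0 \<tau> (g \<tau>)) (at \<tau> within S)"
    and g: "\<And>\<tau>. \<tau> \<in> {\<tau>1..\<tau>2} \<Longrightarrow> norm (B (T 0 \<tau> (g \<tau>))) \<le> D * C * (\<mu> \<tau> powr \<epsilon> * \<kappa> \<tau>)"
  shows "norm (B (R \<tau>2 - R \<tau>1)) \<le> \<theta> * C * (\<rho> \<tau>1 - \<rho> \<tau>2)"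
proof -
  define c where "c = - (\<theta> * C)"
  have "norm (B (R \<tau>2) - B (R \<tau>1)) \<le> c * \<mu> \<tau>2 powr (- 2 * \<epsilon>) - c * \<mu> \<tau>1 powr (- 2 * \<epsilon>)"
  proof (rule norm_increment_le[OF \<open>\<tau>1 \<le> \<tau>2\<close> S(1)])
    fix \<tau> assume \<tau>: "\<tau> \<in> {\<tau>1..\<tau>2}"
    then have \<tau>0: "0 \<le> \<tau>" using S by auto
    show "((\<lambda>\<tau>. B (R \<tau>)) has_vector_derivative B (T 0 \<tau> (g \<tau>))) (at \<tau> within S)"
      using bounded_linear.has_vector_derivative[OF blinfun.bounded_linear_right R[OF \<tau>]] .
    show "((\<lambda>\<tau>. c * \<mu> \<tau> powr (- 2 * \<epsilon>)) has_vector_derivative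
        c * (- 2 * \<epsilon> * d\<mu> \<tau> * \<mu> \<tau> powr (- 2 * \<epsilon> - 1))) (at \<tau> within S)"
      by (rule mu_powr_deriv[OF \<tau>0 S(2)])
    have "D * C * (\<mu> \<tau> powr \<epsilon> * \<kappa> \<tau>) = c * (- 2 * \<epsilon> * d\<mu> \<tau> * \<mu> \<tau> powr (- 2 * \<epsilon> - 1))"
      unfolding kappa_mu[OF \<tau>0] using eps_pos by (simp add: c_def \<theta>_def)
    then show "norm (B (T 0 \<tau> (g \<tau>))) \<le> c * (- 2 * \<epsilon> * d\<mu> \<tau> * \<mu> \<tau> powr (- 2 * \<epsilon> - 1))"
      using g[OF \<tau>] by simp
  qed
  then show ?thesis by (simp add: blinfun.bilinear_simps c_def \<rho>_def algebra_simps)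
qed

lemma green_stable:
  assumes "0 \<le> s" "s \<le> \<tau>1" "\<tau>1 \<le> \<tau>2" "\<tau>2 \<le> t" and S: "{\<tau>1..\<tau>2} \<subseteq> S" "S \<subseteq> {0..}"
    and R: "\<And>\<tau>. \<tau> \<in> {\<tau>1..\<tau>2} \<Longrightarrow> (R has_vector_derivative T 0 \<tau> (g \<tau>)) (at \<tau> within S)"
    and g: "\<And>\<tau>. \<tau> \<in> {\<tau>1..\<tau>2} \<Longrightarrow> norm (g \<tau>) \<le> N * (\<kappa> \<tau> * weight s \<tau>)"
  shows "norm (T t 0 (P 0 (R \<tau>2 - R \<tau>1))) \<le> \<theta> * (N * weight s t) * (\<rho> \<tau>1 - \<rho> \<tau>2)"
proof -
  have "norm ((T t 0 o\<^sub>L P 0) (R \<tau>2 - R \<tau>1)) \<le> \<theta> * (N * weight s t) * (\<rho> \<tau>1 - \<rho> \<tau>2)"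
  proof (rule green_bound[OF assms(3) S R])
    fix \<tau> assume \<tau>: "\<tau> \<in> {\<tau>1..\<tau>2}"
    then have t0: "0 \<le> \<tau>" "\<tau> \<le> t" "0 \<le> t" using assms by auto
    have "norm ((T t 0 o\<^sub>L P 0) (T 0 \<tau> (g \<tau>))) = norm (T t \<tau> (P \<tau> (g \<tau>)))"
      using t0 by (simp add: P_T T_comp)
    also have "\<dots> \<le> D * weight \<tau> t * \<mu> \<tau> powr \<epsilon> * norm (g \<tau>)"
      unfolding weight_def by (rule T_P_bound[OF t0(1,2)])
    also have "\<dots> \<le> D * weight \<tau> t * \<mu> \<tau> powr \<epsilon> * (N * (\<kappa> \<tau> * weight s \<tau>))"
      using D_ge_1 weight_pos[OF t0(1,3)] by (intro mult_left_mono g \<tau>) auto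
    also have "\<dots> = D * (N * (weight s \<tau> * weight \<tau> t)) * (\<mu> \<tau> powr \<epsilon> * \<kappa> \<tau>)" by (simp only: mult_ac)
    finally show "norm ((T t 0 o\<^sub>L P 0) (T 0 \<tau> (g \<tau>))) \<le> D * (N * weight s t) * (\<mu> \<tau> powr \<epsilon> * \<kappa> \<tau>)"
      using weight_mult[of s \<tau> t] t0 assms(1) by simp
  qed
  then show ?thesis by simp
qed

lemma green_unstable:
  assumes "0 \<le> s" "s \<le> t" "t \<le> \<tau>1" "\<tau>1 \<le> \<tau>2" and S: "{\<tau>1..\<tau>2} \<subseteq> S" "S \<subseteq> {0..}"
    and R: "\<And>\<tau>. \<tau> \<in> {\<tau>1..\<tau>2} \<Longrightarrow> (R has_vector_derivative T 0 \<tau> (g \<tau>)) (at \<tau> within S)"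
    and g: "\<And>\<tau>. \<tau> \<in> {\<tau>1..\<tau>2} \<Longrightarrow> norm (g \<tau>) \<le> N * (\<kappa> \<tau> * weight s \<tau>)" and N: "0 \<le> N"
  shows "norm (T t 0 (Q 0 (R \<tau>2 - R \<tau>1))) \<le> \<theta> * (N * weight s t) * (\<rho> \<tau>1 - \<rho> \<tau>2)"
proof -
  have "norm ((T t 0 o\<^sub>L Q 0) (R \<tau>2 - R \<tau>1)) \<le> \<theta> * (N * weight s t) * (\<rho> \<tau>1 - \<rho> \<tau>2)"
  proof (rule green_bound[OF assms(4) S R])
    fix \<tau> assume \<tau>: "\<tau> \<in> {\<tau>1..\<tau>2}"
    then have t0: "0 \<le> \<tau>" "t \<le> \<tau>" "0 \<le> t" using assms by auto
    have le1: "(\<mu> \<tau> / \<mu> t) powr (- b) \<le> 1"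
      using powr_mono[of "- b" 0 "\<mu> \<tau> / \<mu> t"] mu_pos[OF t0(3)] mu_mono[OF t0(3,2)] b_nonneg by simp
    have "norm ((T t 0 o\<^sub>L Q 0) (T 0 \<tau> (g \<tau>))) = norm (T t \<tau> (Q \<tau> (g \<tau>)))"
      using t0 by (simp add: Q_T T_comp)
    also have "\<dots> \<le> D * (\<mu> \<tau> / \<mu> t) powr (- b) * \<mu> \<tau> powr \<epsilon> * norm (g \<tau>)"
      by (rule T_Q_bound[OF t0(3,2)])
    also have "\<dots> \<le> D * 1 * \<mu> \<tau> powr \<epsilon> * (N * (\<kappa> \<tau> * weight s t))"
    proof (intro mult_mono le1)
      have "N * (\<kappa> \<tau> * weight s \<tau>) \<le> N * (\<kappa> \<tau> * weight s t)"
        using N kappa_nonneg[OF t0(1)] weight_antimono[OF assms(1) t0(3,2)]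
        by (intro mult_left_mono) auto
      then show "norm (g \<tau>) \<le> N * (\<kappa> \<tau> * weight s t)" using g[OF \<tau>] by simp
    qed (use D_ge_1 in auto)
    finally show "norm ((T t 0 o\<^sub>L Q 0) (T 0 \<tau> (g \<tau>))) \<le> D * (N * weight s t) * (\<mu> \<tau> powr \<epsilon> * \<kappa> \<tau>)"
      by (simp add: mult_ac)
  qed
  then show ?thesis by simp
qed

section \<open>A priori estimates for decaying solutions\<close>

definition decaying_from :: "real \<Rightarrow> (real \<Rightarrow> 'a) \<Rightarrow> bool" where
  "decaying_from s v \<longleftrightarrow> (\<exists>M. \<forall>t\<ge>s. norm (v t) \<le> M * weight s t)"

lemma decaying_bound_nonneg:
  "0 \<le> s \<Longrightarrow> (\<And>t. s \<le> t \<Longrightarrow> norm (v t) \<le> M * weight s t) \<Longrightarrow> 0 \<le> M"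
  using weight_self[of s] order_trans[OF norm_ge_zero, of "v s" M] by fastforce

lemma decaying_lincomb:
  assumes "decaying_from s v" "decaying_from s w"
  shows "decaying_from s (\<lambda>t. x *\<^sub>R v t + y *\<^sub>R w t)"
proof -
  obtain M N where M: "\<And>t. s \<le> t \<Longrightarrow> norm (v t) \<le> M * weight s t" "\<And>t. s \<le> t \<Longrightarrow> norm (w t) \<le> N * weight s t"
    using assms unfolding decaying_from_def by blast
  have "norm (x *\<^sub>R v t + y *\<^sub>R w t) \<le> (\<bar>x\<bar> * M + \<bar>y\<bar> * N) * weight s t" if "s \<le> t" for t
    using norm_triangle_ineq[of "x *\<^sub>R v t" "y *\<^sub>R w t"]
      mult_left_mono[OF M(1)[OF that] abs_ge_zero[of x]] mult_left_mono[OF M(2)[OF that] abs_ge_zero[of y]]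
    by (simp add: algebra_simps)
  then show ?thesis unfolding decaying_from_def by blast
qed

lemma decaying_diff: "decaying_from s v \<Longrightarrow> decaying_from s w \<Longrightarrow> decaying_from s (\<lambda>t. v t - w t)"
  using decaying_lincomb[of s v w 1 "-1"] by simp

lemma norm_le_PQ: "norm x \<le> norm (P t x) + norm (Q t x)"
  using norm_triangle_ineq[of "P t x" "Q t x"] by (simp add: Q_apply)

text \<open>
  The stable component is propagated forward from time \<open>s\<close>. The unstable component cannot be: it is
  propagated backward from a late time \<open>\<tau>\<close>, and for a decaying solution the boundary term at \<open>\<tau>\<close> is
  of order \<open>\<mu> \<tau> powr (a + \<epsilon> - b)\<close>, hence vanishes in the limit by the gap \<open>a + \<epsilon> < b\<close>.
\<close>

lemma forced_solution_bounds:
  assumes s: "0 \<le> s" and v: "forced_solution s g v" and dec: "decaying_from s v"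
    and g: "\<And>t. s \<le> t \<Longrightarrow> norm (g t) \<le> N * (\<kappa> t * weight s t)" and N: "0 \<le> N"
    and t: "s \<le> t"
  shows "norm (P t (v t)) \<le> weight s t * (D * \<mu> s powr \<epsilon> * norm (P s (v s)) + \<theta> * \<rho> s * N)"
    and "norm (Q t (v t)) \<le> weight s t * (\<theta> * \<rho> s * N)"
proof -
  obtain M where M: "\<And>t. s \<le> t \<Longrightarrow> norm (v t) \<le> M * weight s t"
    using dec unfolding decaying_from_def by blast
  have t0: "0 \<le> t" using s t by simp
  have S0: "{s..} \<subseteq> {0..}" using s by auto
  define z where "z \<tau> = T 0 \<tau> (v \<tau>)" for \<tau>
  have z: "(z has_vector_derivative T 0 \<tau> (g \<tau>)) (at \<tau> within {s..})" if "s \<le> \<tau>" for \<tau>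
    unfolding z_def by (rule forced_solution_pull[OF s v that])
  have Pz: "T r 0 (P 0 (z \<tau>)) = T r \<tau> (P \<tau> (v \<tau>))" and Qz: "T r 0 (Q 0 (z \<tau>)) = T r \<tau> (Q \<tau> (v \<tau>))"
    if "0 \<le> \<tau>" "0 \<le> r" for r \<tau>
    using that by (simp_all add: z_def P_T Q_T T_comp)
  have w: "0 \<le> \<theta> * (N * weight s t)" using weight_pos[OF s t0] theta_pos N by simp
  have "norm (T t 0 (P 0 (z t - z s))) \<le> \<theta> * (N * weight s t) * (\<rho> s - \<rho> t)"
    by (rule green_stable[where S = "{s..}" and g = g]) (use s t S0 z g in auto)
  also have "\<dots> \<le> \<theta> * (N * weight s t) * \<rho> s"
    using rho_nonneg[of t] by (intro mult_left_mono w) auto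
  finally have 1: "norm (T t 0 (P 0 (z t - z s))) \<le> \<theta> * (N * weight s t) * \<rho> s" .
  have "P t (v t) = T t s (P s (v s)) + T t 0 (P 0 (z t - z s))"
    using Pz[of t t] Pz[of s t] t0 s by (simp add: blinfun.bilinear_simps T_self)
  then have "norm (P t (v t)) \<le> norm (T t s (P s (v s))) + norm (T t 0 (P 0 (z t - z s)))"
    by (simp add: norm_triangle_ineq)
  also have "\<dots> \<le> D * weight s t * \<mu> s powr \<epsilon> * norm (P s (v s)) + \<theta> * (N * weight s t) * \<rho> s"
    using T_P_bound[OF s t, of "P s (v s)"] P_idem[OF s] 1 by (auto simp: weight_def)
  also have "\<dots> = weight s t * (D * \<mu> s powr \<epsilon> * norm (P s (v s)) + \<theta> * \<rho> s * N)"
    by (simp add: algebra_simps)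
  finally show "norm (P t (v t)) \<le> weight s t * (D * \<mu> s powr \<epsilon> * norm (P s (v s)) + \<theta> * \<rho> s * N)" .
  define B where "B = D * M / (\<mu> t powr (- b) * \<mu> s powr a)"
  have *: "norm (Q t (v t)) \<le> weight s t * (\<theta> * \<rho> s * N) + B * \<mu> \<tau> powr (a + \<epsilon> - b)" if "t \<le> \<tau>" for \<tau>
  proof -
    have tau0: "0 \<le> \<tau>" "s \<le> \<tau>" using that s t by auto
    have "norm (T t 0 (Q 0 (z \<tau> - z t))) \<le> \<theta> * (N * weight s t) * (\<rho> t - \<rho> \<tau>)"
      by (rule green_unstable[where S = "{s..}" and g = g]) (use s t that S0 z g N in auto)
    also have "\<dots> \<le> \<theta> * (N * weight s t) * \<rho> s"
      using rho_nonneg[of \<tau>] rho_antimono[OF s t] by (intro mult_left_mono w) auto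
    finally have 1: "norm (T t 0 (Q 0 (z \<tau> - z t))) \<le> \<theta> * (N * weight s t) * \<rho> s" .
    have "norm (T t \<tau> (Q \<tau> (v \<tau>))) \<le> D * (\<mu> \<tau> / \<mu> t) powr (- b) * \<mu> \<tau> powr \<epsilon> * norm (v \<tau>)"
      by (rule T_Q_bound[OF t0 that])
    also have "\<dots> \<le> D * (\<mu> \<tau> / \<mu> t) powr (- b) * \<mu> \<tau> powr \<epsilon> * (M * weight s \<tau>)"
      using D_ge_1 M[OF tau0(2)] by (intro mult_left_mono) auto
    also have "\<dots> = B * (\<mu> \<tau> powr (- b) * \<mu> \<tau> powr \<epsilon> * \<mu> \<tau> powr a)"
      using mu_pos[OF t0] mu_pos[OF tau0(1)] mu_pos[OF s]
      by (simp add: B_def weight_def powr_divide)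
    also have "\<mu> \<tau> powr (- b) * \<mu> \<tau> powr \<epsilon> * \<mu> \<tau> powr a = \<mu> \<tau> powr (a + \<epsilon> - b)"
      by (simp add: powr_add[symmetric] algebra_simps)
    finally have 2: "norm (T t \<tau> (Q \<tau> (v \<tau>))) \<le> B * \<mu> \<tau> powr (a + \<epsilon> - b)" .
    have "Q t (v t) = T t \<tau> (Q \<tau> (v \<tau>)) - T t 0 (Q 0 (z \<tau> - z t))"
      using Qz[of t t] Qz[of \<tau> t] t0 tau0 by (simp add: blinfun.bilinear_simps T_self)
    then have "norm (Q t (v t)) \<le> norm (T t \<tau> (Q \<tau> (v \<tau>))) + norm (T t 0 (Q 0 (z \<tau> - z t)))"
      by (simp add: norm_triangle_ineq4)
    then show ?thesis using 1 2 by (simp add: algebra_simps)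
  qed
  show "norm (Q t (v t)) \<le> weight s t * (\<theta> * \<rho> s * N)"
  proof (rule tendsto_lowerbound)
    have "((\<lambda>\<tau>. weight s t * (\<theta> * \<rho> s * N) + B * \<mu> \<tau> powr (a + \<epsilon> - b))
        \<longlongrightarrow> weight s t * (\<theta> * \<rho> s * N) + B * 0) at_top"
      using gap by (intro tendsto_intros mu_powr_tendsto_0) auto
    then show "((\<lambda>\<tau>. weight s t * (\<theta> * \<rho> s * N) + B * \<mu> \<tau> powr (a + \<epsilon> - b))
        \<longlongrightarrow> weight s t * (\<theta> * \<rho> s * N)) at_top" by simp
    show "\<forall>\<^sub>F \<tau> in at_top. norm (Q t (v t)) \<le> weight s t * (\<theta> * \<rho> s * N) + B * \<mu> \<tau> powr (a + \<epsilon> - b)"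
      using * by (auto simp: eventually_at_top_linorder)
  qed simp
qed

text \<open>
  The size of a decaying solution per unit of its stable initial value. The bounds below pair it with
  \<open>\<rho>\<close>: since \<open>\<rho> s\<close> compensates even the square of \<open>L s\<close>, the slope of the invariant graph and the
  Lipschitz constant of that slope are bounded uniformly in \<open>s\<close>.
\<close>

definition L :: "real \<Rightarrow> real" where "L s = 2 * (D * \<mu> s powr \<epsilon>)"

lemma L_nonneg: "0 \<le> L s" using D_ge_1 by (simp add: L_def)

lemma rho_L: "0 \<le> s \<Longrightarrow> \<rho> s * L s \<le> 2 * D"
proof -
  assume s: "0 \<le> s"
  have "\<rho> s * \<mu> s powr \<epsilon> = \<mu> s powr (- \<epsilon>)" by (simp add: \<rho>_def powr_add[symmetric])
  also have "\<dots> \<le> 1" using powr_mono[of "- \<epsilon>" 0 "\<mu> s"] mu_ge_1[OF s] eps_pos by simp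
  finally have "2 * D * (\<rho> s * \<mu> s powr \<epsilon>) \<le> 2 * D * 1" using D_ge_1 by (intro mult_left_mono) auto
  then show ?thesis by (simp add: L_def mult_ac)
qed

lemma rho_L2: "0 \<le> s \<Longrightarrow> \<rho> s * (L s)\<^sup>2 = 4 * D\<^sup>2"
proof -
  assume s: "0 \<le> s"
  have "\<rho> s * (\<mu> s powr \<epsilon>)\<^sup>2 = \<mu> s powr 0"
    unfolding \<rho>_def power2_eq_square by (simp only: powr_add[symmetric]) simp
  then have "\<rho> s * (\<mu> s powr \<epsilon>)\<^sup>2 = 1" using mu_pos[OF s] by simp
  then show ?thesis by (simp add: L_def power_mult_distrib mult_ac)
qed

text \<open>
  The forcing may contain a multiple \<open>\<kappa> t * norm (v t)\<close> of the solution itself, as for a difference of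
  two solutions of the nonlinear equation; for small \<open>\<delta>\<close> it is absorbed into the left-hand side.
\<close>

lemma perturbed_solution_bounds:
  assumes s: "0 \<le> s" and v: "forced_solution s g v" and dec: "decaying_from s v"
    and g: "\<And>t. s \<le> t \<Longrightarrow> norm (g t) \<le> \<kappa> t * (norm (v t) + N * weight s t)" and N: "0 \<le> N"
    and t: "s \<le> t"
  shows "norm (P t (v t)) + norm (Q t (v t)) \<le> weight s t * (L s * norm (P s (v s)) + 4 * (\<theta> * \<rho> s * N))"
    and "norm (Q s (v s)) \<le> \<theta> * \<rho> s * (L s * norm (P s (v s)) + 2 * N)"
proof -
  obtain M0 where M0: "\<And>t. s \<le> t \<Longrightarrow> norm (v t) \<le> M0 * weight s t"
    using dec unfolding decaying_from_def by blast
  define c where "c = D * \<mu> s powr \<epsilon> * norm (P s (v s))"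
  define q where "q = \<theta> * \<rho> s"
  have Lc: "L s * norm (P s (v s)) = 2 * c" by (simp add: L_def c_def)
  have c0: "0 \<le> c" using D_ge_1 by (simp add: c_def)
  have q0: "0 \<le> q" using theta_pos rho_nonneg[of s] by (simp add: q_def)
  have "q \<le> \<theta> * 1" unfolding q_def using theta_pos rho_le_1[OF s] by (intro mult_left_mono) auto
  then have q8: "8 * q \<le> 1" using theta_le by linarith
  \<comment> \<open>The least decay constant of \<open>v\<close>. It is finite, so the bound that it implies for itself can be
    solved for it.\<close>
  define M where "M = (SUP t\<in>{s..}. norm (v t) / weight s t)"
  have wp: "0 < weight s t" if "s \<le> t" for t using weight_pos s that by simp
  have bdd: "bdd_above ((\<lambda>t. norm (v t) / weight s t) ` {s..})"
    using M0 wp by (auto intro!: bdd_aboveI[of _ M0] simp: divide_le_eq)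
  have M: "norm (v t) \<le> M * weight s t" if "s \<le> t" for t
  proof -
    have "norm (v t) / weight s t \<le> M" unfolding M_def
      by (rule cSUP_upper[OF _ bdd]) (use that in auto)
    then show ?thesis using wp[OF that] by (simp add: divide_le_eq)
  qed
  have Mpos: "0 \<le> M" by (rule decaying_bound_nonneg[OF s M])
  have g': "norm (g t) \<le> (M + N) * (\<kappa> t * weight s t)" if "s \<le> t" for t
  proof -
    have "norm (g t) \<le> \<kappa> t * (M * weight s t + N * weight s t)"
      using g[OF that] M[OF that] kappa_nonneg[of t] s that
      by (meson add_right_mono mult_left_mono order_trans)
    then show ?thesis by (simp add: algebra_simps)
  qed
  have MN: "0 \<le> M + N" using Mpos N by simp
  have est: "norm (P t (v t)) \<le> weight s t * (c + q * (M + N))"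
      "norm (Q t (v t)) \<le> weight s t * (q * (M + N))" if "s \<le> t" for t
    using forced_solution_bounds[OF s v dec g' MN that] by (auto simp: c_def q_def)
  have "M \<le> c + 2 * (q * (M + N))" unfolding M_def
  proof (rule cSUP_least)
    fix t assume "t \<in> {s..}"
    then have t: "s \<le> t" by simp
    have "norm (v t) \<le> norm (P t (v t)) + norm (Q t (v t))" by (rule norm_le_PQ)
    also have "\<dots> \<le> (c + 2 * (q * (M + N))) * weight s t"
      using est[OF t] by (simp add: algebra_simps)
    finally show "norm (v t) / weight s t \<le> c + 2 * (q * ((SUP t\<in>{s..}. norm (v t) / weight s t) + N))"
      unfolding M_def using wp[OF t] by (simp add: divide_le_eq)
  qed simp
  moreover have "8 * q * M \<le> M" using q8 Mpos mult_right_mono[of "8*q" 1 M] by simp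
  moreover have "8 * q * N \<le> N" using q8 N mult_right_mono[of "8*q" 1 N] by simp
  moreover have qc: "8 * q * c \<le> c" using q8 c0 mult_right_mono[of "8*q" 1 c] by simp
  ultimately have M2: "M + N \<le> 2 * c + 2 * N" using c0 N by (simp add: algebra_simps)
  have qM: "q * (M + N) \<le> q * (2 * c + 2 * N)" using M2 q0 by (rule mult_left_mono)
  show "norm (Q s (v s)) \<le> \<theta> * \<rho> s * (L s * norm (P s (v s)) + 2 * N)"
    using est(2)[OF order_refl] qM weight_self[OF s] by (simp add: Lc q_def)
  have "norm (P t (v t)) + norm (Q t (v t)) \<le> weight s t * (c + 2 * (q * (M + N)))"
    using est[OF t] by (simp add: algebra_simps)
  also have "\<dots> \<le> weight s t * (2 * c + 4 * (q * N))"
    using wp[OF t] qM qc c0 by (intro mult_left_mono) (auto simp: algebra_simps)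
  finally show "norm (P t (v t)) + norm (Q t (v t)) \<le> weight s t * (L s * norm (P s (v s)) + 4 * (\<theta> * \<rho> s * N))"
    by (simp add: Lc q_def)
qed

lemma lipschitz_forcing_bounds:
  assumes s: "0 \<le> s" and v: "forced_solution s g v" "decaying_from s v"
    and g: "\<And>t. s \<le> t \<Longrightarrow> norm (g t) \<le> \<kappa> t * norm (v t)"
  shows "s \<le> t \<Longrightarrow> norm (P t (v t)) + norm (Q t (v t)) \<le> weight s t * (L s * norm (P s (v s)))"
    and "norm (Q s (v s)) \<le> norm (P s (v s))"
proof -
  have g': "norm (g t) \<le> \<kappa> t * (norm (v t) + 0 * weight s t)" if "s \<le> t" for t using g[OF that] by simp
  show "norm (P t (v t)) + norm (Q t (v t)) \<le> weight s t * (L s * norm (P s (v s)))" if "s \<le> t"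
    using perturbed_solution_bounds(1)[OF s v g' order_refl that] by simp
  have "norm (Q s (v s)) \<le> \<theta> * (\<rho> s * L s) * norm (P s (v s))"
    using perturbed_solution_bounds(2)[OF s v g' order_refl order_refl] by (simp add: mult_ac)
  also have "\<dots> \<le> 1 * norm (P s (v s))"
  proof (rule mult_right_mono)
    have "\<theta> * (\<rho> s * L s) \<le> \<theta> * (2 * D)" using rho_L[OF s] theta_pos by (intro mult_left_mono) auto
    then show "\<theta> * (\<rho> s * L s) \<le> 1" using theta_D theta_pos D_ge_1 by linarith
  qed auto
  finally show "norm (Q s (v s)) \<le> norm (P s (v s))" by simp
qed

text \<open>
  Used twice, with \<open>x\<close> the distance of two solutions: for the remainder of the first order expansion
  in the initial value, where \<open>y = x\<close>, and for the difference of two solutions of linearized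
  equations, where \<open>y\<close> is the size of one of them.
\<close>

lemma quadratic_forcing_bounds:
  assumes s: "0 \<le> s" and r: "forced_solution s g r" "decaying_from s r"
    and g: "\<And>t. s \<le> t \<Longrightarrow> norm (g t) \<le> \<kappa> t * norm (r t) + \<kappa> t * (x t * y t)"
    and x: "\<And>t. s \<le> t \<Longrightarrow> 0 \<le> x t" "\<And>t. s \<le> t \<Longrightarrow> x t \<le> weight s t * (L s * p)"
    and y: "\<And>t. s \<le> t \<Longrightarrow> 0 \<le> y t" "\<And>t. s \<le> t \<Longrightarrow> y t \<le> weight s t * (L s * q)"
    and pq: "0 \<le> p" "0 \<le> q" and P0: "P s (r s) = 0"
  shows "s \<le> t \<Longrightarrow> norm (P t (r t)) + norm (Q t (r t)) \<le> weight s t * (2 * (p * q))"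
    and "norm (Q s (r s)) \<le> p * q"
proof -
  define N where "N = (L s * p) * (L s * q)"
  have N0: "0 \<le> N" using pq L_nonneg[of s] by (simp add: N_def)
  have g': "norm (g t) \<le> \<kappa> t * (norm (r t) + N * weight s t)" if t: "s \<le> t" for t
  proof -
    have w: "0 < weight s t" "weight s t \<le> 1" using weight_pos[of s t] weight_le_1[of s t] s t by auto
    have "x t * y t \<le> (weight s t * (L s * p)) * (weight s t * (L s * q))"
      using x[OF t] y[OF t] w pq L_nonneg[of s] by (intro mult_mono) auto
    also have "\<dots> = weight s t * (N * weight s t)" by (simp add: N_def mult_ac)
    also have "\<dots> \<le> 1 * (N * weight s t)" using w N0 by (intro mult_right_mono) auto
    finally have "\<kappa> t * (x t * y t) \<le> \<kappa> t * (N * weight s t)"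
      using kappa_nonneg[of t] s t by (intro mult_left_mono) auto
    then show ?thesis using g[OF t] by (simp add: algebra_simps)
  qed
  have "\<theta> * \<rho> s * N = \<theta> * (4 * D\<^sup>2) * (p * q)"
    unfolding rho_L2[OF s, symmetric] by (simp add: N_def power2_eq_square mult_ac)
  also have "\<dots> \<le> 1/2 * (p * q)"
    using theta_D2 pq by (intro mult_right_mono) auto
  finally have N: "\<theta> * \<rho> s * N \<le> 1/2 * (p * q)" .
  show "norm (Q s (r s)) \<le> p * q"
    using perturbed_solution_bounds(2)[OF s r g' N0 order_refl] N by (simp add: P0)
  assume t: "s \<le> t"
  have "norm (P t (r t)) + norm (Q t (r t)) \<le> weight s t * (4 * (\<theta> * \<rho> s * N))"
    using perturbed_solution_bounds(1)[OF s r g' N0 t] by (simp add: P0)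
  also have "\<dots> \<le> weight s t * (2 * (p * q))"
    using N weight_pos[of s t] s t by (intro mult_left_mono) (simp_all add: mult_ac)
  finally show "norm (P t (r t)) + norm (Q t (r t)) \<le> weight s t * (2 * (p * q))" .
qed

section \<open>Existence of decaying solutions\<close>

text \<open>
  Variation of constants with the unstable part started at infinity: \<open>\<zeta>\<close> below is the limit of the
  unstable part of the integral of \<open>T 0 \<tau> (g \<tau>)\<close>, and subtracting it leaves only the tail of the integral.
\<close>

lemma forced_solution_exists:
  assumes s: "0 \<le> s" and \<xi>: "P s \<xi> = \<xi>"
    and gc: "continuous_on {s..} g"
    and g: "\<And>t. s \<le> t \<Longrightarrow> norm (g t) \<le> N * (\<kappa> t * weight s t)" and N: "0 \<le> N"
  obtains v where "forced_solution s g v" "P s (v s) = \<xi>" "decaying_from s v"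
proof -
  have S0: "{s..} \<subseteq> {0..}" using s by auto
  have "continuous_on {s..} (\<lambda>\<tau>. T 0 \<tau> (g \<tau>))"
    by (intro continuous_on_blinfun_apply
        continuous_on_subset[OF continuous_T_to_0 S0] gc)
  then obtain R where R: "\<And>\<tau>. s \<le> \<tau> \<Longrightarrow> (R has_vector_derivative T 0 \<tau> (g \<tau>)) (at \<tau> within {s..})"
    using antiderivative_atLeast by blast
  have unst: "norm (T t 0 (Q 0 (R \<tau>2 - R \<tau>1))) \<le> \<theta> * (N * weight s t) * (\<rho> \<tau>1 - \<rho> \<tau>2)"
    if "s \<le> t" "t \<le> \<tau>1" "\<tau>1 \<le> \<tau>2" for t \<tau>1 \<tau>2
    by (rule green_unstable[where S = "{s..}" and g = g]) (use that s R g N S0 in auto)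
  define X where "X n = Q 0 (R (s + real n))" for n
  have rho_seq: "(\<lambda>n. c * \<rho> (s + real n)) \<longlonglongrightarrow> 0" for c
  proof -
    have "filterlim (\<lambda>n. s + real n) at_top sequentially"
      by (rule filterlim_tendsto_add_at_top[OF tendsto_const filterlim_real_sequentially])
    then have "(\<lambda>n. \<rho> (s + real n)) \<longlonglongrightarrow> 0"
      unfolding \<rho>_def using eps_pos by (intro filterlim_compose[OF mu_powr_tendsto_0]) auto
    then show ?thesis by (rule tendsto_mult_right_zero)
  qed
  define B where "B = norm (T 0 s) * (\<theta> * N)"
  have XB: "norm (X i - X j) \<le> B * \<rho> (s + real j)" if "j \<le> i" for i j
  proof -
    have "X i - X j = T 0 s (T s 0 (Q 0 (R (s + real i) - R (s + real j))))"
      using s by (simp add: X_def T_inverse blinfun.bilinear_simps)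
    then have "norm (X i - X j) \<le> norm (T 0 s) * norm (T s 0 (Q 0 (R (s + real i) - R (s + real j))))"
      by (metis norm_blinfun)
    also have "\<dots> \<le> norm (T 0 s) * (\<theta> * (N * weight s s) * (\<rho> (s + real j) - \<rho> (s + real i)))"
      using that by (intro mult_left_mono unst) auto
    also have "\<dots> \<le> norm (T 0 s) * (\<theta> * N * \<rho> (s + real j))"
      using weight_self[OF s] theta_pos N rho_nonneg by (intro mult_left_mono) (auto intro: mult_left_mono)
    finally show ?thesis by (simp add: B_def mult_ac)
  qed
  from Cauchy_if_tail_bound[OF XB rho_seq]
  obtain \<zeta> where \<zeta>: "X \<longlonglongrightarrow> \<zeta>" using Cauchy_convergent convergent_def by blast
  have Q\<zeta>: "Q 0 \<zeta> = \<zeta>"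
  proof (rule LIMSEQ_unique[OF _ \<zeta>])
    have "(\<lambda>n. Q 0 (X n)) \<longlonglongrightarrow> Q 0 \<zeta>" by (intro tendsto_intros \<zeta>)
    then show "X \<longlonglongrightarrow> Q 0 \<zeta>" by (simp add: X_def[abs_def] Q_idem)
  qed
  define z where "z t = T 0 s \<xi> + (R t - R s) - (\<zeta> - Q 0 (R s))" for t
  define v where "v t = T t 0 (z t)" for t
  have Q\<xi>: "Q s \<xi> = 0" using \<xi> by (simp add: Q_apply)
  have Pz: "P 0 (z t) = T 0 s \<xi> + P 0 (R t - R s)" for t
    using P_Q[of 0 "R s"] P_Q[of 0 \<zeta>] s \<xi> by (simp add: z_def blinfun.bilinear_simps P_T Q\<zeta>)
  have Qz: "Q 0 (z t) = Q 0 (R t) - \<zeta>" for t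
    using s by (simp add: z_def blinfun.bilinear_simps Q_T Q\<xi> Q_idem Q\<zeta>)
  show ?thesis
  proof (rule that)
    have "(z has_vector_derivative T 0 t (g t)) (at t within {s..})" if "s \<le> t" for t
      unfolding z_def using R[OF that] by (auto intro!: derivative_eq_intros)
    then show "forced_solution s g v"
      unfolding forced_solution_def v_def using S0 s by (auto intro!: T_push_deriv)
  next
    have "P s (v s) = T s 0 (P 0 (z s))" using s by (simp add: v_def P_T)
    then show "P s (v s) = \<xi>" using s by (simp add: Pz T_inverse)
  next
    have "norm (v t) \<le> (D * \<mu> s powr \<epsilon> * norm \<xi> + 2 * (\<theta> * N)) * weight s t" if t: "s \<le> t" for t
    proof -
      have t0: "0 \<le> t" using s t by simp
      have w: "0 < weight s t" using weight_pos s t0 by simp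
      have "norm (T t 0 (P 0 (R t - R s))) \<le> \<theta> * (N * weight s t) * (\<rho> s - \<rho> t)"
        by (rule green_stable[where S = "{s..}" and g = g]) (use s t S0 R g in auto)
      also have "\<dots> \<le> \<theta> * (N * weight s t) * 1"
        using theta_pos N w rho_nonneg[of t] rho_le_1[OF s] by (intro mult_left_mono) auto
      finally have 1: "norm (T t 0 (P 0 (R t - R s))) \<le> \<theta> * (N * weight s t)" by simp
      have 2: "norm (T t 0 (Q 0 (R t) - \<zeta>)) \<le> \<theta> * (N * weight s t)"
      proof (rule tendsto_upperbound)
        show "((\<lambda>n. norm (T t 0 (Q 0 (R t) - X n))) \<longlongrightarrow> norm (T t 0 (Q 0 (R t) - \<zeta>))) sequentially"
          by (intro tendsto_intros \<zeta>)
        obtain m where m: "t \<le> s + real m" using real_arch_simple[of "t - s"] by (auto simp: algebra_simps)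
        have "norm (T t 0 (Q 0 (R t) - X n)) \<le> \<theta> * (N * weight s t)" if "m \<le> n" for n
        proof -
          have "norm (T t 0 (Q 0 (R t) - X n)) = norm (T t 0 (Q 0 (R (s + real n) - R t)))"
            by (simp add: X_def blinfun.bilinear_simps norm_minus_commute)
          also have "\<dots> \<le> \<theta> * (N * weight s t) * (\<rho> t - \<rho> (s + real n))"
            by (rule unst) (use t m that in auto)
          also have "\<dots> \<le> \<theta> * (N * weight s t) * 1"
            using theta_pos N w rho_nonneg[of "s + real n"] rho_le_1[OF t0] by (intro mult_left_mono) auto
          finally show ?thesis by simp
        qed
        then show "\<forall>\<^sub>F n in sequentially. norm (T t 0 (Q 0 (R t) - X n)) \<le> \<theta> * (N * weight s t)"
          by (auto simp: eventually_sequentially)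
      qed simp
      have 3: "norm (T t s \<xi>) \<le> D * weight s t * \<mu> s powr \<epsilon> * norm \<xi>"
        using T_P_bound[OF s t, of \<xi>] \<xi> by (simp add: weight_def)
      have "z t = P 0 (z t) + Q 0 (z t)" by (simp add: Q_apply)
      then have "z t = T 0 s \<xi> + P 0 (R t - R s) + (Q 0 (R t) - \<zeta>)"
        by (simp only: Pz Qz)
      then have "v t = T t s \<xi> + T t 0 (P 0 (R t - R s)) + T t 0 (Q 0 (R t) - \<zeta>)"
        using s t0 T_comp[of s 0 t \<xi>] unfolding v_def by (simp only: blinfun.add_right) 
      then have "norm (v t) \<le> norm (T t s \<xi>) + norm (T t 0 (P 0 (R t - R s))) + norm (T t 0 (Q 0 (R t) - \<zeta>))"
        by (simp only:) (intro norm_triangle_le add_right_mono norm_triangle_ineq)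
      then show ?thesis using 1 2 3 by (simp add: algebra_simps)
    qed
    then show "decaying_from s v" unfolding decaying_from_def by blast
  qed
qed

text \<open>
  Contraction in the space of decaying functions, with the solution operator of \<open>forced_solution_exists\<close>.
  The lemma serves both the perturbed equation and its linearization along a solution.
\<close>

lemma decaying_solution_exists:
  fixes F :: "real \<Rightarrow> 'a \<Rightarrow> 'a"
  assumes s: "0 \<le> s" and \<xi>: "P s \<xi> = \<xi>"
    and cont: "\<And>u. continuous_on {s..} u \<Longrightarrow> continuous_on {s..} (\<lambda>t. F t (u t))"
    and F0: "\<And>t. s \<le> t \<Longrightarrow> F t 0 = 0"
    and lip: "\<And>t u v. s \<le> t \<Longrightarrow> norm (F t u - F t v) \<le> \<kappa> t * norm (u - v)"
  obtains v where "forced_solution s (\<lambda>t. F t (v t)) v" "P s (v s) = \<xi>" "decaying_from s v"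
proof -
  define sl where "sl u w \<longleftrightarrow> forced_solution s (\<lambda>t. F t (u t)) w \<and> P s (w s) = \<xi> \<and> decaying_from s w" for u w
  define \<Phi> where "\<Phi> u = (SOME w. sl u w)" for u
  have lin: "norm (F t (u t)) \<le> M * (\<kappa> t * weight s t)"
    if "\<forall>t\<ge>s. norm (u t) \<le> M * weight s t" "s \<le> t" for u M t
  proof -
    have "norm (F t (u t)) \<le> \<kappa> t * norm (u t)" using lip[of t "u t" 0] F0 that(2) by simp
    also have "\<dots> \<le> \<kappa> t * (M * weight s t)"
      using that kappa_nonneg[of t] s by (intro mult_left_mono) auto
    finally show ?thesis by (simp add: mult_ac)
  qed
  have \<Phi>: "sl u (\<Phi> u)" if u: "weighted_on {s..} (weight s) u" for u
  proof -
    obtain M where M: "\<forall>t\<ge>s. norm (u t) \<le> M * weight s t" and uc: "continuous_on {s..} u"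
      using u by (auto simp: weighted_on_def)
    have M0: "0 \<le> M" using decaying_bound_nonneg[OF s] M by blast
    obtain w where "sl u w"
      using forced_solution_exists[OF s \<xi> cont[OF uc] lin[OF M] M0] unfolding sl_def by blast
    then show ?thesis unfolding \<Phi>_def by (rule someI[of "sl u"])
  qed
  obtain v where v: "weighted_on {s..} (weight s) v" "\<And>t. t \<in> {s..} \<Longrightarrow> \<Phi> v t = v t"
  proof (rule weighted_fixpoint[of "{s..}" "weight s" \<Phi>])
    show "continuous_on {s..} (weight s)"
      by (rule continuous_on_subset[OF weight_cont[OF s]]) (use s in auto)
    show "weight s t > 0" if "t \<in> {s..}" for t using weight_pos[of s t] s that by simp
    show "weighted_on {s..} (weight s) (\<Phi> u)" if "weighted_on {s..} (weight s) u" for u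
      using \<Phi>[OF that] forced_solution_cont by (auto simp: weighted_on_def sl_def decaying_from_def)
  next
    fix u v :: "real \<Rightarrow> 'a" and N t :: real
    assume u: "weighted_on {s..} (weight s) u" and v: "weighted_on {s..} (weight s) v" and N: "0 \<le> N"
      and uv: "\<And>t. t \<in> {s..} \<Longrightarrow> norm (u t - v t) \<le> N * weight s t" and t: "t \<in> {s..}"
    note Pu = \<Phi>[OF u] and Pv = \<Phi>[OF v]
    define d where "d t = \<Phi> u t - \<Phi> v t" for t
    have d: "forced_solution s (\<lambda>t. F t (u t) - F t (v t)) d" "decaying_from s d"
      unfolding d_def using Pu Pv by (auto simp: sl_def intro: forced_solution_diff decaying_diff)
    have F: "norm (F t (u t) - F t (v t)) \<le> N * (\<kappa> t * weight s t)" if "s \<le> t" for t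
    proof -
      have "norm (F t (u t) - F t (v t)) \<le> \<kappa> t * norm (u t - v t)" using lip that by simp
      also have "\<dots> \<le> \<kappa> t * (N * weight s t)"
        using uv that kappa_nonneg[of t] s by (intro mult_left_mono) auto
      finally show ?thesis by (simp add: mult_ac)
    qed
    have t': "s \<le> t" using t by simp
    have w: "0 < weight s t" using weight_pos[of s t] s t' by simp
    have Pd: "P s (d s) = 0" using Pu Pv by (simp add: sl_def d_def blinfun.bilinear_simps)
    have "norm (d t) \<le> norm (P t (d t)) + norm (Q t (d t))" by (rule norm_le_PQ)
    also have "\<dots> \<le> weight s t * (2 * (\<theta> * \<rho> s * N))"
      using forced_solution_bounds[OF s d F N t'] by (simp add: Pd)
    also have "\<dots> \<le> weight s t * (N / 2)"
    proof (rule mult_left_mono)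
      have "\<theta> * \<rho> s * N \<le> (1/8) * 1 * N"
        using theta_pos theta_le rho_nonneg rho_le_1[OF s] N by (intro mult_right_mono mult_mono) auto
      then show "2 * (\<theta> * \<rho> s * N) \<le> N / 2" using N by simp
    qed (use w in simp)
    finally show "norm (\<Phi> u t - \<Phi> v t) \<le> N / 2 * weight s t" by (simp add: d_def mult_ac)
  qed (blast intro: that)
  have P: "sl v (\<Phi> v)" by (rule \<Phi>[OF v(1)])
  have "forced_solution s (\<lambda>t. F t (\<Phi> v t)) (\<Phi> v)"
    using P v(2) by (subst forced_solution_cong[where h = "\<lambda>t. F t (v t)"]) (auto simp: sl_def)
  then show ?thesis using that[of "\<Phi> v"] P by (auto simp: sl_def)
qed

end

section \<open>The perturbation\<close>

locale perturbed_system = small_perturbation_scale +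
  fixes f :: "real \<Rightarrow> 'a \<Rightarrow> 'a"
  assumes admissible: "admissible_perturbation \<mu> \<epsilon> \<delta> f"
begin

definition f' :: "real \<Rightarrow> 'a \<Rightarrow> 'a \<Rightarrow>\<^sub>L 'a" where
  "f' t u = Blinfun (frechet_derivative (f t) (at u))"

lemma f_C1: "C1_on ({0..} \<times> UNIV) (\<lambda>(t, v). f t v)"
  using admissible by (simp add: admissible_perturbation_def)

text \<open>
  The derivative in the second variable is a restriction of the joint derivative, hence depends
  continuously on both variables.
\<close>

lemma f_derivative_aux:
  obtains G :: "real \<times> 'a \<Rightarrow> (real \<times> 'a) \<Rightarrow>\<^sub>L 'a" where "continuous_on ({0..} \<times> UNIV) G"
    "\<And>t u. 0 \<le> t \<Longrightarrow> (f t has_derivative blinfun_apply (G (t, u) o\<^sub>L Pair_right)) (at u)"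
proof -
  obtain G where G: "continuous_on ({0..} \<times> UNIV) G"
    "\<And>x. x \<in> {0..} \<times> UNIV \<Longrightarrow> ((\<lambda>(t, v). f t v) has_derivative blinfun_apply (G x)) (at x within {0..} \<times> UNIV)"
    using C1_onE[OF f_C1] by blast
  show ?thesis
  proof (rule that[OF G(1)])
    fix t :: real and u :: 'a assume t: "0 \<le> t"
    have "((\<lambda>v. (t, v)) has_derivative (\<lambda>h. (0, h))) (at u)"
      by (auto intro!: derivative_eq_intros)
    then have "((\<lambda>v. case (t, v) of (t, v) \<Rightarrow> f t v) has_derivative (\<lambda>h. G (t, u) (0, h))) (at u)"
      by (rule has_derivative_in_compose2[OF G(2), rotated 3]) (use t in auto)
    then have "((\<lambda>v. f t v) has_derivative (\<lambda>h. G (t, u) (0, h))) (at u)" by simp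
    moreover have "(\<lambda>h. blinfun_apply (G (t, u)) (0, h)) = blinfun_apply (G (t, u) o\<^sub>L Pair_right)" by auto
    ultimately show "(f t has_derivative blinfun_apply (G (t, u) o\<^sub>L Pair_right)) (at u)" by simp
  qed
qed

lemma f_deriv: "0 \<le> t \<Longrightarrow> (f t has_derivative blinfun_apply (f' t u)) (at u)"
proof -
  assume t: "0 \<le> t"
  obtain G :: "real \<times> 'a \<Rightarrow> (real \<times> 'a) \<Rightarrow>\<^sub>L 'a" where "(f t has_derivative blinfun_apply (G (t, u) o\<^sub>L Pair_right)) (at u)"
    using f_derivative_aux t by metis
  then have "f' t u = G (t, u) o\<^sub>L Pair_right"
    unfolding f'_def by (simp add: frechet_derivative_at[symmetric] blinfun_apply_inverse)
  then show ?thesis using \<open>(f t has_derivative blinfun_apply (G (t, u) o\<^sub>L Pair_right)) (at u)\<close> by simp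
qed

lemma f'_apply: "0 \<le> t \<Longrightarrow> blinfun_apply (f' t u) = frechet_derivative (f t) (at u)"
  by (rule frechet_derivative_at[OF f_deriv])

lemma f'_cont: "continuous_on ({0..} \<times> UNIV) (\<lambda>(t, u). f' t u)"
proof -
  obtain G :: "real \<times> 'a \<Rightarrow> (real \<times> 'a) \<Rightarrow>\<^sub>L 'a" where G: "continuous_on ({0..} \<times> UNIV) G"
    "\<And>t u. 0 \<le> t \<Longrightarrow> (f t has_derivative blinfun_apply (G (t, u) o\<^sub>L Pair_right)) (at u)"
    using f_derivative_aux by metis
  have "continuous_on ({0..} \<times> UNIV) (\<lambda>x. G x o\<^sub>L Pair_right)"
    by (intro bounded_bilinear.continuous_on[OF bounded_bilinear_blinfun_compose] G continuous_intros)
  then show ?thesis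
  proof (rule continuous_on_eq)
    fix x :: "real \<times> 'a" assume "x \<in> {0..} \<times> UNIV"
    then have t: "0 \<le> fst x" by auto
    have "blinfun_apply (G (fst x, snd x) o\<^sub>L Pair_right) = blinfun_apply (f' (fst x) (snd x))"
      using has_derivative_unique[OF G(2)[OF t] f_deriv[OF t]] .
    then show "G x o\<^sub>L Pair_right = (case x of (t, u) \<Rightarrow> f' t u)"
      by (simp add: blinfun_apply_inject case_prod_beta)
  qed
qed

lemma f_zero: "0 \<le> t \<Longrightarrow> f t 0 = 0"
  and f'_zero: "0 \<le> t \<Longrightarrow> f' t 0 = 0"
  and f'_bound: "0 \<le> t \<Longrightarrow> norm (f' t u) \<le> \<kappa> t"
  and f'_lipschitz: "0 \<le> t \<Longrightarrow> norm (f' t u - f' t v) \<le> \<kappa> t * norm (u - v)"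
proof -
  assume t: "0 \<le> t"
  have *: "f t 0 = 0" "frechet_derivative (f t) (at 0) = (\<lambda>h. 0)"
     "onorm (frechet_derivative (f t) (at u)) \<le> \<kappa> t"
     "onorm (\<lambda>h. frechet_derivative (f t) (at u) h - frechet_derivative (f t) (at v) h) \<le> \<kappa> t * norm (u - v)"
    using admissible t unfolding admissible_perturbation_def \<kappa>_def d\<mu>_def Let_def by blast+
  show "f t 0 = 0" by (rule *)
  show "f' t 0 = 0" using *(2) t by (intro blinfun_eqI) (simp add: f'_apply)
  show "norm (f' t u) \<le> \<kappa> t" using *(3) t by (simp add: f'_apply norm_blinfun.rep_eq)
  show "norm (f' t u - f' t v) \<le> \<kappa> t * norm (u - v)"
    using *(4) t by (simp add: f'_apply norm_blinfun.rep_eq minus_blinfun.rep_eq)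
qed

lemma f_lipschitz:
  assumes "0 \<le> t" shows "norm (f t u - f t v) \<le> \<kappa> t * norm (u - v)"
  using differentiable_bound[of UNIV "f t" "\<lambda>u. blinfun_apply (f' t u)" "\<kappa> t" u v]
    f_deriv[OF assms] f'_bound[OF assms] by (simp add: norm_blinfun.rep_eq)

lemma f_remainder:
  assumes "0 \<le> t" shows "norm (f t v - f t u - f' t u (v - u)) \<le> \<kappa> t * (norm (v - u))\<^sup>2"
  by (rule lipschitz_derivative_remainder) (use assms f_deriv f'_lipschitz kappa_nonneg in auto)

lemma f_along_cont:
  assumes "continuous_on S u" "S \<subseteq> {0..}" shows "continuous_on S (\<lambda>t. f t (u t))"
  using continuous_on_compose2[OF C1_on_imp_continuous_on[OF f_C1]
      continuous_on_Pair[OF continuous_on_id assms(1)]] assms(2) by auto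

lemma f'_along_cont:
  assumes "continuous_on S u" "S \<subseteq> {0..}" shows "continuous_on S (\<lambda>t. f' t (u t))"
  using continuous_on_compose2[OF f'_cont
      continuous_on_Pair[OF continuous_on_id assms(1)]] assms(2) by auto

section \<open>Decaying solutions and their dependence on the initial value\<close>

abbreviation "solution_from s v \<equiv> forced_solution s (\<lambda>t. f t (v t)) v"

abbreviation "linearized_from s v w \<equiv> forced_solution s (\<lambda>t. f' t (v t) (w t)) w"

lemma decaying_solution_diff:
  assumes s: "0 \<le> s" and v: "solution_from s v" "decaying_from s v"
    and w: "solution_from s w" "decaying_from s w"
  shows "s \<le> t \<Longrightarrow> norm (P t (v t - w t)) + norm (Q t (v t - w t)) \<le> weight s t * (L s * norm (P s (v s - w s)))"
    and "norm (Q s (v s - w s)) \<le> norm (P s (v s - w s))"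
proof -
  have g: "norm (f t (v t) - f t (w t)) \<le> \<kappa> t * norm (v t - w t)" if "s \<le> t" for t
    using f_lipschitz[of t] s that by simp
  note est = lipschitz_forcing_bounds[OF s forced_solution_diff[OF v(1) w(1)] decaying_diff[OF v(2) w(2)]]
  show "s \<le> t \<Longrightarrow> norm (P t (v t - w t)) + norm (Q t (v t - w t)) \<le> weight s t * (L s * norm (P s (v s - w s)))"
    using g by (rule est(1))
  show "norm (Q s (v s - w s)) \<le> norm (P s (v s - w s))"
    using g by (rule est(2))
qed

lemma decaying_solution_unique:
  assumes s: "0 \<le> s" and v: "solution_from s v" "decaying_from s v"
    and w: "solution_from s w" "decaying_from s w" and t: "s \<le> t" and eq: "P s (v s) = P s (w s)"
  shows "v t = w t"
proof -
  have "norm (P t (v t - w t)) + norm (Q t (v t - w t)) \<le> 0"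
    using decaying_solution_diff(1)[OF s v w t] by (simp add: eq blinfun.diff_right[of "P s"])
  from order_trans[OF norm_le_PQ this] show ?thesis by simp
qed

definition stable_solution :: "real \<Rightarrow> 'a \<Rightarrow> real \<Rightarrow> 'a" where
  "stable_solution s \<xi> = (SOME v. solution_from s v \<and> P s (v s) = \<xi> \<and> decaying_from s v)"

lemma stable_solution:
  assumes s: "0 \<le> s" and \<xi>: "P s \<xi> = \<xi>"
  shows "solution_from s (stable_solution s \<xi>)" "P s (stable_solution s \<xi> s) = \<xi>"
    "decaying_from s (stable_solution s \<xi>)"
proof -
  obtain v where "solution_from s v" "P s (v s) = \<xi>" "decaying_from s v"
  proof (rule decaying_solution_exists[OF s \<xi>, of f])
    show "continuous_on {s..} (\<lambda>t. f t (u t))" if "continuous_on {s..} u" for u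
      by (rule f_along_cont[OF that]) (use s in auto)
  qed (use s f_zero f_lipschitz in auto)
  then have "\<exists>v. solution_from s v \<and> P s (v s) = \<xi> \<and> decaying_from s v" by blast
  from someI_ex[OF this] show "solution_from s (stable_solution s \<xi>)" "P s (stable_solution s \<xi> s) = \<xi>"
    "decaying_from s (stable_solution s \<xi>)" unfolding stable_solution_def by blast+
qed

lemma f'_apply_bound: "0 \<le> t \<Longrightarrow> norm (f' t u w) \<le> \<kappa> t * norm w"
  using norm_blinfun[of "f' t u" w] mult_right_mono[OF f'_bound[of t u] norm_ge_zero[of w]] by linarith

lemma linearized_bounds:
  assumes s: "0 \<le> s" and w: "linearized_from s v w" "decaying_from s w"
  shows "s \<le> t \<Longrightarrow> norm (P t (w t)) + norm (Q t (w t)) \<le> weight s t * (L s * norm (P s (w s)))"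
    and "norm (Q s (w s)) \<le> norm (P s (w s))"
  by (rule lipschitz_forcing_bounds[OF s w]; use s f'_apply_bound in simp)+

text \<open>
  The candidate for the derivative of \<open>stable_solution\<close> with respect to its stable initial value: the
  decaying solution of the equation linearized along \<open>stable_solution s \<xi>\<close>.
\<close>

definition dstable :: "real \<Rightarrow> 'a \<Rightarrow> 'a \<Rightarrow> real \<Rightarrow> 'a" where
  "dstable s \<xi> h = (SOME w. linearized_from s (stable_solution s \<xi>) w \<and> P s (w s) = h \<and> decaying_from s w)"

lemma dstable:
  assumes s: "0 \<le> s" and \<xi>: "P s \<xi> = \<xi>" and h: "P s h = h"
  shows "linearized_from s (stable_solution s \<xi>) (dstable s \<xi> h)" "P s (dstable s \<xi> h s) = h"
    "decaying_from s (dstable s \<xi> h)"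
proof -
  define v where "v = stable_solution s \<xi>"
  have vc: "continuous_on {s..} v" unfolding v_def by (rule forced_solution_cont[OF stable_solution(1)[OF s \<xi>]])
  have S0: "{s..} \<subseteq> {0..}" using s by auto
  obtain w where "linearized_from s v w" "P s (w s) = h" "decaying_from s w"
  proof (rule decaying_solution_exists[OF s h, of "\<lambda>t. blinfun_apply (f' t (v t))"])
    show "continuous_on {s..} (\<lambda>t. f' t (v t) (u t))" if "continuous_on {s..} u" for u
      by (intro continuous_on_blinfun_apply that f'_along_cont[OF vc S0])
    show "norm (f' t (v t) u - f' t (v t) w) \<le> \<kappa> t * norm (u - w)" if "s \<le> t" for t u w
      using f'_apply_bound[of t "v t" "u - w"] s that by (simp add: blinfun.diff_right)
  qed auto
  then have "\<exists>w. linearized_from s v w \<and> P s (w s) = h \<and> decaying_from s w" by blast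
  from someI_ex[OF this] show "linearized_from s (stable_solution s \<xi>) (dstable s \<xi> h)"
     "P s (dstable s \<xi> h s) = h" "decaying_from s (dstable s \<xi> h)" unfolding dstable_def v_def by blast+
qed

lemma dstable_lincomb:
  assumes s: "0 \<le> s" and \<xi>: "P s \<xi> = \<xi>" and h: "P s h = h" "P s k = k" and t: "s \<le> t"
  shows "dstable s \<xi> (x *\<^sub>R h + y *\<^sub>R k) t = x *\<^sub>R dstable s \<xi> h t + y *\<^sub>R dstable s \<xi> k t"
proof -
  have hk: "P s (x *\<^sub>R h + y *\<^sub>R k) = x *\<^sub>R h + y *\<^sub>R k" using h by (simp add: blinfun.bilinear_simps)
  define v where "v = stable_solution s \<xi>"
  define d where "d t = dstable s \<xi> (x *\<^sub>R h + y *\<^sub>R k) t - (x *\<^sub>R dstable s \<xi> h t + y *\<^sub>R dstable s \<xi> k t)" for t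
  note Dh = dstable[OF s \<xi> h(1), folded v_def] and Dk = dstable[OF s \<xi> h(2), folded v_def]
    and Dhk = dstable[OF s \<xi> hk, folded v_def]
  have d: "linearized_from s v d" "decaying_from s d"
    using forced_solution_diff[OF Dhk(1) forced_solution_lincomb[OF Dh(1) Dk(1), of x y]]
    unfolding d_def by (simp add: blinfun.bilinear_simps, intro decaying_diff decaying_lincomb Dh Dk Dhk)
  have "P s (d s) = 0" by (simp add: d_def blinfun.bilinear_simps Dh Dk Dhk)
  then have "norm (P t (d t)) + norm (Q t (d t)) \<le> 0" using linearized_bounds(1)[OF s d t] by simp
  from order_trans[OF norm_le_PQ this] show ?thesis by (simp add: d_def)
qed

text \<open>
  \<open>dstable\<close> as an operator on the whole space, by composition with the projection onto \<open>E(s)\<close>.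
\<close>

definition W :: "real \<Rightarrow> 'a \<Rightarrow> real \<Rightarrow> 'a \<Rightarrow>\<^sub>L 'a" where
  "W s \<xi> t = Blinfun (\<lambda>h. dstable s \<xi> (P s h) t)"

lemma W_apply:
  assumes s: "0 \<le> s" and \<xi>: "P s \<xi> = \<xi>" and t: "s \<le> t"
  shows "W s \<xi> t h = dstable s \<xi> (P s h) t"
proof -
  have "bounded_linear (\<lambda>h. dstable s \<xi> (P s h) t)"
  proof (rule bounded_linear_intro)
    fix h k r
    show "dstable s \<xi> (P s (h + k)) t = dstable s \<xi> (P s h) t + dstable s \<xi> (P s k) t"
      using dstable_lincomb[OF s \<xi> _ _ t, of "P s h" "P s k" 1 1] s by (simp add: P_idem blinfun.bilinear_simps)
    show "dstable s \<xi> (P s (r *\<^sub>R h)) t = r *\<^sub>R dstable s \<xi> (P s h) t"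
      using dstable_lincomb[OF s \<xi> _ _ t, of "P s h" "P s h" r 0] s by (simp add: P_idem blinfun.bilinear_simps)
    note Dh = dstable[OF s \<xi> P_idem[OF s, of h]]
    have "norm (dstable s \<xi> (P s h) t) \<le> weight s t * (L s * norm (P s h))"
      using linearized_bounds(1)[OF s Dh(1,3) t] norm_le_PQ[of "dstable s \<xi> (P s h) t" t] by (simp add: Dh(2))
    also have "\<dots> \<le> weight s t * (L s * (norm (P s) * norm h))"
      using weight_pos[of s t] s t L_nonneg[of s] by (intro mult_left_mono norm_blinfun) auto
    finally show "norm (dstable s \<xi> (P s h) t) \<le> norm h * (weight s t * L s * norm (P s))"
      by (simp add: mult_ac)
  qed
  then show ?thesis unfolding W_def by (simp add: bounded_linear_Blinfun_apply)
qed

lemma stable_solution_dist: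
  assumes s: "0 \<le> s" and \<xi>: "P s \<xi> = \<xi>" and \<eta>: "P s \<eta> = \<eta>" and t: "s \<le> t"
  shows "norm (stable_solution s \<eta> t - stable_solution s \<xi> t) \<le> weight s t * (L s * norm (\<eta> - \<xi>))"
  using order_trans[OF norm_le_PQ
      decaying_solution_diff(1)[OF s stable_solution(1,3)[OF s \<eta>] stable_solution(1,3)[OF s \<xi>] t]]
  by (simp add: blinfun.diff_right stable_solution(2)[OF s] \<xi> \<eta>)

lemma stable_solution_remainder:
  assumes s: "0 \<le> s" and \<xi>: "P s \<xi> = \<xi>" and \<eta>: "P s \<eta> = \<eta>"
  defines "r \<equiv> \<lambda>t. stable_solution s \<eta> t - stable_solution s \<xi> t - dstable s \<xi> (\<eta> - \<xi>) t"
  shows "s \<le> t \<Longrightarrow> norm (P t (r t)) + norm (Q t (r t)) \<le> weight s t * (2 * (norm (\<eta> - \<xi>) * norm (\<eta> - \<xi>)))"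
    and "norm (Q s (r s)) \<le> norm (\<eta> - \<xi>) * norm (\<eta> - \<xi>)"
proof -
  define v where "v = stable_solution s \<xi>"
  define u where "u = stable_solution s \<eta>"
  define w where "w = dstable s \<xi> (\<eta> - \<xi>)"
  have h: "P s (\<eta> - \<xi>) = \<eta> - \<xi>" using \<xi> \<eta> by (simp add: blinfun.bilinear_simps)
  note V = stable_solution[OF s \<xi>, folded v_def] and U = stable_solution[OF s \<eta>, folded u_def]
    and Wd = dstable[OF s \<xi> h, folded v_def w_def]
  have r: "r t = u t - v t - w t" for t by (simp add: r_def u_def v_def w_def)
  define g where "g t = (f t (u t) - f t (v t)) - f' t (v t) (w t)" for t
  have dr: "forced_solution s g r" "decaying_from s r"
    unfolding g_def r[abs_def] by (intro forced_solution_diff decaying_diff U V Wd)+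
  have Pr: "P s (r s) = 0" by (simp add: r blinfun.bilinear_simps U V Wd)
  define x where "x t = norm (u t - v t)" for t
  have x: "x t \<le> weight s t * (L s * norm (\<eta> - \<xi>))" if "s \<le> t" for t
    unfolding x_def u_def v_def by (rule stable_solution_dist[OF s \<xi> \<eta> that])
  have g: "norm (g t) \<le> \<kappa> t * norm (r t) + \<kappa> t * (x t * x t)" if t: "s \<le> t" for t
  proof -
    have t0: "0 \<le> t" using s t by simp
    have "g t = (f t (u t) - f t (v t) - f' t (v t) (u t - v t)) + f' t (v t) (r t)"
      by (simp add: g_def r blinfun.bilinear_simps)
    then have "norm (g t) \<le> norm (f t (u t) - f t (v t) - f' t (v t) (u t - v t)) + norm (f' t (v t) (r t))"
      by (simp add: norm_triangle_ineq)
    then show ?thesis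
      using f_remainder[OF t0, of "u t" "v t"] f'_apply_bound[OF t0, of "v t" "r t"]
      by (simp add: x_def power2_eq_square)
  qed
  note est = quadratic_forcing_bounds[OF s dr g _ x _ x norm_ge_zero norm_ge_zero Pr]
  show "s \<le> t \<Longrightarrow> norm (P t (r t)) + norm (Q t (r t)) \<le> weight s t * (2 * (norm (\<eta> - \<xi>) * norm (\<eta> - \<xi>)))"
    by (rule est(1)) (auto simp: x_def)
  show "norm (Q s (r s)) \<le> norm (\<eta> - \<xi>) * norm (\<eta> - \<xi>)"
    by (rule est(2)) (auto simp: x_def)
qed

lemma dstable_lipschitz:
  assumes s: "0 \<le> s" and \<xi>: "P s \<xi> = \<xi>" and \<eta>: "P s \<eta> = \<eta>" and h: "P s h = h"
  defines "d \<equiv> \<lambda>t. dstable s \<eta> h t - dstable s \<xi> h t"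
  shows "s \<le> t \<Longrightarrow> norm (P t (d t)) + norm (Q t (d t)) \<le> weight s t * (2 * (norm (\<eta> - \<xi>) * norm h))"
    and "norm (Q s (d s)) \<le> norm (\<eta> - \<xi>) * norm h"
proof -
  define v where "v = stable_solution s \<xi>"
  define u where "u = stable_solution s \<eta>"
  define w where "w = dstable s \<xi> h"
  note Wd = dstable[OF s \<xi> h, folded v_def w_def] and X = dstable[OF s \<eta> h, folded u_def]
  define g where "g t = f' t (u t) (dstable s \<eta> h t) - f' t (v t) (w t)" for t
  have d: "d t = dstable s \<eta> h t - w t" for t by (simp add: d_def w_def)
  have dd: "forced_solution s g d" "decaying_from s d"
    unfolding g_def d[abs_def] by (intro forced_solution_diff decaying_diff X Wd)+
  have Pd: "P s (d s) = 0" by (simp add: d blinfun.bilinear_simps X Wd)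
  define x where "x t = norm (u t - v t)" for t
  define y where "y t = norm (w t)" for t
  have x: "x t \<le> weight s t * (L s * norm (\<eta> - \<xi>))" if "s \<le> t" for t
    unfolding x_def u_def v_def by (rule stable_solution_dist[OF s \<xi> \<eta> that])
  have y: "y t \<le> weight s t * (L s * norm h)" if "s \<le> t" for t
    using linearized_bounds(1)[OF s Wd(1,3) that] norm_le_PQ[of "w t" t] by (simp add: Wd(2) y_def)
  have g: "norm (g t) \<le> \<kappa> t * norm (d t) + \<kappa> t * (x t * y t)" if t: "s \<le> t" for t
  proof -
    have t0: "0 \<le> t" using s t by simp
    have "g t = (f' t (u t) - f' t (v t)) (w t) + f' t (u t) (d t)"
      by (simp add: g_def d blinfun.bilinear_simps)
    then have "norm (g t) \<le> norm ((f' t (u t) - f' t (v t)) (w t)) + norm (f' t (u t) (d t))"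
      by (simp add: norm_triangle_ineq)
    moreover have "norm ((f' t (u t) - f' t (v t)) (w t)) \<le> \<kappa> t * norm (u t - v t) * norm (w t)"
      by (rule order_trans[OF norm_blinfun mult_right_mono[OF f'_lipschitz[OF t0] norm_ge_zero]])
    ultimately show ?thesis
      using f'_apply_bound[OF t0, of "u t" "d t"] by (simp add: x_def y_def mult.assoc)
  qed
  note est = quadratic_forcing_bounds[OF s dd g _ x _ y norm_ge_zero norm_ge_zero Pd]
  show "s \<le> t \<Longrightarrow> norm (P t (d t)) + norm (Q t (d t)) \<le> weight s t * (2 * (norm (\<eta> - \<xi>) * norm h))"
    by (rule est(1)) (auto simp: x_def y_def)
  show "norm (Q s (d s)) \<le> norm (\<eta> - \<xi>) * norm h"
    by (rule est(2)) (auto simp: x_def y_def)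
qed

section \<open>Global solutions\<close>

text \<open>
  An antiderivative of the Lipschitz constant \<open>norm (A t) + \<kappa> t\<close> of the perturbed vector field.
\<close>

definition \<Gamma> :: "real \<Rightarrow> real" where "\<Gamma> t = \<Gamma>\<^sub>A t + - (\<delta> / (3 * \<epsilon>)) * \<mu> t powr (- 3 * \<epsilon>)"

lemma \<Gamma>: assumes "0 \<le> t" shows "(\<Gamma> has_vector_derivative norm (A t) + \<kappa> t) (at t within {0..})"
proof -
  have "(\<Gamma> has_vector_derivative norm (A t) + - (\<delta> / (3 * \<epsilon>)) * (- 3 * \<epsilon> * d\<mu> t * \<mu> t powr (- 3 * \<epsilon> - 1)))
      (at t within {0..})"
    unfolding \<Gamma>_def by (intro has_vector_derivative_add \<Gamma>\<^sub>A mu_powr_deriv assms) auto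
  then show ?thesis using eps_pos by (simp add: \<kappa>_def mult.assoc)
qed

lemma \<Gamma>_cont: "continuous_on {0..} \<Gamma>"
  by (rule continuous_on_vector_derivative) (use \<Gamma> in auto)

lemma rate_nonneg: "0 \<le> t \<Longrightarrow> 0 \<le> norm (A t) + \<kappa> t"
  using kappa_nonneg by simp

lemma field_lipschitz:
  assumes "0 \<le> t"
  shows "norm ((A t u + f t u) - (A t v + f t v)) \<le> (norm (A t) + \<kappa> t) * norm (u - v)"
proof -
  have eq: "(A t u + f t u) - (A t v + f t v) = A t (u - v) + (f t u - f t v)"
    by (simp add: blinfun.bilinear_simps)
  show ?thesis
    unfolding eq using norm_triangle_ineq[of "A t (u - v)" "f t u - f t v"] norm_blinfun[of "A t" "u - v"]
      f_lipschitz[OF assms, of u v] by (simp add: distrib_right)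
qed

definition global_solution :: "(real \<Rightarrow> 'a) \<Rightarrow> bool" where
  "global_solution v \<longleftrightarrow> solution_from 0 v"

lemma global_solution_exists:
  assumes "0 \<le> s"
  obtains v where "global_solution v" "v s = x"
proof -
  obtain v where "v s = x" "\<And>t. 0 \<le> t \<Longrightarrow> (v has_vector_derivative A t (v t) + f t (v t)) (at t within {0..})"
  proof (rule lipschitz_ivp[where F = "\<lambda>t v. A t v + f t v", OF \<Gamma> rate_nonneg _ _ field_lipschitz assms])
    show "continuous_on {0..} (\<lambda>t. A t (u t) + f t (u t))" if "continuous_on {0..} u" for u
      by (intro continuous_intros continuous_on_blinfun_apply A_cont
          f_along_cont that) auto
  qed (use f_zero in \<open>auto simp: blinfun.bilinear_simps\<close>)
  then show ?thesis using that by (auto simp: global_solution_def forced_solution_def)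
qed

lemma solution_growth:
  assumes v: "global_solution v" and st: "0 \<le> s" "0 \<le> t"
  shows "norm (v t - v s) \<le> norm (v s) * (exp (2 * \<bar>\<Gamma> t - \<Gamma> s\<bar>) - 1)"
proof (rule gronwall[OF _ \<Gamma> _ rate_nonneg st])
  fix x :: real assume x: "0 \<le> x"
  show "(v has_vector_derivative A x (v x) + f x (v x)) (at x within {0..})"
    using v x by (auto simp: global_solution_def forced_solution_def)
  show "norm (A x (v x) + f x (v x)) \<le> (norm (A x) + \<kappa> x) * norm (v x)"
    using field_lipschitz[OF x, of "v x" 0] f_zero[OF x] by (simp add: blinfun.bilinear_simps)
qed

lemma solution_unique:
  assumes s: "0 \<le> s" and v: "solution_from s v" and w: "solution_from s w" and eq: "v s = w s" and t: "s \<le> t"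
  shows "v t = w t"
proof -
  have "norm ((\<lambda>t. v t - w t) t - (\<lambda>t. v t - w t) s) \<le> norm ((\<lambda>t. v t - w t) s) * (exp (2 * (\<Gamma> t - \<Gamma> s)) - 1)"
  proof (rule gronwall_forward[where S = "{s..}" and l = "\<lambda>t. norm (A t) + \<kappa> t"
        and d' = "\<lambda>t. (A t (v t) + f t (v t)) - (A t (w t) + f t (w t))"])
    fix x assume "x \<in> {s..t}"
    then have x: "s \<le> x" "0 \<le> x" using s by auto
    show "((\<lambda>t. v t - w t) has_vector_derivative (A x (v x) + f x (v x)) - (A x (w x) + f x (w x))) (at x within {s..})"
      using v w x(1) unfolding forced_solution_def by (intro has_vector_derivative_diff) auto
    show "(\<Gamma> has_vector_derivative norm (A x) + \<kappa> x) (at x within {s..})"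
      by (rule has_vector_derivative_within_subset[OF \<Gamma>[OF x(2)]]) (use s in auto)
    show "norm ((A x (v x) + f x (v x)) - (A x (w x) + f x (w x))) \<le> (norm (A x) + \<kappa> x) * norm (v x - w x)"
      by (rule field_lipschitz[OF x(2)])
    show "0 \<le> norm (A x) + \<kappa> x" by (rule rate_nonneg[OF x(2)])
  qed (use t in auto)
  then show ?thesis by (simp add: eq)
qed

lemma sol_eq:
  assumes s: "0 \<le> s" and v: "solution_from s v" and t: "s \<le> t"
  shows "sol A f s (v s) t = v t"
  unfolding sol_def
proof (rule the_equality)
  show "\<exists>w. solves A f s (v s) w \<and> w t = v t"
    using v by (auto simp: solves_def forced_solution_def)
  show "x = v t" if "\<exists>w. solves A f s (v s) w \<and> w t = x" for x
    using that solution_unique[OF s v _ _ t] by (fastforce simp: solves_def forced_solution_def)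
qed

section \<open>The function whose graph is invariant\<close>

definition phi :: "real \<times> 'a \<Rightarrow> 'a" where
  "phi = (\<lambda>p\<in>Gset P. Q (fst p) (stable_solution (fst p) (snd p) (fst p)))"

lemma Gset_iff: "(s, \<xi>) \<in> Gset P \<longleftrightarrow> 0 \<le> s \<and> P s \<xi> = \<xi>"
  using Esp_iff[of s \<xi>] by (auto simp: Gset_def)

lemma phi_eq: "0 \<le> s \<Longrightarrow> P s \<xi> = \<xi> \<Longrightarrow> phi (s, \<xi>) = Q s (stable_solution s \<xi> s)"
  by (simp add: phi_def Gset_iff)

lemma stable_solution_start: "0 \<le> s \<Longrightarrow> P s \<xi> = \<xi> \<Longrightarrow> stable_solution s \<xi> s = \<xi> + phi (s, \<xi>)"
  using stable_solution(2)[of s \<xi>] by (simp add: phi_eq Q_apply)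

lemma Q_phi: "0 \<le> s \<Longrightarrow> P s \<xi> = \<xi> \<Longrightarrow> Q s (phi (s, \<xi>)) = phi (s, \<xi>)"
  by (simp add: phi_eq Q_idem)

lemma P_phi: "0 \<le> s \<Longrightarrow> P s \<xi> = \<xi> \<Longrightarrow> P s (phi (s, \<xi>)) = 0"
  by (simp add: phi_eq P_Q)

text \<open>
  The graph consists exactly of the initial values of decaying solutions. Membership is therefore
  inherited along solutions, in both time directions.
\<close>

lemma decaying_solution_on_graph:
  assumes s: "0 \<le> s" and v: "solution_from s v" "decaying_from s v"
  shows "Q s (v s) = phi (s, P s (v s))"
proof -
  have p: "P s (P s (v s)) = P s (v s)" by (rule P_idem[OF s])
  show ?thesis
    using decaying_solution_unique[OF s v stable_solution(1,3)[OF s p] order_refl] stable_solution(2)[OF s p]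
    by (simp add: phi_eq[OF s p])
qed

lemma phi_lipschitz:
  assumes s: "0 \<le> s" and "P s \<xi> = \<xi>" "P s \<eta> = \<eta>"
  shows "norm (phi (s, \<eta>) - phi (s, \<xi>)) \<le> norm (\<eta> - \<xi>)"
  using decaying_solution_diff(2)[OF s stable_solution(1,3)[OF s assms(3)] stable_solution(1,3)[OF s assms(2)]]
    stable_solution(2)[OF s] assms by (simp add: phi_eq blinfun.bilinear_simps)

lemma stable_solution_zero:
  assumes s: "0 \<le> s" and t: "s \<le> t" shows "stable_solution s 0 t = 0"
proof -
  have z: "solution_from s (\<lambda>_. 0)" "decaying_from s (\<lambda>_. 0)"
    using s f_zero by (auto simp: forced_solution_def decaying_from_def intro!: exI[of _ 0])
  have p: "P s 0 = 0" by simp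
  show ?thesis
    using decaying_solution_unique[OF s stable_solution(1,3)[OF s p] z t] stable_solution(2)[OF s p] by simp
qed

lemma phi_zero: "0 \<le> s \<Longrightarrow> phi (s, 0) = 0"
  by (simp add: phi_eq stable_solution_zero)

definition dPhi :: "real \<Rightarrow> 'a \<Rightarrow> 'a \<Rightarrow>\<^sub>L 'a" where "dPhi s \<xi> = Q s o\<^sub>L W s \<xi> s"

lemma dPhi_apply: "0 \<le> s \<Longrightarrow> P s \<xi> = \<xi> \<Longrightarrow> dPhi s \<xi> h = Q s (dstable s \<xi> (P s h) s)"
  by (simp add: dPhi_def W_apply)

lemma phi_remainder:
  assumes s: "0 \<le> s" and \<xi>: "P s \<xi> = \<xi>" and \<eta>: "P s \<eta> = \<eta>"
  shows "norm (phi (s, \<eta>) - phi (s, \<xi>) - dPhi s \<xi> (\<eta> - \<xi>)) \<le> 1 * (norm (\<eta> - \<xi>))\<^sup>2"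
proof -
  have "dPhi s \<xi> (\<eta> - \<xi>) = Q s (dstable s \<xi> (\<eta> - \<xi>) s)"
    using dPhi_apply[OF s \<xi>, of "\<eta> - \<xi>"] \<xi> \<eta> by (simp only: blinfun.diff_right)
  then show ?thesis
    using stable_solution_remainder(2)[OF s \<xi> \<eta>] s \<xi> \<eta>
    by (simp add: phi_eq blinfun.diff_right power2_eq_square)
qed

lemma dPhi_bound:
  assumes s: "0 \<le> s" and \<xi>: "P s \<xi> = \<xi>"
  shows "norm (dPhi s \<xi> h) \<le> norm (P s h)"
  using linearized_bounds(2)[OF s dstable(1,3)[OF s \<xi> P_idem[OF s]], of h] dstable(2)[OF s \<xi> P_idem[OF s], of h] s \<xi>
  by (simp add: dPhi_apply)

lemma dPhi_lipschitz:
  assumes s: "0 \<le> s" and \<xi>: "P s \<xi> = \<xi>" and \<eta>: "P s \<eta> = \<eta>"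
  shows "norm (dPhi s \<eta> h - dPhi s \<xi> h) \<le> norm (\<eta> - \<xi>) * norm (P s h)"
  using dstable_lipschitz(2)[OF s \<xi> \<eta> P_idem[OF s], of h] assms
  by (simp add: dPhi_apply blinfun.bilinear_simps)

text \<open>
  The equation linearized along the zero solution is the unperturbed one, whose decaying solutions
  stay in the stable subspaces.
\<close>

lemma dPhi_zero:
  assumes s: "0 \<le> s" shows "dPhi s 0 h = 0"
proof -
  have z: "P s 0 = 0" by simp
  note Dd = dstable[OF s z P_idem[OF s, of h]]
  define w where "w = dstable s 0 (P s h)"
  have "forced_solution s (\<lambda>_. 0) w"
    using Dd(1) s unfolding w_def
    by (subst (asm) forced_solution_cong[where h = "\<lambda>_. 0"]) (auto simp: stable_solution_zero f'_zero)
  from forced_solution_bounds(2)[OF s this Dd(3)[folded w_def] _ order_refl order_refl]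
  have "norm (Q s (w s)) \<le> 0" by simp
  then show ?thesis using s by (simp add: dPhi_apply w_def)
qed

lemma subspace_Esp: "subspace (Esp P s)"
  unfolding Esp_def by (intro linear_subspace_image bounded_linear.linear[OF blinfun.bounded_linear_right] subspace_UNIV)

lemma phi_derivative:
  assumes s: "0 \<le> s" and \<xi>: "P s \<xi> = \<xi>"
  shows "((\<lambda>x. phi (s, x)) has_derivative blinfun_apply (dPhi s \<xi>)) (at \<xi> within Esp P s)"
  by (rule quadratic_remainder_has_derivative[OF blinfun.bounded_linear_right, where C = 1])
     (use phi_remainder[OF s \<xi>] Esp_iff[OF s] in blast)

lemma dphi_eq:
  assumes s: "0 \<le> s" and \<xi>: "\<xi> \<in> Esp P s" and h: "h \<in> Esp P s"
  shows "dphi P phi s \<xi> h = dPhi s \<xi> h"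
proof -
  have d: "((\<lambda>x. phi (s, x)) has_derivative blinfun_apply (dPhi s \<xi>)) (at \<xi> within Esp P s)"
    using phi_derivative s \<xi> Esp_iff by simp
  then have "((\<lambda>x. phi (s, x)) has_derivative dphi P phi s \<xi>) (at \<xi> within Esp P s)"
    unfolding dphi_def using differentiableI frechet_derivative_works by blast
  from has_derivative_unique_on_subspace[OF subspace_Esp \<xi> h this d] show ?thesis .
qed

lemma phi_in_Xspace:
  assumes "C1_on (Gset P) phi"
  shows "phi \<in> Xspace P"
  unfolding Xspace_def
proof (intro CollectI conjI allI impI ballI)
  show "phi \<in> (\<Pi>\<^sub>E p\<in>Gset P. Fsp P (fst p))"
  proof
    show "phi p \<in> Fsp P (fst p)" if "p \<in> Gset P" for p
      using that Q_phi Fsp_iff by (cases p) (auto simp: Gset_iff)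
  qed (simp add: phi_def)
  fix s :: real assume s: "0 \<le> s"
  show "phi (s, 0) = 0" by (rule phi_zero[OF s])
  have z: "0 \<in> Esp P s" by (simp add: Esp_iff s)
  then show "dphi P phi s 0 h = 0" if "h \<in> Esp P s" for h
    using that s by (simp add: dphi_eq dPhi_zero)
  fix \<xi> assume \<xi>: "\<xi> \<in> Esp P s"
  show "onorm_on norm (Esp P s) (dphi P phi s \<xi>) \<le> 1"
  proof (rule onorm_on_le)
    show "norm (dphi P phi s \<xi> h) \<le> 1 * norm h" if "h \<in> Esp P s" for h
      using dPhi_bound[OF s, of \<xi> h] \<xi> that s by (simp add: dphi_eq Esp_iff)
  qed (use \<xi> in auto)
  fix \<xi>' assume \<xi>': "\<xi>' \<in> Esp P s"
  show "onorm_on norm (Esp P s) (\<lambda>h. dphi P phi s \<xi> h - dphi P phi s \<xi>' h) \<le> norm (\<xi> - \<xi>')"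
  proof (rule onorm_on_le)
    show "norm (dphi P phi s \<xi> h - dphi P phi s \<xi>' h) \<le> norm (\<xi> - \<xi>') * norm h" if "h \<in> Esp P s" for h
      using dPhi_lipschitz[OF s, of \<xi>' \<xi> h] \<xi> \<xi>' that s by (simp add: dphi_eq Esp_iff)
  qed (use \<xi> in auto)
qed (use assms in auto)

section \<open>Invariance and uniqueness of the graph\<close>

lemma decaying_from_mono:
  assumes "0 \<le> s" "s \<le> t" "decaying_from s v" shows "decaying_from t v"
proof -
  obtain M where M: "\<And>\<tau>. s \<le> \<tau> \<Longrightarrow> norm (v \<tau>) \<le> M * weight s \<tau>"
    using assms unfolding decaying_from_def by blast
  have "norm (v \<tau>) \<le> (M * weight s t) * weight t \<tau>" if "t \<le> \<tau>" for \<tau>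
    using M[of \<tau>] weight_mult[of s t \<tau>] that assms by (simp add: mult.assoc)
  then show ?thesis unfolding decaying_from_def by blast
qed

lemma decaying_from_extend:
  assumes s: "0 \<le> s" "s \<le> t" and c: "continuous_on {s..} v" and d: "decaying_from t v"
  shows "decaying_from s v"
proof -
  obtain M where M: "\<And>\<tau>. t \<le> \<tau> \<Longrightarrow> norm (v \<tau>) \<le> M * weight t \<tau>"
    using d unfolding decaying_from_def by blast
  have "compact (v ` {s..t})"
    by (intro compact_continuous_image continuous_on_subset[OF c]) auto
  from compact_imp_bounded[OF this] obtain B where "\<forall>x\<in>v ` {s..t}. norm x \<le> B"
    unfolding bounded_iff by blast
  then have B: "norm (v \<tau>) \<le> B" if "\<tau> \<in> {s..t}" for \<tau>
    using that by simp
  have w: "0 < weight s t" using weight_pos s by simp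
  have B0: "0 \<le> B" using order_trans[OF norm_ge_zero B[of s]] s by simp
  have M0: "0 \<le> M" using order_trans[OF norm_ge_zero M[of t]] weight_self[of t] s by simp
  have "norm (v \<tau>) \<le> ((B + M) / weight s t) * weight s \<tau>" if \<tau>: "s \<le> \<tau>" for \<tau>
  proof (cases "\<tau> \<le> t")
    case True
    have "norm (v \<tau>) * weight s t \<le> (B + M) * weight s \<tau>"
      using B[of \<tau>] \<tau> True M0 B0 weight_antimono[of s \<tau> t] s w by (intro mult_mono) auto
    then show ?thesis using w by (simp add: field_simps)
  next
    case False
    have "norm (v \<tau>) \<le> M * weight t \<tau>" using M False by simp
    also have "\<dots> \<le> (B + M) * weight t \<tau>"
      using B0 weight_pos[of t \<tau>] s False by (intro mult_right_mono) auto
    also have "weight t \<tau> = weight s \<tau> / weight s t"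
      using weight_mult[of s t \<tau>] s False w by (simp add: field_simps)
    finally show ?thesis by simp
  qed
  then show ?thesis unfolding decaying_from_def by blast
qed

lemma decaying_from_cong:
  "(\<And>t. s \<le> t \<Longrightarrow> v t = w t) \<Longrightarrow> decaying_from s w \<Longrightarrow> decaying_from s v"
  by (simp add: decaying_from_def)

lemma graph_solution:
  assumes s: "0 \<le> s" and \<xi>: "P s \<xi> = \<xi>" and v: "solution_from s v" "v s = \<xi> + phi (s, \<xi>)" and t: "s \<le> t"
  shows "v t = stable_solution s \<xi> t"
  by (rule solution_unique[OF s v(1) stable_solution(1)[OF s \<xi>] _ t])
     (simp add: v(2) stable_solution_start s \<xi>)

text \<open>
  Backward in time as well: on a compact interval every solution is bounded, so decay from a later
  time is decay from an earlier one. The backward direction gives two-sided curves in the graph,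
  along which \<open>psi\<close> is differentiated below.
\<close>

lemma global_solution_stays_on_graph:
  assumes v: "global_solution v" and s: "0 \<le> s" and on: "Q s (v s) = phi (s, P s (v s))" and t: "0 \<le> t"
  shows "Q t (v t) = phi (t, P t (v t))"
proof -
  have vs: "solution_from r v" if "0 \<le> r" for r
    using forced_solution_mono[of 0 _ v r] v that by (simp add: global_solution_def)
  have p: "P s (P s (v s)) = P s (v s)" by (rule P_idem[OF s])
  have "v s = P s (v s) + phi (s, P s (v s))" using on by (simp add: Q_apply algebra_simps)
  then have "v r = stable_solution s (P s (v s)) r" if "s \<le> r" for r
    using graph_solution[OF s p vs[OF s] _ that] by simp
  then have dec: "decaying_from s v"
    by (rule decaying_from_cong[OF _ stable_solution(3)[OF s p]])
  have "decaying_from t v"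
  proof (cases "s \<le> t")
    case True
    then show ?thesis using decaying_from_mono[OF s _ dec] by simp
  next
    case False
    then show ?thesis
      by (intro decaying_from_extend[OF t _ forced_solution_cont[OF vs[OF t]] dec]) simp
  qed
  then show ?thesis by (rule decaying_solution_on_graph[OF t vs[OF t]])
qed

lemma semiflow_lift:
  assumes s: "0 \<le> s" and v: "solution_from s v" "v s = \<xi> + \<phi> (s, \<xi>)" and \<tau>: "0 \<le> \<tau>"
  shows "semiflow A f P \<tau> (lift \<phi> s \<xi>) = (s + \<tau>, P (s + \<tau>) (v (s + \<tau>)), Q (s + \<tau>) (v (s + \<tau>)))"
  using sol_eq[OF s v(1), of "s + \<tau>"] \<tau> by (simp add: semiflow_def lift_def v(2) Let_def)

lemma flow_on_graph_phi:
  assumes s: "0 \<le> s" and \<xi>: "P s \<xi> = \<xi>" and t: "s \<le> t"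
  shows "flow_on_graph A f P phi t s \<xi> = (t, P t (stable_solution s \<xi> t), Q t (stable_solution s \<xi> t))"
  using semiflow_lift[where \<phi> = phi, OF s stable_solution(1)[OF s \<xi>] stable_solution_start[OF s \<xi>], of "t - s"] t
  by (simp add: flow_on_graph_def)

lemma mem_graph_of: "(s, x, y) \<in> graph_of P \<phi> \<longleftrightarrow> 0 \<le> s \<and> P s x = x \<and> y = \<phi> (s, x)"
proof
  assume "0 \<le> s \<and> P s x = x \<and> y = \<phi> (s, x)"
  then show "(s, x, y) \<in> graph_of P \<phi>"
    unfolding graph_of_def by (intro image_eqI[where x = "(s, x)"]) (auto simp: lift_def Gset_iff)
qed (auto simp: graph_of_def lift_def Gset_iff)

text \<open>
  Invariance under the semiflow in terms of solutions, free of the description operator in \<open>sol\<close>.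
\<close>

lemma invariant_graph_iff:
  "invariant_graph A f P \<phi> \<longleftrightarrow>
    (\<forall>s \<xi> v t. 0 \<le> s \<longrightarrow> P s \<xi> = \<xi> \<longrightarrow> solution_from s v \<longrightarrow> v s = \<xi> + \<phi> (s, \<xi>) \<longrightarrow> s \<le> t \<longrightarrow>
        Q t (v t) = \<phi> (t, P t (v t)))" (is "_ \<longleftrightarrow> ?R")
proof
  assume inv: "invariant_graph A f P \<phi>"
  show ?R
  proof (intro allI impI)
    fix s \<xi> v t assume *: "0 \<le> s" "P s \<xi> = \<xi>" "solution_from s v" "v s = \<xi> + \<phi> (s, \<xi>)" "s \<le> t"
    have "lift \<phi> s \<xi> \<in> graph_of P \<phi>" using * by (simp add: lift_def mem_graph_of)
    then have "semiflow A f P (t - s) (lift \<phi> s \<xi>) \<in> graph_of P \<phi>"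
      using inv * unfolding invariant_graph_def by (meson diff_ge_0_iff_ge image_subset_iff)
    then show "Q t (v t) = \<phi> (t, P t (v t))"
      using semiflow_lift[where \<phi> = \<phi>, OF *(1,3,4), of "t - s"] * by (simp add: mem_graph_of)
  qed
next
  assume R: ?R
  show "invariant_graph A f P \<phi>"
    unfolding invariant_graph_def
  proof (intro allI impI subsetI)
    fix \<tau> :: real and p assume \<tau>: "0 \<le> \<tau>" and "p \<in> semiflow A f P \<tau> ` graph_of P \<phi>"
    then obtain s \<xi> where s: "0 \<le> s" and \<xi>: "P s \<xi> = \<xi>" and p: "p = semiflow A f P \<tau> (lift \<phi> s \<xi>)"
      by (auto simp: graph_of_def Gset_iff)
    obtain v where v: "global_solution v" "v s = \<xi> + \<phi> (s, \<xi>)" using global_solution_exists[OF s] by blast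
    then have vs: "solution_from s v" using forced_solution_mono[of 0 _ v s] s by (simp add: global_solution_def)
    have "Q (s + \<tau>) (v (s + \<tau>)) = \<phi> (s + \<tau>, P (s + \<tau>) (v (s + \<tau>)))"
      using R s \<xi> vs v(2) \<tau> by simp
    then show "p \<in> graph_of P \<phi>"
      unfolding p semiflow_lift[where \<phi> = \<phi>, OF s vs v(2) \<tau>] using s \<tau> by (simp add: mem_graph_of P_idem)
  qed
qed

lemma phi_invariant: "invariant_graph A f P phi"
  unfolding invariant_graph_iff
proof (intro allI impI)
  fix s \<xi> v t assume *: "0 \<le> s" "P s \<xi> = \<xi>" "solution_from s v" "v s = \<xi> + phi (s, \<xi>)" "s \<le> t"
  have e: "v r = stable_solution s \<xi> r" if "s \<le> r" for r using graph_solution[OF *(1-4) that] .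
  have "decaying_from s v" by (rule decaying_from_cong[OF e stable_solution(3)[OF *(1,2)]])
  then have "decaying_from t v" using decaying_from_mono * by blast
  then show "Q t (v t) = phi (t, P t (v t))"
    using decaying_solution_on_graph[of t v] forced_solution_mono[OF *(3,5)] * by simp
qed

lemma Xspace_norm_le:
  assumes \<phi>: "\<phi> \<in> Xspace P" and s: "0 \<le> s" and \<xi>: "P s \<xi> = \<xi>"
  shows "norm (\<phi> (s, \<xi>)) \<le> norm \<xi>"
proof -
  have C1: "C1_on (Gset P) \<phi>" and z: "\<phi> (s, 0) = 0"
    and le: "\<And>\<eta>. \<eta> \<in> Esp P s \<Longrightarrow> onorm_on norm (Esp P s) (dphi P \<phi> s \<eta>) \<le> 1"
    using \<phi> s by (auto simp: Xspace_def)
  obtain G where G: "\<And>x. x \<in> Gset P \<Longrightarrow> (\<phi> has_derivative blinfun_apply (G x)) (at x within Gset P)"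
    using C1_onE[OF C1] by blast
  have D: "((\<lambda>x. \<phi> (s, x)) has_derivative dphi P \<phi> s \<eta>) (at \<eta> within Esp P s)" if "\<eta> \<in> Esp P s" for \<eta>
  proof -
    have "((\<lambda>x. (s, x)) has_derivative (\<lambda>h. (0, h))) (at \<eta> within Esp P s)"
      by (auto intro!: derivative_eq_intros)
    then have "((\<lambda>x. \<phi> (s, x)) has_derivative (\<lambda>h. G (s, \<eta>) (0, h))) (at \<eta> within Esp P s)"
      by (rule has_derivative_in_compose2[OF G, rotated 3]) (use that s in \<open>auto simp: Gset_def\<close>)
    then show ?thesis unfolding dphi_def using differentiableI frechet_derivative_works by blast
  qed
  have xiE: "\<xi> \<in> Esp P s" using \<xi> s by (simp add: Esp_iff)
  have rE: "r *\<^sub>R \<xi> \<in> Esp P s" for r using subspace_scale[OF subspace_Esp xiE] .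
  have "norm (\<phi> (s, 1 *\<^sub>R \<xi>) - \<phi> (s, 0 *\<^sub>R \<xi>)) \<le> 1 * norm \<xi> - 0 * norm \<xi>"
  proof (rule norm_increment_le[where S = "{0..1}" and f' = "\<lambda>r. dphi P \<phi> s (r *\<^sub>R \<xi>) \<xi>" and g' = "\<lambda>_. norm \<xi>"])
    fix r :: real assume r: "r \<in> {0..1}"
    have "((\<lambda>r. r *\<^sub>R \<xi>) has_derivative (\<lambda>h. h *\<^sub>R \<xi>)) (at r within {0..1})"
      by (auto intro!: derivative_eq_intros)
    then have "((\<lambda>r. \<phi> (s, r *\<^sub>R \<xi>)) has_derivative (\<lambda>h. dphi P \<phi> s (r *\<^sub>R \<xi>) (h *\<^sub>R \<xi>))) (at r within {0..1})"
      by (rule has_derivative_in_compose2[OF D, rotated 3]) (use rE r in auto)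
    then show "((\<lambda>r. \<phi> (s, r *\<^sub>R \<xi>)) has_vector_derivative dphi P \<phi> s (r *\<^sub>R \<xi>) \<xi>) (at r within {0..1})"
      using linear_scale[OF has_derivative_linear[OF D[OF rE]]] by (simp add: has_vector_derivative_def)
    show "((\<lambda>r. r * norm \<xi>) has_vector_derivative norm \<xi>) (at r within {0..1})"
      by (auto intro!: derivative_eq_intros)
    show "norm (dphi P \<phi> s (r *\<^sub>R \<xi>) \<xi>) \<le> norm \<xi>"
      using norm_le_onorm_on[OF has_derivative_bounded_linear[OF D[OF rE]] xiE le[OF rE]] by simp
  qed auto
  then show ?thesis by (simp add: z)
qed

text \<open>
  Where the unstable component is dominated by the stable one, the forcing in the stable equation is at
  most \<open>2 * \<kappa> t * norm (P t (v t))\<close>. So the stable component obeys a closed inequality on every compact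
  interval, with a constant independent of the interval.
\<close>

lemma solution_on_graph_decays:
  assumes s: "0 \<le> s" and v: "solution_from s v"
    and QP: "\<And>t. s \<le> t \<Longrightarrow> norm (Q t (v t)) \<le> norm (P t (v t))"
  shows "decaying_from s v"
proof -
  define c where "c = D * \<mu> s powr \<epsilon> * norm (P s (v s))"
  have S0: "{s..} \<subseteq> {0..}" using s by auto
  have vc: "continuous_on {s..} v" by (rule forced_solution_cont[OF v])
  have v2: "norm (v t) \<le> 2 * norm (P t (v t))" if "s \<le> t" for t
    using QP[OF that] norm_le_PQ[of "v t" t] by linarith
  define z where "z \<tau> = T 0 \<tau> (v \<tau>)" for \<tau>
  have z: "(z has_vector_derivative T 0 \<tau> (f \<tau> (v \<tau>))) (at \<tau> within {s..})" if "s \<le> \<tau>" for \<tau>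
    unfolding z_def by (rule forced_solution_pull[OF s v that])
  have Pz: "T r 0 (P 0 (z \<tau>)) = T r \<tau> (P \<tau> (v \<tau>))" if "0 \<le> \<tau>" "0 \<le> r" for r \<tau>
    using that by (simp_all add: z_def P_T T_comp)
  have "norm (v t) \<le> (4 * c) * weight s t" if t: "s \<le> t" for t
  proof -
    have zc: "continuous_on {s..t} z"
      using z by (intro continuous_on_vector_derivative[of _ _ "\<lambda>\<tau>. T 0 \<tau> (f \<tau> (v \<tau>))"])
        (auto intro: has_vector_derivative_within_subset[of z _ _ "{s..}"])
    have "continuous_on {s..t} (\<lambda>\<tau>. T \<tau> 0 (P 0 (z \<tau>)))"
      by (intro continuous_on_blinfun_apply continuous_intros zc
          continuous_on_subset[OF continuous_T_0]) (use s in auto)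
    moreover have "T \<tau> 0 (P 0 (z \<tau>)) = P \<tau> (v \<tau>)" if "\<tau> \<in> {s..t}" for \<tau>
      using Pz[of \<tau> \<tau>] s that by (simp add: T_self)
    ultimately have Pc: "continuous_on {s..t} (\<lambda>\<tau>. P \<tau> (v \<tau>))" by (rule continuous_on_eq)
    have "continuous_on {s..t} (\<lambda>\<tau>. norm (P \<tau> (v \<tau>)) / weight s \<tau>)"
      using weight_pos[OF s] s
      by (intro continuous_on_divide continuous_on_norm Pc continuous_on_subset[OF weight_cont[OF s]])
         (auto simp: less_imp_neq[symmetric])
    then obtain r where r: "r \<in> {s..t}"
      "\<And>\<tau>. \<tau> \<in> {s..t} \<Longrightarrow> norm (P \<tau> (v \<tau>)) / weight s \<tau> \<le> norm (P r (v r)) / weight s r"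
      using continuous_attains_sup[of "{s..t}" "\<lambda>\<tau>. norm (P \<tau> (v \<tau>)) / weight s \<tau>"] t by auto
    define m where "m = norm (P r (v r)) / weight s r"
    have rs: "s \<le> r" "0 \<le> r" "r \<le> t" using r s by auto
    have wr: "0 < weight s r" using weight_pos s rs by simp
    have m0: "0 \<le> m" using wr by (simp add: m_def)
    have Pm: "norm (P \<tau> (v \<tau>)) \<le> m * weight s \<tau>" if "\<tau> \<in> {s..t}" for \<tau>
      using r(2)[OF that] weight_pos[of s \<tau>] s that by (simp add: m_def[symmetric] divide_le_eq)
    have "norm (T r 0 (P 0 (z r - z s))) \<le> \<theta> * (2 * m * weight s r) * (\<rho> s - \<rho> r)"
    proof (rule green_stable[where S = "{s..}" and g = "\<lambda>\<tau>. f \<tau> (v \<tau>)"])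
      fix \<tau> assume \<tau>: "\<tau> \<in> {s..r}"
      then have \<tau>0: "0 \<le> \<tau>" "s \<le> \<tau>" "\<tau> \<in> {s..t}" using s rs by auto
      show "(z has_vector_derivative T 0 \<tau> (f \<tau> (v \<tau>))) (at \<tau> within {s..})" using z \<tau>0 by simp
      have "norm (f \<tau> (v \<tau>)) \<le> \<kappa> \<tau> * norm (v \<tau>)"
        using f_lipschitz[OF \<tau>0(1), of "v \<tau>" 0] f_zero[OF \<tau>0(1)] by simp
      also have "\<dots> \<le> \<kappa> \<tau> * (2 * (m * weight s \<tau>))"
        using v2[OF \<tau>0(2)] Pm[OF \<tau>0(3)] kappa_nonneg[OF \<tau>0(1)] by (intro mult_left_mono) auto
      finally show "norm (f \<tau> (v \<tau>)) \<le> 2 * m * (\<kappa> \<tau> * weight s \<tau>)" by (simp add: mult_ac)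
    qed (use s rs in auto)
    also have "\<dots> \<le> (1/8) * (2 * m * weight s r) * 1"
      using theta_pos theta_le m0 wr rho_antimono[OF s rs(1)] rho_nonneg[of r] rho_le_1[OF s]
      by (intro mult_mono mult_right_mono) auto
    finally have 1: "norm (T r 0 (P 0 (z r - z s))) \<le> m * weight s r / 4" by simp
    have "P r (v r) = T r s (P s (v s)) + T r 0 (P 0 (z r - z s))"
      using Pz[of r r] Pz[of s r] rs s by (simp add: blinfun.bilinear_simps T_self)
    then have "m * weight s r \<le> norm (T r s (P s (v s))) + norm (T r 0 (P 0 (z r - z s)))"
      using wr by (simp add: m_def norm_triangle_ineq)
    also have "\<dots> \<le> c * weight s r + m * weight s r / 4"
      using T_P_bound[OF s rs(1), of "P s (v s)"] 1 P_idem[OF s]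
      by (simp add: c_def weight_def mult_ac)
    also have "\<dots> = (c + m / 4) * weight s r" by (simp add: algebra_simps)
    finally have "m \<le> c + m / 4" using wr by simp
    then have "m \<le> 2 * c" using m0 by linarith
    have wt: "0 < weight s t" using weight_pos[of s t] s t by simp
    have "norm (v t) \<le> 2 * (m * weight s t)" using v2[OF t] Pm[of t] t by simp
    also have "\<dots> \<le> 2 * (2 * c * weight s t)"
      using \<open>m \<le> 2 * c\<close> wt by (intro mult_left_mono mult_right_mono) auto
    finally show ?thesis by simp
  qed
  then show ?thesis unfolding decaying_from_def by blast
qed

lemma invariant_Xspace_eq_phi:
  assumes \<phi>: "\<phi> \<in> Xspace P" and inv: "invariant_graph A f P \<phi>"
  shows "\<phi> = phi"
proof (rule PiE_ext)
  show "\<phi> \<in> (\<Pi>\<^sub>E p\<in>Gset P. UNIV)" using \<phi> by (auto simp: Xspace_def PiE_def)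
  show "phi \<in> (\<Pi>\<^sub>E p\<in>Gset P. UNIV)" by (auto simp: phi_def)
  fix p assume "p \<in> Gset P"
  then obtain s \<xi> where p: "p = (s, \<xi>)" and s: "0 \<le> s" and \<xi>: "P s \<xi> = \<xi>"
    by (cases p) (auto simp: Gset_iff)
  have "\<phi> (s, \<xi>) \<in> Fsp P s" using \<phi> s \<xi> by (auto simp: Xspace_def PiE_def Pi_def Gset_iff)
  then have Q\<phi>: "Q s (\<phi> (s, \<xi>)) = \<phi> (s, \<xi>)" using Fsp_iff[OF s] by simp
  obtain v where v: "global_solution v" "v s = \<xi> + \<phi> (s, \<xi>)" using global_solution_exists[OF s] by blast
  then have vs: "solution_from s v" using forced_solution_mono[of 0 _ v s] s by (simp add: global_solution_def)
  have Pv: "P s (v s) = \<xi>" using v(2) \<xi> P_Q[OF s, of "\<phi> (s, \<xi>)"] Q\<phi> by (simp add: blinfun.bilinear_simps)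
  have "decaying_from s v"
  proof (rule solution_on_graph_decays[OF s vs])
    fix t assume t: "s \<le> t"
    have "Q t (v t) = \<phi> (t, P t (v t))" using inv s \<xi> vs v(2) t unfolding invariant_graph_iff by blast
    then show "norm (Q t (v t)) \<le> norm (P t (v t))"
      using Xspace_norm_le[OF \<phi>, of t "P t (v t)"] s t by (simp add: P_idem)
  qed
  then have "Q s (v s) = phi (s, P s (v s))" by (rule decaying_solution_on_graph[OF s vs])
  then show "\<phi> p = phi p" using Pv v(2) by (simp add: p Q_apply)
qed

section \<open>Decay of the flow on the graph\<close>

lemma flow_on_graph_derivative:
  assumes s: "0 \<le> s" and \<xi>: "P s \<xi> = \<xi>" and t: "s \<le> t"
  shows "(flow_on_graph A f P phi t s has_derivative
      (\<lambda>h. (0, P t (W s \<xi> t h), Q t (W s \<xi> t h)))) (at \<xi> within Esp P s)"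
proof -
  have rem: "norm (stable_solution s \<eta> t - stable_solution s \<xi> t - W s \<xi> t (\<eta> - \<xi>)) \<le> (2 * weight s t) * (norm (\<eta> - \<xi>))\<^sup>2"
    if "\<eta> \<in> Esp P s" for \<eta>
  proof -
    have \<eta>: "P s \<eta> = \<eta>" using that Esp_iff[OF s] by simp
    have "W s \<xi> t (\<eta> - \<xi>) = dstable s \<xi> (\<eta> - \<xi>) t"
      using \<xi> \<eta> W_apply[OF s \<xi> t, of "\<eta> - \<xi>"] by (simp only: blinfun.diff_right)
    then show ?thesis
      using order_trans[OF norm_le_PQ stable_solution_remainder(1)[OF s \<xi> \<eta> t]]
      by (simp add: mult_ac power2_eq_square)
  qed
  have d: "((\<lambda>\<eta>. stable_solution s \<eta> t) has_derivative blinfun_apply (W s \<xi> t)) (at \<xi> within Esp P s)"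
    by (rule quadratic_remainder_has_derivative[OF blinfun.bounded_linear_right]) (rule rem)
  have "((\<lambda>\<eta>. (t, P t (stable_solution s \<eta> t), Q t (stable_solution s \<eta> t))) has_derivative
     (\<lambda>h. (0, P t (W s \<xi> t h), Q t (W s \<xi> t h)))) (at \<xi> within Esp P s)"
    by (intro has_derivative_Pair has_derivative_const bounded_linear.has_derivative[OF blinfun.bounded_linear_right] d)
  then show ?thesis
    by (rule has_derivative_transform[rotated 2]) (use s t \<xi> in \<open>auto simp: Esp_iff flow_on_graph_phi\<close>)
qed

lemma flow_on_graph_bounds:
  assumes s: "0 \<le> s" and \<xi>: "\<xi> \<in> Esp P s" and \<xi>': "\<xi>' \<in> Esp P s" and t: "s \<le> t"
  shows "sum_norm (flow_on_graph A f P phi t s \<xi> - flow_on_graph A f P phi t s \<xi>')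
      \<le> 2 * D * (\<mu> t / \<mu> s) powr a * \<mu> s powr \<epsilon> * norm (\<xi> - \<xi>')"
    and "flow_on_graph A f P phi t s differentiable (at \<xi> within Esp P s)"
    and "onorm_on sum_norm (Esp P s) (\<lambda>h. dflow_on_graph A f P phi t s \<xi> h - dflow_on_graph A f P phi t s \<xi>' h)
      \<le> 2 * D * (\<mu> t / \<mu> s) powr a * \<mu> s powr (2 * \<epsilon>) * norm (\<xi> - \<xi>')"
proof -
  have x: "P s \<xi> = \<xi>" "P s \<xi>' = \<xi>'" using \<xi> \<xi>' Esp_iff[OF s] by auto
  show "sum_norm (flow_on_graph A f P phi t s \<xi> - flow_on_graph A f P phi t s \<xi>')
      \<le> 2 * D * (\<mu> t / \<mu> s) powr a * \<mu> s powr \<epsilon> * norm (\<xi> - \<xi>')"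
    using decaying_solution_diff(1)[OF s stable_solution(1,3)[OF s x(1)] stable_solution(1,3)[OF s x(2)] t]
      stable_solution(2)[OF s x(1)] stable_solution(2)[OF s x(2)]
    by (simp add: flow_on_graph_phi s x t sum_norm_def blinfun.bilinear_simps L_def weight_def mult_ac)
  note fd = flow_on_graph_derivative[OF s _ t]
  show diff: "flow_on_graph A f P phi t s differentiable (at \<xi> within Esp P s)"
    using differentiableI[OF fd[OF x(1)]] .
  have df: "dflow_on_graph A f P phi t s \<eta> h = (0, P t (dstable s \<eta> h t), Q t (dstable s \<eta> h t))"
    if "\<eta> \<in> Esp P s" "h \<in> Esp P s" for \<eta> h
  proof -
    have \<eta>: "P s \<eta> = \<eta>" "P s h = h" using that Esp_iff[OF s] by auto
    have "(flow_on_graph A f P phi t s has_derivative dflow_on_graph A f P phi t s \<eta>) (at \<eta> within Esp P s)"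
      unfolding dflow_on_graph_def using differentiableI[OF fd[OF \<eta>(1)]] frechet_derivative_works by blast
    from has_derivative_unique_on_subspace[OF subspace_Esp that this fd[OF \<eta>(1)]]
    show ?thesis by (simp add: W_apply[OF s \<eta>(1) t] \<eta>)
  qed
  have w: "0 < weight s t" using weight_pos s t by simp
  have m: "1 \<le> D * \<mu> s powr (2 * \<epsilon>)"
    using mult_mono[of 1 D 1 "\<mu> s powr (2 * \<epsilon>)"] D_ge_1 ge_one_powr_ge_zero[of "\<mu> s" "2 * \<epsilon>"] mu_ge_1[OF s] eps_pos
    by simp
  show "onorm_on sum_norm (Esp P s) (\<lambda>h. dflow_on_graph A f P phi t s \<xi> h - dflow_on_graph A f P phi t s \<xi>' h)
      \<le> 2 * D * (\<mu> t / \<mu> s) powr a * \<mu> s powr (2 * \<epsilon>) * norm (\<xi> - \<xi>')"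
  proof (rule onorm_on_le)
    fix h assume h: "h \<in> Esp P s"
    then have h': "P s h = h" using Esp_iff[OF s] by simp
    have "sum_norm (dflow_on_graph A f P phi t s \<xi> h - dflow_on_graph A f P phi t s \<xi>' h)
        \<le> weight s t * (2 * (norm (\<xi> - \<xi>') * norm h))"
      using dstable_lipschitz(1)[OF s x(2) x(1) h' t]
      by (simp add: df[OF \<xi> h] df[OF \<xi>' h] sum_norm_def blinfun.bilinear_simps)
    also have "\<dots> = (2 * weight s t * norm (\<xi> - \<xi>') * norm h) * 1" by (simp add: mult_ac)
    also have "\<dots> \<le> (2 * weight s t * norm (\<xi> - \<xi>') * norm h) * (D * \<mu> s powr (2 * \<epsilon>))"
      using w by (intro mult_left_mono m) auto
    finally show "sum_norm (dflow_on_graph A f P phi t s \<xi> h - dflow_on_graph A f P phi t s \<xi>' h)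
        \<le> 2 * D * (\<mu> t / \<mu> s) powr a * \<mu> s powr (2 * \<epsilon>) * norm (\<xi> - \<xi>') * norm h"
      by (simp add: weight_def mult_ac)
  qed (use \<xi> D_ge_1 in auto)
qed

section \<open>Continuous differentiability of the invariant function\<close>

text \<open>
  The invariant function in the coordinates \<open>z = T 0 s v\<close>, in which the stable subspaces are all \<open>E(0)\<close>;
  it is extended to the whole space by composition with \<open>P 0\<close>. Its derivative in \<open>z\<close> is \<open>dpsi\<close>, and
  \<open>psi_const\<close> is a Lipschitz constant for \<open>psi\<close> and \<open>dpsi\<close> that depends continuously on \<open>s\<close>.
\<close>

definition psi :: "real \<times> 'a \<Rightarrow> 'a" where
  "psi = (\<lambda>(s, z). T 0 s (phi (s, T s 0 (P 0 z))))"

definition dpsi :: "real \<times> 'a \<Rightarrow> 'a \<Rightarrow>\<^sub>L 'a" where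
  "dpsi = (\<lambda>(s, z). T 0 s o\<^sub>L (dPhi s (T s 0 (P 0 z)) o\<^sub>L (T s 0 o\<^sub>L P 0)))"

definition psi_const :: "real \<Rightarrow> real" where
  "psi_const s = norm (T 0 s) * (1 + norm (T s 0 o\<^sub>L P 0))\<^sup>2"

lemma psi_const_nonneg: "0 \<le> psi_const s" by (simp add: psi_const_def)

lemma psi_const_cont: "continuous_on {0..} psi_const"
  unfolding psi_const_def
  by (intro continuous_intros continuous_T_to_0 continuous_T_0
      continuous_on_blinfun_compose)

lemma P_T0P: "0 \<le> s \<Longrightarrow> P s (T s 0 (P 0 z)) = T s 0 (P 0 z)"
  by (simp add: P_T P_idem)

lemma psi_P: "psi (s, P 0 z) = psi (s, z)"
  by (simp add: psi_def P_idem)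

lemma Q_psi: "0 \<le> s \<Longrightarrow> Q 0 (psi (s, z)) = psi (s, z)"
  by (simp add: psi_def Q_T Q_phi P_T0P)

lemma P_psi: "0 \<le> s \<Longrightarrow> P 0 (psi (s, z)) = 0"
  using Q_psi[of s z] by (simp add: Q_apply)

lemma psi_zero: "0 \<le> s \<Longrightarrow> psi (s, 0) = 0"
  by (simp add: psi_def phi_zero)

lemma psi_const_square_bound:
  "norm (T 0 s) * (norm (T s 0 (P 0 h)) * norm (T s 0 (P 0 k))) \<le> psi_const s * (norm h * norm k)"
proof -
  define n where "n = norm (T s 0 o\<^sub>L P 0)"
  have n: "norm (T s 0 (P 0 x)) \<le> (1 + n) * norm x" for x
    using norm_blinfun[of "T s 0 o\<^sub>L P 0" x] by (simp add: n_def algebra_simps add_increasing)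
  have "norm (T s 0 (P 0 h)) * norm (T s 0 (P 0 k)) \<le> ((1 + n) * norm h) * ((1 + n) * norm k)"
    by (intro mult_mono n) (auto simp: n_def)
  then have "norm (T 0 s) * (norm (T s 0 (P 0 h)) * norm (T s 0 (P 0 k))) \<le> norm (T 0 s) * (((1 + n) * norm h) * ((1 + n) * norm k))"
    by (intro mult_left_mono) auto
  then show ?thesis by (simp add: psi_const_def n_def power2_eq_square mult_ac)
qed

lemma psi_remainder:
  assumes s: "0 \<le> s"
  shows "norm (psi (s, z + h) - psi (s, z) - dpsi (s, z) h) \<le> psi_const s * (norm h)\<^sup>2"
proof -
  define x where "x = T s 0 (P 0 z)"
  define k where "k = T s 0 (P 0 h)"
  have px: "P s x = x" "P s (x + k) = x + k" using P_T0P[OF s] by (simp_all add: x_def k_def blinfun.bilinear_simps)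
  have "psi (s, z + h) - psi (s, z) - dpsi (s, z) h = T 0 s (phi (s, x + k) - phi (s, x) - dPhi s x k)"
    by (simp add: psi_def dpsi_def x_def k_def blinfun.bilinear_simps)
  then have "norm (psi (s, z + h) - psi (s, z) - dpsi (s, z) h) \<le> norm (T 0 s) * norm (phi (s, x + k) - phi (s, x) - dPhi s x k)"
    by (simp add: norm_blinfun)
  also have "\<dots> \<le> norm (T 0 s) * (norm k * norm k)"
    using phi_remainder[OF s px] by (intro mult_left_mono) (auto simp: power2_eq_square)
  also have "\<dots> \<le> psi_const s * (norm h * norm h)" unfolding k_def by (rule psi_const_square_bound)
  finally show ?thesis by (simp add: power2_eq_square)
qed

lemma psi_lipschitz:
  assumes s: "0 \<le> s"
  shows "norm (psi (s, z) - psi (s, y)) \<le> psi_const s * norm (z - y)"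
proof -
  define n where "n = norm (T s 0 o\<^sub>L P 0)"
  have "psi (s, z) - psi (s, y) = T 0 s (phi (s, T s 0 (P 0 z)) - phi (s, T s 0 (P 0 y)))"
    by (simp add: psi_def blinfun.bilinear_simps)
  then have "norm (psi (s, z) - psi (s, y)) \<le> norm (T 0 s) * norm (phi (s, T s 0 (P 0 z)) - phi (s, T s 0 (P 0 y)))"
    by (simp add: norm_blinfun)
  also have "\<dots> \<le> norm (T 0 s) * norm (T s 0 (P 0 z) - T s 0 (P 0 y))"
    by (intro mult_left_mono phi_lipschitz s P_T0P) auto
  also have "\<dots> = norm (T 0 s) * norm ((T s 0 o\<^sub>L P 0) (z - y))"
    by (simp add: blinfun.bilinear_simps)
  also have "\<dots> \<le> norm (T 0 s) * (n * norm (z - y))"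
    unfolding n_def by (intro mult_left_mono norm_blinfun) auto
  also have "\<dots> \<le> norm (T 0 s) * ((1 + n)\<^sup>2 * norm (z - y))"
  proof (intro mult_left_mono mult_right_mono)
    have "0 \<le> n" by (simp add: n_def)
    then show "n \<le> (1 + n)\<^sup>2" by (simp add: power2_eq_square algebra_simps add_increasing)
  qed auto
  finally show ?thesis by (simp add: psi_const_def n_def mult_ac)
qed

lemma dpsi_lipschitz:
  assumes s: "0 \<le> s"
  shows "norm (dpsi (s, z) - dpsi (s, y)) \<le> psi_const s * norm (z - y)"
proof (rule norm_blinfun_bound)
  fix h
  define k where "k = T s 0 (P 0 h)"
  have "(dpsi (s, z) - dpsi (s, y)) h = T 0 s (dPhi s (T s 0 (P 0 z)) k - dPhi s (T s 0 (P 0 y)) k)"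
    by (simp add: dpsi_def k_def blinfun.bilinear_simps)
  then have "norm ((dpsi (s, z) - dpsi (s, y)) h) \<le> norm (T 0 s) * norm (dPhi s (T s 0 (P 0 z)) k - dPhi s (T s 0 (P 0 y)) k)"
    by (simp add: norm_blinfun)
  also have "\<dots> \<le> norm (T 0 s) * (norm (T s 0 (P 0 z) - T s 0 (P 0 y)) * norm (P s k))"
    by (intro mult_left_mono dPhi_lipschitz s P_T0P) auto
  also have "\<dots> = norm (T 0 s) * (norm (T s 0 (P 0 (z - y))) * norm (T s 0 (P 0 h)))"
    by (simp add: k_def P_T0P[OF s] blinfun.bilinear_simps)
  also have "\<dots> \<le> psi_const s * (norm (z - y) * norm h)" by (rule psi_const_square_bound)
  finally show "norm ((dpsi (s, z) - dpsi (s, y)) h) \<le> psi_const s * norm (z - y) * norm h" by (simp add: mult_ac)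
qed (simp add: psi_const_nonneg)

text \<open>
  Through every point of the graph passes a solution that stays in the graph for all times.
\<close>

lemma graph_curve:
  assumes s0: "0 \<le> s0"
  obtains v where "global_solution v" "v s0 = T s0 0 (P 0 z0 + psi (s0, z0))"
    "\<And>s. 0 \<le> s \<Longrightarrow> Q 0 (T 0 s (v s)) = psi (s, T 0 s (v s))"
proof -
  obtain v where v: "global_solution v" "v s0 = T s0 0 (P 0 z0 + psi (s0, z0))"
    using global_solution_exists[OF s0] by blast
  have Tpsi: "T s0 0 (psi (s0, z0)) = phi (s0, T s0 0 (P 0 z0))"
    using s0 by (simp add: psi_def T_inverse)
  have "P s0 (v s0) = T s0 0 (P 0 z0)"
    using s0 by (simp add: v(2) P_T blinfun.bilinear_simps P_psi P_idem)
  moreover have "Q s0 (v s0) = phi (s0, T s0 0 (P 0 z0))"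
    using s0 Q_phi[OF s0 P_T0P[OF s0]] by (simp add: v(2) Q_T blinfun.bilinear_simps Q_psi Tpsi Q_P)
  ultimately have on: "Q s0 (v s0) = phi (s0, P s0 (v s0))" by simp
  show ?thesis
  proof (rule that[OF v])
    fix s :: real assume s: "0 \<le> s"
    have "Q 0 (T 0 s (v s)) = T 0 s (phi (s, P s (v s)))"
      using global_solution_stays_on_graph[OF v(1) s0 on s] s by (simp add: Q_T)
    also have "\<dots> = psi (s, T 0 s (v s))" using s by (simp add: psi_def P_T T_inverse)
    finally show "Q 0 (T 0 s (v s)) = psi (s, T 0 s (v s))" .
  qed
qed

text \<open>
  Tends to \<open>0\<close> as \<open>s\<close> tends to \<open>s0\<close>. The last factor measures how far a solution moves in the coordinate
  \<open>z\<close> between the two times, per unit of its value at \<open>s0\<close>.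
\<close>

definition psi_modulus :: "real \<Rightarrow> real \<Rightarrow> real" where
  "psi_modulus s0 s = (psi_const s + norm (Q 0)) * (norm (T s0 0) * (norm (P 0) + psi_const s0)) *
     (norm (T 0 s) * (exp (2 * \<bar>\<Gamma> s - \<Gamma> s0\<bar>) - 1) + norm (T 0 s - T 0 s0))"

lemma psi_modulus_cont: "continuous_on {0..} (psi_modulus s0)"
  unfolding psi_modulus_def by (intro continuous_intros psi_const_cont continuous_T_to_0 \<Gamma>_cont)

lemma psi_modulus_self: "psi_modulus s0 s0 = 0"
  by (simp add: psi_modulus_def)

lemma psi_modulus_nonneg: "0 \<le> psi_modulus s0 s"
  unfolding psi_modulus_def by (intro mult_nonneg_nonneg add_nonneg_nonneg psi_const_nonneg) auto

text \<open>
  Follow the solution in the graph that starts over \<open>z\<close> at time \<open>s0\<close>. Its unstable coordinate is \<open>psi\<close> at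
  both times, and its stable coordinate has moved little.
\<close>

lemma psi_time_close:
  assumes s0: "0 \<le> s0" and s: "0 \<le> s"
  shows "norm (psi (s, z) - psi (s0, z)) \<le> psi_modulus s0 s * norm z"
proof -
  obtain v where v: "global_solution v" "v s0 = T s0 0 (P 0 z + psi (s0, z))"
    "\<And>s. 0 \<le> s \<Longrightarrow> Q 0 (T 0 s (v s)) = psi (s, T 0 s (v s))"
    using graph_curve[OF s0] by blast
  define y where "y s = T 0 s (v s)" for s
  have y0: "y s0 = P 0 z + psi (s0, z)" using s0 by (simp add: y_def v(2) T_inverse)
  define \<eta> where "\<eta> = norm (T 0 s) * (exp (2 * \<bar>\<Gamma> s - \<Gamma> s0\<bar>) - 1) + norm (T 0 s - T 0 s0)"
  have \<eta>0: "0 \<le> \<eta>" by (simp add: \<eta>_def)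
  have v0: "norm (v s0) \<le> norm (T s0 0) * ((norm (P 0) + psi_const s0) * norm z)"
  proof -
    have "norm (P 0 z + psi (s0, z)) \<le> norm (P 0) * norm z + psi_const s0 * norm z"
      using norm_triangle_ineq[of "P 0 z" "psi (s0, z)"] norm_blinfun[of "P 0" z]
        psi_lipschitz[OF s0, of z 0] psi_zero[OF s0] by simp
    then have "norm (T s0 0) * norm (P 0 z + psi (s0, z)) \<le> norm (T s0 0) * ((norm (P 0) + psi_const s0) * norm z)"
      by (intro mult_left_mono) (auto simp: algebra_simps)
    then show ?thesis unfolding v(2) using norm_blinfun order_trans by blast
  qed
  have yd: "norm (y s - y s0) \<le> \<eta> * norm (v s0)"
  proof -
    have "y s - y s0 = T 0 s (v s - v s0) + (T 0 s - T 0 s0) (v s0)"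
      by (simp add: y_def blinfun.bilinear_simps)
    then have "norm (y s - y s0) \<le> norm (T 0 s (v s - v s0)) + norm ((T 0 s - T 0 s0) (v s0))"
      by (simp add: norm_triangle_ineq)
    also have "\<dots> \<le> norm (T 0 s) * norm (v s - v s0) + norm (T 0 s - T 0 s0) * norm (v s0)"
      by (intro add_mono norm_blinfun)
    also have "\<dots> \<le> norm (T 0 s) * (norm (v s0) * (exp (2 * \<bar>\<Gamma> s - \<Gamma> s0\<bar>) - 1)) + norm (T 0 s - T 0 s0) * norm (v s0)"
      by (intro add_right_mono mult_left_mono solution_growth[OF v(1) s0 s]) auto
    finally show ?thesis by (simp add: \<eta>_def algebra_simps)
  qed
  have "psi (s, z) = psi (s, y s0)"
    using psi_P[of s z] psi_P[of s "y s0"] s0 by (simp add: y0 blinfun.bilinear_simps P_psi P_idem)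
  then have "psi (s, z) - psi (s0, z) = (psi (s, y s0) - psi (s, y s)) + Q 0 (y s - y s0)"
    using v(3)[OF s] v(3)[OF s0] s0 y0 P_Q[of 0] psi_P[of s0 "y s0"] psi_P[of s0 z]
    by (simp add: y_def[symmetric] blinfun.bilinear_simps Q_psi Q_P)
  then have "norm (psi (s, z) - psi (s0, z)) \<le> norm (psi (s, y s0) - psi (s, y s)) + norm (Q 0 (y s - y s0))"
    by (simp add: norm_triangle_ineq)
  also have "\<dots> \<le> psi_const s * norm (y s - y s0) + norm (Q 0) * norm (y s - y s0)"
    using psi_lipschitz[OF s, of "y s0" "y s"] by (intro add_mono norm_blinfun) (simp add: norm_minus_commute)
  also have "\<dots> = (psi_const s + norm (Q 0)) * norm (y s - y s0)" by (simp add: algebra_simps)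
  also have "\<dots> \<le> (psi_const s + norm (Q 0)) * (\<eta> * norm (v s0))"
    using psi_const_nonneg[of s] by (intro mult_left_mono yd) auto
  also have "\<dots> \<le> (psi_const s + norm (Q 0)) * (\<eta> * (norm (T s0 0) * ((norm (P 0) + psi_const s0) * norm z)))"
    using psi_const_nonneg[of s] \<eta>0 by (intro mult_left_mono v0) auto
  also have "\<dots> = psi_modulus s0 s * norm z" by (simp add: psi_modulus_def \<eta>_def mult_ac)
  finally show ?thesis .
qed

text \<open>
  \<open>derivative_close\<close> on the ball of radius \<open>r\<close>. With \<open>r\<close> the square root of a bound for their distance,
  both error terms are of order \<open>r\<close>; the summand \<open>\<bar>s - s0\<bar>\<close> keeps \<open>r\<close> positive.
\<close>

lemma dpsi_time_close:
  assumes s0: "0 \<le> s0" and s: "0 \<le> s"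
  defines "r \<equiv> sqrt (psi_modulus s0 s + \<bar>s - s0\<bar>)"
  shows "norm (dpsi (s, z) - dpsi (s0, z)) \<le> 2 * r * (norm z + r) + 2 * (psi_const s + psi_const s0) * r"
proof (cases "s = s0")
  case True
  then show ?thesis by (simp add: r_def psi_modulus_self)
next
  case False
  have r2: "r\<^sup>2 = psi_modulus s0 s + \<bar>s - s0\<bar>" using psi_modulus_nonneg[of s0 s] by (simp add: r_def)
  have r: "0 < r" using psi_modulus_nonneg[of s0 s] False by (simp add: r_def)
  have "norm (dpsi (s, z) - dpsi (s0, z)) \<le> 2 * (r\<^sup>2 * (norm z + r)) / r + 2 * (psi_const s + psi_const s0) * r"
  proof (rule derivative_close[where ?g1.0 = "\<lambda>z. psi (s, z)" and ?g2.0 = "\<lambda>z. psi (s0, z)" and v = z])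
    show "0 < r" by (rule r)
    show "0 \<le> psi_const s + psi_const s0" using psi_const_nonneg by simp
    fix h :: 'a assume h: "norm h \<le> r"
    have "psi_const s * (norm h)\<^sup>2 \<le> (psi_const s + psi_const s0) * (norm h)\<^sup>2"
      "psi_const s0 * (norm h)\<^sup>2 \<le> (psi_const s + psi_const s0) * (norm h)\<^sup>2"
      using psi_const_nonneg by (intro mult_right_mono; simp)+
    then show "norm (psi (s, z + h) - psi (s, z) - dpsi (s, z) h) \<le> (psi_const s + psi_const s0) * (norm h)\<^sup>2"
      "norm (psi (s0, z + h) - psi (s0, z) - dpsi (s0, z) h) \<le> (psi_const s + psi_const s0) * (norm h)\<^sup>2"
      using psi_remainder[OF s, of z h] psi_remainder[OF s0, of z h] by linarith+
    have "norm (psi (s, z + h) - psi (s0, z + h)) \<le> psi_modulus s0 s * norm (z + h)"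
      by (rule psi_time_close[OF s0 s])
    also have "\<dots> \<le> r\<^sup>2 * (norm z + r)"
      using psi_modulus_nonneg[of s0 s] h norm_triangle_ineq[of z h] unfolding r2 by (intro mult_mono) auto
    finally show "norm (psi (s, z + h) - psi (s0, z + h)) \<le> r\<^sup>2 * (norm z + r)" .
  qed
  then show ?thesis using r by (simp add: power2_eq_square)
qed

lemma continuous_fst_half:
  "continuous_on {0..} c \<Longrightarrow> continuous_on ({0::real..} \<times> UNIV) (\<lambda>x. c (fst x))"
  by (rule continuous_on_compose2[OF _ continuous_on_fst[OF continuous_on_id]]) auto

lemma dpsi_cont: "continuous_on ({0..} \<times> UNIV) dpsi"
  unfolding continuous_on_def
proof (intro ballI)
  fix p :: "real \<times> 'a" assume "p \<in> {0..} \<times> UNIV"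
  then obtain s0 z0 where p: "p = (s0, z0)" and s0: "0 \<le> s0" by (cases p) auto
  define r where "r s = sqrt (psi_modulus s0 s + \<bar>s - s0\<bar>)" for s
  define B where "B x = psi_const (fst x) * norm (snd x - z0) + 2 * r (fst x) * (norm z0 + r (fst x))
    + 2 * (psi_const (fst x) + psi_const s0) * r (fst x)" for x :: "real \<times> 'a"
  have rc: "continuous_on {0..} r" unfolding r_def by (intro continuous_intros psi_modulus_cont)
  have "continuous_on ({0..} \<times> UNIV) B"
    unfolding B_def by (intro continuous_intros continuous_fst_half rc psi_const_cont)
  moreover have "B p = 0" by (simp add: B_def p r_def psi_modulus_self)
  ultimately have lim: "(B \<longlongrightarrow> 0) (at p within {0..} \<times> UNIV)"
    using \<open>p \<in> _\<close> unfolding continuous_on_def by metis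
  have "norm (dpsi x - dpsi p) \<le> B x" if mem: "x \<in> {0..} \<times> UNIV" for x
  proof -
    obtain s z where x: "x = (s, z)" and s: "0 \<le> s" using mem by (cases x) auto
    have "norm (dpsi (s, z) - dpsi (s0, z0)) \<le> norm (dpsi (s, z) - dpsi (s, z0)) + norm (dpsi (s, z0) - dpsi (s0, z0))"
      using norm_triangle_ineq[of "dpsi (s, z) - dpsi (s, z0)" "dpsi (s, z0) - dpsi (s0, z0)"] by simp
    then show ?thesis
      using dpsi_lipschitz[OF s, of z z0] dpsi_time_close[OF s0 s, of z0] by (simp add: x p B_def r_def)
  qed
  then show "(dpsi \<longlongrightarrow> dpsi p) (at p within {0..} \<times> UNIV)"
    by (intro LIM_zero_cancel[OF Lim_null_comparison[OF _ lim]])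
       (auto simp: eventually_at_filter intro!: always_eventually)
qed

lemma psi_partial_derivative:
  assumes s: "0 \<le> s"
  shows "((\<lambda>z. psi (s, z)) has_derivative blinfun_apply (dpsi (s, z))) (at z)"
  by (rule quadratic_remainder_has_derivative[OF blinfun.bounded_linear_right, where C = "psi_const s"])
     (use psi_remainder[OF s, of z] in \<open>metis add.commute diff_add_cancel\<close>)

text \<open>
  The vector field of the equation in the coordinate \<open>z\<close>, at the point of the graph over \<open>P 0 z\<close>.
\<close>

definition graph_field :: "real \<times> 'a \<Rightarrow> 'a" where
  "graph_field = (\<lambda>(s, z). T 0 s (f s (T s 0 (P 0 z + psi (s, z)))))"

text \<open>
  The derivative is dictated by invariance: along a solution \<open>z\<close> in the graph, \<open>psi (s, z s) = Q 0 (z s)\<close>,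
  and the derivative of the left-hand side must match.
\<close>

lemma psi_total_derivative:
  assumes s0: "0 \<le> s0"
  shows "(psi has_derivative (\<lambda>(ds, dz). ds *\<^sub>R Q 0 (graph_field (s0, z0)) + dpsi (s0, z0) (dz - ds *\<^sub>R P 0 (graph_field (s0, z0)))))
    (at (s0, z0) within {0..} \<times> UNIV)"
proof -
  obtain v where v: "global_solution v" "v s0 = T s0 0 (P 0 z0 + psi (s0, z0))"
    "\<And>s. 0 \<le> s \<Longrightarrow> Q 0 (T 0 s (v s)) = psi (s, T 0 s (v s))"
    using graph_curve[OF s0] by blast
  define z where "z s = T 0 s (v s)" for s
  define g where "g = graph_field (s0, z0)"
  have zs0: "z s0 = P 0 z0 + psi (s0, z0)" using s0 by (simp add: z_def v(2) T_inverse)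
  have z': "(z has_vector_derivative T 0 s (f s (v s))) (at s within {0..})" if "0 \<le> s" for s
    unfolding z_def using v(1) that
    by (intro T_pull_deriv) (auto simp: global_solution_def forced_solution_def)
  have z'0: "(z has_derivative (\<lambda>ds. ds *\<^sub>R g)) (at s0 within {0..})"
    using z'[OF s0] by (simp add: g_def graph_field_def v(2) has_vector_derivative_def)
  define y where "y s = z0 + P 0 (z s - z s0)" for s
  have y0: "y s0 = z0" by (simp add: y_def)
  have Py: "P 0 (y s) = P 0 (z s)" for s
    using s0 by (simp add: y_def zs0 blinfun.bilinear_simps P_idem P_psi)
  have y': "(y has_derivative (\<lambda>ds. ds *\<^sub>R P 0 g)) (at s0 within {0..})"
    unfolding y_def
    by (rule derivative_eq_intros bounded_linear.has_derivative[OF blinfun.bounded_linear_right] z'0 refl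
        | simp add: blinfun.bilinear_simps)+
  have "continuous_on {0..} z" by (rule continuous_on_vector_derivative) (use z' in auto)
  then have yc: "continuous_on {0..} y"
    unfolding y_def by (intro continuous_intros)
  have psiy: "psi (s, y s) = Q 0 (z s)" if "0 \<le> s" for s
    using v(3)[OF that] psi_P[of s "y s"] psi_P[of s "z s"] by (simp add: Py z_def)
  \<comment> \<open>Centred at the moving point \<open>y s\<close>, \<open>psi\<close> has a time derivative at \<open>h = 0\<close> that is known from invariance, and a continuous space derivative; the joint derivative follows, and the shift is undone by the chain rule.\<close>
  have chi: "((\<lambda>(s, h). psi (s, y s + h)) has_derivative (\<lambda>(ds, dh). ds *\<^sub>R Q 0 g + dpsi (s0, y s0 + 0) dh))
      (at (s0, 0) within {0..} \<times> UNIV)"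
  proof (rule has_derivative_partialsI[where fy = "\<lambda>s h. dpsi (s, y s + h)"])
    have "((\<lambda>s. Q 0 (z s)) has_derivative (\<lambda>ds. ds *\<^sub>R Q 0 g)) (at s0 within {0..})"
      using bounded_linear.has_derivative[OF blinfun.bounded_linear_right z'0, of "Q 0"]
      by (simp add: blinfun.bilinear_simps)
    then show "((\<lambda>s. psi (s, y s + 0)) has_derivative (\<lambda>ds. ds *\<^sub>R Q 0 g)) (at s0 within {0..})"
      by (rule has_derivative_transform[rotated 2]) (use s0 psiy in auto)
    fix s :: real and h :: 'a assume s: "s \<in> {0..}"
    have "((\<lambda>h. y s + h) has_derivative (\<lambda>h. h)) (at h)" by (auto intro!: derivative_eq_intros)
    from has_derivative_compose[OF this psi_partial_derivative[of s "y s + h"]] s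
    show "((\<lambda>h. psi (s, y s + h)) has_derivative blinfun_apply (dpsi (s, y s + h))) (at h within UNIV)" by simp
  next
    have "continuous_on ({0..} \<times> UNIV) (\<lambda>x. dpsi (fst x, y (fst x) + snd x))"
      by (rule continuous_on_compose2[OF dpsi_cont]) (auto intro!: continuous_intros continuous_fst_half yc)
    then show "continuous (at (s0, 0) within {0..} \<times> UNIV) (\<lambda>(s, h). dpsi (s, y s + h))"
      using s0 by (simp add: continuous_on_eq_continuous_within case_prod_unfold)
  qed auto
  have y'': "((\<lambda>x. y (fst x)) has_derivative (\<lambda>h. fst h *\<^sub>R P 0 g)) (at (s0, z0) within {0..} \<times> UNIV)"
    by (rule has_derivative_in_compose[where g = y and f = fst, OF has_derivative_fst[OF has_derivative_ident]])
       (rule has_derivative_subset[OF _ ], use y' in auto)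
  have sh: "((\<lambda>x. (fst x, snd x - y (fst x))) has_derivative (\<lambda>h. (fst h, snd h - fst h *\<^sub>R P 0 g)))
      (at (s0, z0) within {0..} \<times> UNIV)"
    by (intro has_derivative_Pair has_derivative_diff y'' has_derivative_fst has_derivative_snd has_derivative_ident)
  have "((\<lambda>x. (\<lambda>(s, h). psi (s, y s + h)) (fst x, snd x - y (fst x))) has_derivative
      (\<lambda>h. (\<lambda>(ds, dh). ds *\<^sub>R Q 0 g + dpsi (s0, y s0 + 0) dh) (fst h, snd h - fst h *\<^sub>R P 0 g)))
      (at (s0, z0) within {0..} \<times> UNIV)"
    by (rule has_derivative_in_compose[OF sh], rule has_derivative_subset[where s = "{0..} \<times> UNIV"])
       (use chi y0 in auto)
  then show ?thesis by (simp add: y0 g_def case_prod_unfold)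
qed

definition psi_total :: "real \<times> 'a \<Rightarrow> (real \<times> 'a) \<Rightarrow>\<^sub>L 'a" where
  "psi_total x = (blinfun_scaleR_left (Q 0 (graph_field x) - dpsi x (P 0 (graph_field x))) o\<^sub>L fst_blinfun) + (dpsi x o\<^sub>L snd_blinfun)"

lemma psi_total_apply: "psi_total x h = fst h *\<^sub>R (Q 0 (graph_field x) - dpsi x (P 0 (graph_field x))) + dpsi x (snd h)"
  by (simp add: psi_total_def blinfun.bilinear_simps)

lemma psi_derivative:
  assumes "x \<in> {0..} \<times> UNIV"
  shows "(psi has_derivative blinfun_apply (psi_total x)) (at x within {0..} \<times> UNIV)"
proof -
  obtain s z where x: "x = (s, z)" "0 \<le> s" using assms by (cases x) auto
  show ?thesis
    by (rule has_derivative_eq_rhs[OF psi_total_derivative[OF x(2), of z, folded x(1)]])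
       (auto simp: x(1) psi_total_apply blinfun.bilinear_simps algebra_simps)
qed

lemma psi_cont: "continuous_on ({0..} \<times> UNIV) psi"
  by (rule has_derivative_continuous_on[OF psi_derivative])

lemma graph_field_cont: "continuous_on ({0..} \<times> UNIV) graph_field"
proof -
  have c: "continuous_on ({0..} \<times> UNIV) (\<lambda>x. T (fst x) 0 (P 0 (snd x) + psi x))"
    by (intro continuous_on_blinfun_apply continuous_intros
        continuous_fst_half continuous_T_0 psi_cont)
  have "continuous_on ({0..} \<times> UNIV) (\<lambda>x. case (fst x, T (fst x) 0 (P 0 (snd x) + psi x)) of (t, v) \<Rightarrow> f t v)"
    by (rule continuous_on_compose2[OF C1_on_imp_continuous_on[OF f_C1]
        continuous_on_Pair[OF continuous_on_fst[OF continuous_on_id] c]]) auto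
  then have "continuous_on ({0..} \<times> UNIV) (\<lambda>x. f (fst x) (T (fst x) 0 (P 0 (snd x) + psi x)))"
    by (simp only: prod.case)
  then have "continuous_on ({0..} \<times> UNIV) (\<lambda>x. T 0 (fst x) (f (fst x) (T (fst x) 0 (P 0 (snd x) + psi x))))"
    by (intro continuous_on_blinfun_apply
        continuous_fst_half continuous_T_to_0)
  then show ?thesis by (simp add: graph_field_def case_prod_beta')
qed

lemma psi_total_cont: "continuous_on ({0..} \<times> UNIV) psi_total"
  unfolding psi_total_def
  by (intro continuous_on_add continuous_on_blinfun_compose
      bounded_linear.continuous_on[OF bounded_linear_blinfun_scaleR_left] continuous_on_diff
      continuous_on_blinfun_apply continuous_on_const graph_field_cont dpsi_cont)

lemma psi_C1: "C1_on ({0..} \<times> UNIV) psi"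
  by (rule C1_onI[OF psi_total_cont psi_derivative])

lemma T_0_C1: "C1_on {0..} (\<lambda>t. T t 0)"
  by (rule C1_on_curve[where c' = "\<lambda>t. A t o\<^sub>L T t 0"])
     (auto intro!: T_0_deriv continuous_on_blinfun_compose A_cont continuous_T_0)

lemma T_to_0_C1: "C1_on {0..} (\<lambda>t. T 0 t)"
  by (rule C1_on_curve[where c' = "\<lambda>t. - (T 0 t o\<^sub>L A t)"])
     (auto intro!: T_to_0_deriv continuous_on_minus continuous_on_blinfun_compose
       A_cont continuous_T_to_0)

lemma phi_C1: "C1_on (Gset P) phi"
proof -
  have fs: "C1_on ({0..} \<times> UNIV) (fst :: real \<times> 'a \<Rightarrow> real)" "C1_on ({0..} \<times> UNIV) (snd :: real \<times> 'a \<Rightarrow> 'a)"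
    by (intro C1_on_bounded_linear bounded_linear_fst bounded_linear_snd)+
  have "C1_on ({0..} \<times> UNIV) (\<lambda>x. T 0 (fst x) (snd x))"
    by (intro C1_on_blinfun_apply C1_on_compose[OF fs(1) T_to_0_C1] fs) auto
  then have "C1_on ({0..} \<times> UNIV) (\<lambda>x. psi (fst x, T 0 (fst x) (snd x)))"
    by (intro C1_on_compose[OF C1_on_Pair psi_C1] fs) auto
  then have "C1_on ({0..} \<times> UNIV) (\<lambda>x. T (fst x) 0 (psi (fst x, T 0 (fst x) (snd x))))"
    by (intro C1_on_blinfun_apply C1_on_compose[OF fs(1) T_0_C1] fs) auto
  then have "C1_on (Gset P) (\<lambda>x. T (fst x) 0 (psi (fst x, T 0 (fst x) (snd x))))"
    by (rule C1_on_subset) (auto simp: Gset_def)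
  then show ?thesis
  proof (rule C1_on_cong)
    fix x assume "x \<in> Gset P"
    then obtain s \<xi> where "x = (s, \<xi>)" "0 \<le> s" "P s \<xi> = \<xi>" by (cases x) (auto simp: Gset_iff)
    then show "T (fst x) 0 (psi (fst x, T 0 (fst x) (snd x))) = phi x"
      by (simp add: psi_def T_inverse P_T)
  qed
qed

section \<open>The graph as a manifold\<close>

text \<open>
  A \<open>C\<^sup>1\<close> extension of \<open>T s 0\<close> to negative \<open>s\<close> by invertible operators: \<open>T 0 (- s)\<close> has at \<open>s = 0\<close> the same
  derivative \<open>A 0\<close> as \<open>T s 0\<close>, and the inverse of \<open>T_reflected s\<close> is \<open>T_reflected (- s)\<close>.
\<close>

definition T_reflected :: "real \<Rightarrow> 'a \<Rightarrow>\<^sub>L 'a" where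
  "T_reflected s = (if s \<in> {0..} then T s 0 else T 0 (- s))"

lemma T_reflected_inverse: "T_reflected s (T_reflected (- s) v) = v"
  by (auto simp: T_reflected_def T_inverse)

lemma T_reflected_C1: "C1_on UNIV T_reflected"
  unfolding T_reflected_def
proof (rule C1_on_glue[where R = "{..0}"
      and f' = "\<lambda>t. blinfun_scaleR_left (A t o\<^sub>L T t 0)" and g' = "\<lambda>t. blinfun_scaleR_left (T 0 (- t) o\<^sub>L A (- t))"])
  show "continuous_on {0..} (\<lambda>t. blinfun_scaleR_left (A t o\<^sub>L T t 0))"
    by (intro bounded_linear.continuous_on[OF bounded_linear_blinfun_scaleR_left]
        continuous_on_blinfun_compose A_cont continuous_T_0)
  have neg: "continuous_on {..0} (\<lambda>t. c (- t))" if "continuous_on {0..} c" for c :: "real \<Rightarrow> 'a \<Rightarrow>\<^sub>L 'a"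
    by (rule continuous_on_compose2[OF that]) (auto intro!: continuous_intros)
  show "continuous_on {..0} (\<lambda>t. blinfun_scaleR_left (T 0 (- t) o\<^sub>L A (- t)))"
    by (intro bounded_linear.continuous_on[OF bounded_linear_blinfun_scaleR_left]
        continuous_on_blinfun_compose neg A_cont continuous_T_to_0)
  fix t :: real
  show "((\<lambda>t. T t 0) has_derivative blinfun_apply (blinfun_scaleR_left (A t o\<^sub>L T t 0))) (at t within {0..})" if "t \<in> {0..}"
    using T_0_deriv[of t] that by (simp add: has_vector_derivative_def)
  show "((\<lambda>t. T 0 (- t)) has_derivative blinfun_apply (blinfun_scaleR_left (T 0 (- t) o\<^sub>L A (- t)))) (at t within {..0})"
    if "t \<in> {..0}"
  proof -
    have im: "uminus ` {..0} = {0::real..}" by force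
    have neg: "(uminus has_vector_derivative -1) (at t within {..0})"
      by (rule has_vector_derivative_minus[OF has_vector_derivative_id])
    have "(T 0 \<circ> uminus has_vector_derivative (-1) *\<^sub>R - (T 0 (- t) o\<^sub>L A (- t))) (at t within {..0})"
      by (rule vector_diff_chain_within[OF neg]) (use T_to_0_deriv[of "- t"] that in \<open>simp add: im\<close>)
    then show ?thesis by (simp add: has_vector_derivative_def o_def)
  qed
  assume "t \<in> {0..}" "t \<in> {..0}"
  then have t: "t = 0" by simp
  show "T t 0 = T 0 (- t)" by (simp add: t)
  have "T 0 0 = id_blinfun" by (rule blinfun_eqI) (simp add: T_self)
  then show "blinfun_scaleR_left (A t o\<^sub>L T t 0) = blinfun_scaleR_left (T 0 (- t) o\<^sub>L A (- t))"
    using blinfun_eqI[of "A 0 o\<^sub>L id_blinfun" "id_blinfun o\<^sub>L A 0"] by (simp add: t)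
qed auto

definition psi_reflected :: "real \<times> 'a \<Rightarrow> 'a" where
  "psi_reflected = (\<lambda>x. if x \<in> {0..} \<times> UNIV then psi x else 2 *\<^sub>R psi (0, snd x) - psi (- fst x, snd x))"

lemma psi_reflected_C1: "C1_on UNIV psi_reflected"
  unfolding psi_reflected_def by (rule C1_on_odd_reflection[OF psi_C1])

lemma psi_reflected_nonneg: "0 \<le> s \<Longrightarrow> psi_reflected (s, z) = psi (s, z)"
  by (simp add: psi_reflected_def)

text \<open>
  \<open>psi_reflected\<close> depends only on the stable component of \<open>z\<close> and takes unstable values, so that the shear
  \<open>z \<mapsto> z + psi_reflected (s, z)\<close> is inverted by changing the sign.
\<close>

lemma psi_reflected_shear: "psi_reflected (s, z + psi_reflected (s, y)) = psi_reflected (s, z)"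
proof -
  have P0: "P 0 (psi_reflected (s, y)) = 0"
    by (auto simp: psi_reflected_def P_psi blinfun.bilinear_simps)
  have e: "psi (r, z + psi_reflected (s, y)) = psi (r, z)" for r
    using psi_P[of r "z + psi_reflected (s, y)"] psi_P[of r z] P0 by (simp add: blinfun.bilinear_simps)
  show ?thesis unfolding psi_reflected_def[of] using e by (auto simp: psi_reflected_def)
qed

text \<open>
  One chart serves all points: pass to the coordinate \<open>z\<close>, then shear the graph onto \<open>E(0)\<close>. Both steps
  are defined for negative times too, which gives an open domain around the boundary points over
  time \<open>0\<close>.
\<close>

lemma graph_C1_submanifold: "C1_submanifold (ident ` graph_of P phi)"
  unfolding C1_submanifold_def
proof (intro ballI)
  fix p assume "p \<in> ident ` graph_of P phi"
  define h :: "real \<times> 'a \<Rightarrow> real \<times> 'a" where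
    "h x = (fst x, T_reflected (- fst x) (snd x) - psi_reflected (fst x, T_reflected (- fst x) (snd x)))" for x
  define g :: "real \<times> 'a \<Rightarrow> real \<times> 'a" where
    "g x = (fst x, T_reflected (fst x) (snd x + psi_reflected x))" for x
  define \<pi> :: "(real \<times> 'a) \<Rightarrow>\<^sub>L (real \<times> 'a)" where
    "\<pi> = (Pair_left o\<^sub>L fst_blinfun) + (Pair_right o\<^sub>L (P 0 o\<^sub>L snd_blinfun))"
  have \<pi>: "blinfun_apply \<pi> x = (fst x, P 0 (snd x))" for x by (simp add: \<pi>_def blinfun.bilinear_simps)
  have fs: "C1_on UNIV (fst :: real \<times> 'a \<Rightarrow> real)" "C1_on UNIV (snd :: real \<times> 'a \<Rightarrow> 'a)"
    "C1_on UNIV (\<lambda>x::real \<times> 'a. - fst x)"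
    by (intro C1_on_bounded_linear bounded_linear_fst bounded_linear_snd bounded_linear_minus)+
  have Tm: "C1_on UNIV (\<lambda>x::real \<times> 'a. T_reflected (- fst x) (snd x))"
    by (intro C1_on_blinfun_apply C1_on_compose[OF fs(3) T_reflected_C1] fs) auto
  have hC1: "C1_on UNIV h"
    unfolding h_def by (intro C1_on_Pair C1_on_diff Tm C1_on_compose[OF C1_on_Pair psi_reflected_C1] fs) auto
  have gC1: "C1_on UNIV g"
    unfolding g_def
    by (intro C1_on_Pair C1_on_blinfun_apply C1_on_compose[OF fs(1) T_reflected_C1] C1_on_add psi_reflected_C1 fs) auto
  have gh: "g (h x) = x" for x
  proof -
    have "psi_reflected (fst x, z - psi_reflected (fst x, z)) = psi_reflected (fst x, z)" for z
      using psi_reflected_shear[of "fst x" "z - psi_reflected (fst x, z)" z] by simp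
    then show ?thesis by (simp add: g_def h_def T_reflected_inverse)
  qed
  have hg: "h (g x) = x" for x
    using psi_reflected_shear[of "fst x" "snd x" "snd x"] T_reflected_inverse[of "- fst x"] by (simp add: g_def h_def)
  have h: "homeomorphism UNIV UNIV h g"
    unfolding homeomorphism_def
    using gh hg surjI[of h g, OF hg] surjI[of g h, OF gh]
      C1_on_imp_continuous_on[OF hC1] C1_on_imp_continuous_on[OF gC1] by simp
  have "h ` (ident ` graph_of P phi) = {w. w \<in> range \<pi> \<and> 0 \<le> fst w}"
  proof (intro set_eqI iffI)
    fix w assume "w \<in> h ` (ident ` graph_of P phi)"
    then obtain s x where s: "0 \<le> s" and x: "P s x = x" and w: "w = h (s, x + phi (s, x))"
      by (auto simp: graph_of_def lift_def ident_def Gset_iff)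
    have "psi (s, T 0 s (x + phi (s, x))) = T 0 s (phi (s, x))"
      using s x by (simp add: psi_def P_T T_inverse blinfun.bilinear_simps P_phi)
    moreover have "T_reflected (- s) = T 0 s" using s by (auto simp: T_reflected_def)
    ultimately have "w = (s, T 0 s x)"
      using s by (simp add: w h_def psi_reflected_nonneg blinfun.bilinear_simps)
    moreover have "(s, T 0 s x) = \<pi> (s, T 0 s x)" using s x by (simp add: \<pi> P_T)
    ultimately show "w \<in> {w. w \<in> range \<pi> \<and> 0 \<le> fst w}" using s by (auto intro: range_eqI)
  next
    fix w assume "w \<in> {w. w \<in> range \<pi> \<and> 0 \<le> fst w}"
    then obtain s z where w: "w = (s, P 0 z)" and s: "0 \<le> s" by (auto simp: \<pi>)
    define x where "x = T s 0 (P 0 z)"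
    have x: "P s x = x" using P_T0P[OF s] by (simp add: x_def)
    have "g w = (s, T s 0 (P 0 z + psi (s, P 0 z)))" using s by (simp add: g_def w psi_reflected_nonneg T_reflected_def)
    also have "\<dots> = (s, x + phi (s, x))"
      using s by (simp add: psi_P) (simp add: x_def psi_def T_inverse blinfun.bilinear_simps)
    finally have "w = h (s, x + phi (s, x))" using hg by metis
    moreover have "(s, x + phi (s, x)) \<in> ident ` graph_of P phi"
      by (rule image_eqI[of _ _ "(s, x, phi (s, x))"]) (auto simp: ident_def mem_graph_of s x)
    ultimately show "w \<in> h ` (ident ` graph_of P phi)" by blast
  qed
  then have "h ` (UNIV \<inter> ident ` graph_of P phi) = {w \<in> UNIV. w \<in> range \<pi> \<and> 0 \<le> blinfun_apply fst_blinfun w}"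
    by simp
  moreover have "\<pi> o\<^sub>L \<pi> = \<pi>" by (rule blinfun_eqI) (simp add: \<pi> P_idem)
  ultimately show "\<exists>U W h g. \<exists>(\<pi> :: (real \<times> 'a) \<Rightarrow>\<^sub>L (real \<times> 'a)) (l :: (real \<times> 'a) \<Rightarrow>\<^sub>L real).
        open U \<and> p \<in> U \<and> open W \<and> homeomorphism U W h g \<and> C1_on U h \<and> C1_on W g \<and>
        \<pi> o\<^sub>L \<pi> = \<pi> \<and> h ` (U \<inter> ident ` graph_of P phi) = {w \<in> W. w \<in> range \<pi> \<and> 0 \<le> l w}"
    using h hC1 gC1 by (intro exI[of _ UNIV] exI[of _ h] exI[of _ g] exI[of _ \<pi>] exI[of _ fst_blinfun]) auto
qed

section \<open>The tangent spaces\<close>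

lemma phi_quadratic: "0 \<le> s \<Longrightarrow> P s \<xi> = \<xi> \<Longrightarrow> norm (phi (s, \<xi>)) \<le> (norm \<xi>)\<^sup>2"
  using phi_remainder[of s 0 \<xi>] by (simp add: phi_zero dPhi_zero)

lemma C1_curve_in_tangent_space:
  assumes "C1_on {0..1} \<gamma>" "\<And>r. r \<in> {0..1} \<Longrightarrow> \<gamma> r \<in> M" "\<gamma> 0 = p"
    and "(\<gamma> has_vector_derivative v) (at 0 within {0..1})"
  shows "v \<in> tangent_space M p"
  unfolding tangent_space_def
  by (intro span_base CollectI exI[of _ \<gamma>] exI[of _ "1::real"]) (use assms in auto)

lemma mem_ident_graph:
  "(s, v) \<in> ident ` graph_of P phi \<longleftrightarrow> 0 \<le> s \<and> Q s v = phi (s, P s v)"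
proof
  assume "(s, v) \<in> ident ` graph_of P phi"
  then obtain x where "0 \<le> s" "P s x = x" "v = x + phi (s, x)"
    by (auto simp: graph_of_def lift_def ident_def Gset_iff)
  then show "0 \<le> s \<and> Q s v = phi (s, P s v)"
    by (simp add: P_phi blinfun.bilinear_simps Q_phi Q_apply)
next
  assume *: "0 \<le> s \<and> Q s v = phi (s, P s v)"
  then have "(s, v) = ident (s, P s v, phi (s, P s v))" by (simp add: ident_def Q_apply algebra_simps)
  moreover have "(s, P s v, phi (s, P s v)) \<in> graph_of P phi" using * by (simp add: mem_graph_of P_idem)
  ultimately show "(s, v) \<in> ident ` graph_of P phi" by blast
qed

lemma P_cont: "continuous_on {0..} P"
proof -
  have "continuous_on {0..} (\<lambda>t. T t 0 o\<^sub>L (P 0 o\<^sub>L T 0 t))"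
    by (intro continuous_on_blinfun_compose continuous_T_0
        continuous_T_to_0 continuous_on_const)
  then show ?thesis
    by (rule continuous_on_eq) (auto intro!: blinfun_eqI simp: P_T T_inverse)
qed

text \<open>
  The unstable component of a point of the graph is at most the square of its stable component, hence
  of second order along a curve starting at \<open>(s, 0)\<close>.
\<close>

lemma tangent_velocity_in_Esp:
  assumes s: "0 \<le> s" and e: "0 < e" and \<gamma>: "\<gamma> ` {0..e} \<subseteq> ident ` graph_of P phi" "\<gamma> 0 = (s, 0)"
    and d: "(\<gamma> has_vector_derivative v) (at 0 within {0..e})"
  shows "snd v \<in> Esp P s"
proof -
  define F where "F = at (0::real) within {0..e}"
  have neF: "F \<noteq> bot" unfolding F_def using e
    by (simp add: trivial_limit_within islimpt_Icc)
  define q where "q r = snd (\<gamma> r) /\<^sub>R r" for r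
  have mem: "0 \<le> fst (\<gamma> r)" "Q (fst (\<gamma> r)) (snd (\<gamma> r)) = phi (fst (\<gamma> r), P (fst (\<gamma> r)) (snd (\<gamma> r)))"
    if "r \<in> {0..e}" for r
    using \<gamma>(1) that mem_ident_graph[of "fst (\<gamma> r)" "snd (\<gamma> r)"] by (auto simp: image_subset_iff)
  have \<gamma>c: "(\<gamma> \<longlongrightarrow> (s, 0)) F"
    using has_vector_derivative_continuous[OF d] \<gamma>(2) by (simp add: continuous_within F_def)
  have fc: "((\<lambda>r. fst (\<gamma> r)) \<longlongrightarrow> s) F" using tendsto_fst[OF \<gamma>c] by simp
  have sc: "((\<lambda>r. snd (\<gamma> r)) \<longlongrightarrow> 0) F" using tendsto_snd[OF \<gamma>c] by simp
  have "((\<lambda>r. (\<gamma> r - \<gamma> 0) /\<^sub>R (r - 0)) \<longlongrightarrow> v) F"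
    using d unfolding has_vector_derivative_iff_quotient F_def .
  from tendsto_snd[OF this] have q: "(q \<longlongrightarrow> snd v) F" by (simp add: q_def[abs_def] \<gamma>(2))
  have evF: "\<forall>\<^sub>F r in F. r \<in> {0<..e}"
    unfolding F_def by (auto simp: eventually_at_filter intro!: always_eventually)
  have Pc: "((\<lambda>r. P (fst (\<gamma> r))) \<longlongrightarrow> P s) F"
  proof (rule continuous_on_tendsto_compose[OF P_cont fc])
    show "s \<in> {0..}" using s by simp
    show "\<forall>\<^sub>F r in F. fst (\<gamma> r) \<in> {0..}" using evF by eventually_elim (use mem in auto)
  qed
  have Qc: "((\<lambda>r. Q (fst (\<gamma> r)) (q r)) \<longlongrightarrow> Q s (snd v)) F"
    unfolding Q_apply by (intro tendsto_diff q bounded_bilinear.tendsto[OF bounded_bilinear_blinfun_apply] Pc)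
  have le: "norm (Q (fst (\<gamma> r)) (q r)) \<le> (norm (P (fst (\<gamma> r))))\<^sup>2 * (norm (q r) * norm (snd (\<gamma> r)))" if r: "r \<in> {0<..e}" for r
  proof -
    have r': "r \<in> {0..e}" using r by auto
    note m = mem[OF r']
    define y where "y = snd (\<gamma> r)"
    define N where "N = norm (P (fst (\<gamma> r)))"
    have "norm (Q (fst (\<gamma> r)) y) \<le> (norm (P (fst (\<gamma> r)) y))\<^sup>2"
      using phi_quadratic[OF m(1) P_idem[OF m(1)], of y] m(2) by (simp add: y_def)
    also have "\<dots> \<le> (N * norm y)\<^sup>2" unfolding N_def by (intro power_mono norm_blinfun) auto
    finally have 1: "norm (Q (fst (\<gamma> r)) y) \<le> (N * norm y)\<^sup>2" .
    have "norm (Q (fst (\<gamma> r)) (q r)) = norm (Q (fst (\<gamma> r)) y) / r"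
      using r by (simp add: q_def y_def blinfun.bilinear_simps divide_inverse mult.commute)
    also have "\<dots> \<le> (N * norm y)\<^sup>2 / r" using 1 r by (intro divide_right_mono) auto
    also have "\<dots> = N\<^sup>2 * (norm (q r) * norm y)"
      using r by (simp add: q_def y_def power2_eq_square divide_inverse mult_ac)
    finally show ?thesis by (simp add: N_def y_def)
  qed
  have "((\<lambda>r. (norm (P (fst (\<gamma> r))))\<^sup>2 * (norm (q r) * norm (snd (\<gamma> r)))) \<longlongrightarrow>
      (norm (P s))\<^sup>2 * (norm (snd v) * norm (0::'a))) F"
    by (intro tendsto_mult tendsto_power tendsto_norm Pc q sc)
  then have lim: "((\<lambda>r. (norm (P (fst (\<gamma> r))))\<^sup>2 * (norm (q r) * norm (snd (\<gamma> r)))) \<longlongrightarrow> 0) F"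
    by simp
  have "((\<lambda>r. Q (fst (\<gamma> r)) (q r)) \<longlongrightarrow> 0) F"
    by (rule Lim_null_comparison[OF eventually_mono[OF evF le] lim])
  with Qc have "Q s (snd v) = 0" using tendsto_unique[OF neF] by blast
  then show ?thesis using s by (simp add: Esp_iff Q_apply)
qed

lemma graph_tangent_space:
  assumes s: "0 \<le> s"
  shows "tangent_space (ident ` graph_of P phi) (s, 0) = UNIV \<times> Esp P s"
proof
  have sub: "subspace (UNIV \<times> Esp P s :: (real \<times> 'a) set)"
    by (intro subspace_Times subspace_UNIV subspace_Esp)
  show "tangent_space (ident ` graph_of P phi) (s, 0) \<subseteq> UNIV \<times> Esp P s"
    unfolding tangent_space_def
  proof (rule span_minimal[OF _ sub], safe)
    fix x y \<gamma> and e :: real assume "0 < e" "\<gamma> ` {0..e} \<subseteq> ident ` graph_of P phi" "\<gamma> 0 = (s, 0)"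
      "(\<gamma> has_vector_derivative (x, y)) (at 0 within {0..e})"
    then show "y \<in> Esp P s" using tangent_velocity_in_Esp[OF s, of e \<gamma> "(x, y)"] by simp
  qed simp
  have t1: "(1, 0) \<in> tangent_space (ident ` graph_of P phi) (s, 0)"
  proof (rule C1_curve_in_tangent_space[where \<gamma> = "\<lambda>r. (s + r, 0)"])
    show "C1_on {0..1} (\<lambda>r. (s + r, 0::'a))"
      by (intro C1_on_Pair C1_on_add C1_on_const C1_on_bounded_linear bounded_linear_ident)
    show "((\<lambda>r. (s + r, 0::'a)) has_vector_derivative (1, 0)) (at 0 within {0..1})"
      unfolding has_vector_derivative_def by (auto intro!: derivative_eq_intros simp: scaleR_prod_def)
    fix r :: real assume "r \<in> {0..1}"
    then show "(s + r, 0) \<in> ident ` graph_of P phi" using s by (simp add: mem_ident_graph phi_zero)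
  qed (simp add: s)
  have t2: "(0, x) \<in> tangent_space (ident ` graph_of P phi) (s, 0)" if "x \<in> Esp P s" for x
  proof (rule C1_curve_in_tangent_space[where \<gamma> = "\<lambda>r. (s, r *\<^sub>R x + phi (s, r *\<^sub>R x))"])
    have x: "P s x = x" using that Esp_iff[OF s] by simp
    have rx: "P s (r *\<^sub>R x) = r *\<^sub>R x" for r :: real using x by (simp add: blinfun.bilinear_simps)
    have lin: "C1_on {0..1} (\<lambda>r::real. r *\<^sub>R x)"
      by (intro C1_on_bounded_linear bounded_linear_scaleR_left)
    show "C1_on {0..1} (\<lambda>r. (s, r *\<^sub>R x + phi (s, r *\<^sub>R x)))"
      by (intro C1_on_Pair C1_on_add C1_on_const lin C1_on_compose[OF C1_on_Pair phi_C1])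
         (use s rx in \<open>auto simp: Gset_iff\<close>)
    show "(s, r *\<^sub>R x + phi (s, r *\<^sub>R x)) \<in> ident ` graph_of P phi" for r :: real
      using s rx[of r] by (simp add: mem_ident_graph blinfun.bilinear_simps P_phi Q_apply x)
    show "(s, 0 *\<^sub>R x + phi (s, 0 *\<^sub>R x)) = (s, 0)" by (simp add: phi_zero s)
    have "((\<lambda>r. r *\<^sub>R x + phi (s, r *\<^sub>R x)) has_derivative (\<lambda>r. r *\<^sub>R x)) (at 0 within {0..1})"
    proof (rule quadratic_remainder_has_derivative[OF bounded_linear_scaleR_left, where C = "(norm x)\<^sup>2"])
      show "norm (r *\<^sub>R x + phi (s, r *\<^sub>R x) - (0 *\<^sub>R x + phi (s, 0 *\<^sub>R x)) - (r - 0) *\<^sub>R x) \<le> (norm x)\<^sup>2 * (norm (r - 0))\<^sup>2" for r :: real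
        using phi_quadratic[OF s rx[of r]] by (simp add: phi_zero s power_mult_distrib mult.commute)
    qed
    then show "((\<lambda>r. (s, r *\<^sub>R x + phi (s, r *\<^sub>R x))) has_vector_derivative (0, x)) (at 0 within {0..1})"
      unfolding has_vector_derivative_def
      by (rule has_derivative_eq_rhs[OF has_derivative_Pair[OF has_derivative_const]]) (auto simp: scaleR_prod_def)
  qed
  show "(UNIV :: real set) \<times> Esp P s \<subseteq> tangent_space (ident ` graph_of P phi) (s, 0)"
  proof
    fix w :: "real \<times> 'a" assume "w \<in> UNIV \<times> Esp P s"
    then obtain r x where w: "w = (r, x)" "x \<in> Esp P s" by auto
    have st: "subspace (tangent_space (ident ` graph_of P phi) (s, 0))"
      unfolding tangent_space_def by (rule subspace_span)
    have "r *\<^sub>R (1, 0) + (0, x) \<in> tangent_space (ident ` graph_of P phi) (s, 0)"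
      by (intro subspace_add[OF st] subspace_scale[OF st] t1 t2 w)
    then show "w \<in> tangent_space (ident ` graph_of P phi) (s, 0)" by (simp add: w)
  qed
qed

end

section \<open>The smooth stable manifold theorem\<close>

theorem theorem1:
  fixes A :: "real \<Rightarrow> 'a::banach \<Rightarrow>\<^sub>L 'a"
    and T :: "real \<Rightarrow> real \<Rightarrow> 'a \<Rightarrow>\<^sub>L 'a"
    and P :: "real \<Rightarrow> 'a \<Rightarrow>\<^sub>L 'a"
    and \<mu> :: "real \<Rightarrow> real"
    and D a b \<epsilon> :: real
  assumes "C1_on {0..} A"
    and "evolution_operator A T"
    and "growth_rate \<mu>"
    and "mu_dichotomy T \<mu> P D a b \<epsilon>"
    and "\<epsilon> > 0"
    and "a + \<epsilon> < b"
  shows "\<exists>\<delta>\<^sub>0>0. \<forall>\<delta>. 0 < \<delta> \<and> \<delta> \<le> \<delta>\<^sub>0 \<longrightarrow>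
    (\<forall>f :: real \<Rightarrow> 'a \<Rightarrow> 'a. admissible_perturbation \<mu> \<epsilon> \<delta> f \<longrightarrow>
      (\<exists>!\<phi>. \<phi> \<in> Xspace P \<and> invariant_graph A f P \<phi>) \<and>
      (\<forall>\<phi>. \<phi> \<in> Xspace P \<and> invariant_graph A f P \<phi> \<longrightarrow>
        C1_submanifold (ident ` graph_of P \<phi>) \<and>
        (\<forall>s\<ge>0. tangent_space (ident ` graph_of P \<phi>) (s, 0) = UNIV \<times> Esp P s) \<and>
        (\<exists>K>0. \<forall>s\<ge>0. \<forall>\<xi>\<in>Esp P s. \<forall>\<xi>'\<in>Esp P s. \<forall>t\<ge>s.
          sum_norm (flow_on_graph A f P \<phi> t s \<xi> - flow_on_graph A f P \<phi> t s \<xi>')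
            \<le> K * (\<mu> t / \<mu> s) powr a * \<mu> s powr \<epsilon> * norm (\<xi> - \<xi>') \<and>
          flow_on_graph A f P \<phi> t s differentiable (at \<xi> within Esp P s) \<and>
          onorm_on sum_norm (Esp P s)
              (\<lambda>h. dflow_on_graph A f P \<phi> t s \<xi> h - dflow_on_graph A f P \<phi> t s \<xi>' h)
            \<le> K * (\<mu> t / \<mu> s) powr a * \<mu> s powr (2 * \<epsilon>) * norm (\<xi> - \<xi>'))))"
proof -
  interpret mu_dichotomy_system A T P \<mu> D a b \<epsilon> by unfold_locales (fact assms)+
  show ?thesis
  proof (rule exI[of _ "\<epsilon> / (4 * D ^ 3)"], intro conjI allI impI)
    \<comment> \<open>The bound on \<open>\<delta>\<close> amounts to \<open>8 * \<theta> * D\<^sup>2 \<le> 1\<close>.\<close>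
    show "0 < \<epsilon> / (4 * D ^ 3)" using eps_pos D_ge_1 by simp
    fix \<delta> :: real and f :: "real \<Rightarrow> 'a \<Rightarrow> 'a"
    assume \<delta>: "0 < \<delta> \<and> \<delta> \<le> \<epsilon> / (4 * D ^ 3)" and f: "admissible_perturbation \<mu> \<epsilon> \<delta> f"
    interpret perturbed_system A T P \<mu> D a b \<epsilon> \<delta> f by unfold_locales (use \<delta> f in auto)
    show "\<exists>!\<phi>. \<phi> \<in> Xspace P \<and> invariant_graph A f P \<phi>"
      using phi_in_Xspace[OF phi_C1] phi_invariant invariant_Xspace_eq_phi by blast
    fix \<phi> assume "\<phi> \<in> Xspace P \<and> invariant_graph A f P \<phi>"
    then have \<phi>: "\<phi> = phi" using invariant_Xspace_eq_phi by blast
    show "C1_submanifold (ident ` graph_of P \<phi>)" unfolding \<phi> by (rule graph_C1_submanifold)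
    show "tangent_space (ident ` graph_of P \<phi>) (s, 0) = UNIV \<times> Esp P s" if "0 \<le> s" for s
      unfolding \<phi> by (rule graph_tangent_space[OF that])
    show "\<exists>K>0. \<forall>s\<ge>0. \<forall>\<xi>\<in>Esp P s. \<forall>\<xi>'\<in>Esp P s. \<forall>t\<ge>s.
          sum_norm (flow_on_graph A f P \<phi> t s \<xi> - flow_on_graph A f P \<phi> t s \<xi>')
            \<le> K * (\<mu> t / \<mu> s) powr a * \<mu> s powr \<epsilon> * norm (\<xi> - \<xi>') \<and>
          flow_on_graph A f P \<phi> t s differentiable (at \<xi> within Esp P s) \<and>
          onorm_on sum_norm (Esp P s)
              (\<lambda>h. dflow_on_graph A f P \<phi> t s \<xi> h - dflow_on_graph A f P \<phi> t s \<xi>' h)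
            \<le> K * (\<mu> t / \<mu> s) powr a * \<mu> s powr (2 * \<epsilon>) * norm (\<xi> - \<xi>')"
      unfolding \<phi> using flow_on_graph_bounds D_ge_1
      by (intro exI[of _ "2 * D"]) auto
  qed
qed

end
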